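(* Let $M\subset\mathbb{R}^d$ be a polyhedral model set with internal group $H=\mathbb{R}^n$. Then $H^1_{an}(M,\mathbb{R})$ is $n$-dimensional and is contained in $H^1_{max}(M,\mathbb{R})$.
   Context: Model sets. A cut and project scheme $(\Gamma,H,\mathbb{R}^d)$ consists of a locally compact abelian group $H$ and a lattice (discrete cocompact subgroup) $\Gamma\subset H\times\mathbb{R}^d$ such that the projection $\pi^\|:H\times\mathbb{R}^d\to\mathbb{R}^d$ is injective on $\Gamma$ and the projection $\pi^\perp:H\times\mathbb{R}^d\to H$ maps $\Gamma$ densely into $H$. A window is a compact set $W\subset H$ that is the closure of its interior and satisfies: $W+h=W$ implies $h=0$. For $\xi\in (H\times\mathbb{R}^d)/\Gamma$ put $\curlywedge_\xi(W)=\{\pi^\|(\gamma):\gamma\in\Gamma+\xi,\ \pi^\perp(\gamma)\in W\}$; $\xi$ is non-singular if $\pi^\perp(\Gamma+\xi)\cap\partial W=\emptyset$. The hull $\Omega_\Lambda$ of a Delone set $\Lambda$ is the closure of $\{\Lambda-x:x\in\mathbb{R}^d\}$ in a metric in which two Delone sets are close if they agree exactly on a large ball around the origin up to a small translation. The hull of $\curlywedge_\xi(W)$, $\xi$ non-singular, is independent of such $\xi$ and is denoted $\Omega(W)$; a model set with window $W$ is any element of $\Omega(W)$. The map $\curlywedge_\xi(W)\mapsto\xi$ ($\xi$ non-singular) extends to a continuous map $\pi_{max}:\Omega(W)\to(H\times\mathbb{R}^d)/\Gamma$. A model set is polyhedral if $H=\mathbb{R}^n$ and $W$ is a finite disjoint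 union of polyhedra. Pattern equivariance. Let $Y$ be an abelian group (with a metric where needed) and let $\Xi$ be the closure in $\Omega_M$ of $\{M-x:x\in M\}$. A function $F$ on $M$ (or on $\mathbb{R}^d$) with values in a set is strongly pattern equivariant (s.p.e.) if there is $R>0$ such that $F(x_1)=F(x_2)$ whenever $x_1,x_2$ lie in its domain and $M-x_1$, $M-x_2$ agree on $B_R(0)$. $F:M\to Y$ is weakly pattern equivariant (w.p.e.) if there is a continuous $\tilde F:\Xi\to Y$ with $F(x)=\tilde F(M-x)$ for all $x\in M$. The coboundary of $F:M\to Y$ is $\delta F(x,y)=F(y)-F(x)$. A function $\Psi:M\times M\to Y$ is s.p.e. if for some $R_0$, large enough that every ball of radius $R_0/3$ contains a point of $M$, there is $R>0$ such that $\Psi(x_1,y_1)=\Psi(x_2,y_2)$ whenever $|y_i-x_i|\le R_0$, $y_1-x_1=y_2-x_2$ and $M-x_1,M-x_2$ agree on $B_R(0)$. Cohomology. $H^1(M,Y)$ is the group of s.p.e. 1-cocycles with values in $Y$, modulo coboundaries of s.p.e. 0-cochains $M\to Y$, on the CW-complex in $\mathbb{R}^d$ with vertex set $M$ dual to the Voronoi complex of $M$. (Every 1-cocycle is of the form $\delta F$, restricted to edges, for some $F:M\to Y$.) $H^1_{an}(M,\mathbb{R})\subset H^1(M,\mathbb{R})$ consists of the classes $[\delta F]$ with $F:M\to\mathbb{R}$ w.p.e. and $\delta F$ s.p.e. There is a natural isomorphism $\check H^1(\Omega_M,\mathbb{R})\cong H^1(M,\mathbb{R})$ from the Čech cohomology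 of the hull: identify $\check H^1(\Omega_M,\mathbb{Z})$ with the homotopy classes $[\Omega_M,S^1]$; each class has a representative $f$ with $x\mapsto f(M-x)$ s.p.e. on $\mathbb{R}^d$; write $f(M-x)=\exp(2\pi i\tau(x))$ with $\tau:\mathbb{R}^d\to\mathbb{R}$ continuous and send $[f]$ to $[\delta(\tau|_M)]$, then extend $\mathbb{R}$-linearly. $H^1_{max}(M,\mathbb{R})$ is the image of $\pi_{max}^*:H^1((H\times\mathbb{R}^d)/\Gamma,\mathbb{R})\to \check H^1(\Omega_M,\mathbb{R})\cong H^1(M,\mathbb{R})$. *)

theory Defs
  imports "HOL-Analysis.Analysis"
begin

section \<open>Point sets in Euclidean space and their hulls\<close>

definition shift :: "'a::ab_group_add set \<Rightarrow> 'a \<Rightarrow> 'a set" where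
  "shift A x = (\<lambda>y. y - x) ` A"

definition agree :: "real \<Rightarrow> 'a::real_normed_vector set \<Rightarrow> 'a set \<Rightarrow> bool" where
  "agree R A B \<longleftrightarrow> A \<inter> ball 0 R = B \<inter> ball 0 R"

definition delone :: "'a::metric_space set \<Rightarrow> bool" where
  "delone A \<longleftrightarrow> uniform_discrete A \<and> (\<exists>R>0. \<forall>z. A \<inter> ball z R \<noteq> {})"

definition close_sets :: "real \<Rightarrow> 'a::real_normed_vector set \<Rightarrow> 'a set \<Rightarrow> bool" where
  "close_sets e A B \<longleftrightarrow>
     (\<exists>u v. norm u < e \<and> norm v < e \<and> agree (1 / e) (shift A u) (shift B v))"

text \<open>
  Two sets are close if they agree exactly on a large ball around the origin up to small
  translations. The cap \<open>1\<close> makes the triangle inequality hold and does not affect the topology.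
\<close>

definition delone_dist :: "'a::real_normed_vector set \<Rightarrow> 'a set \<Rightarrow> real" where
  "delone_dist A B = Inf (insert 1 {e. 0 < e \<and> close_sets e A B})"

lemma in_shift [simp]: "z \<in> shift A x \<longleftrightarrow> z + x \<in> A"
  unfolding shift_def by (force simp: image_iff algebra_simps)

lemma agreeD: "agree R A B \<Longrightarrow> norm z < R \<Longrightarrow> z \<in> A \<longleftrightarrow> z \<in> B"
  unfolding agree_def by (metis IntI IntD1 mem_ball_0)

lemma close_sets_commute: "close_sets e A B \<longleftrightarrow> close_sets e B A"
  unfolding close_sets_def agree_def by metis

lemma close_sets_trans:
  assumes ab: "0 < a" "0 < b" "a + b < 1" and "close_sets a A B" "close_sets b B C"
  shows "close_sets (a + b) A C"
proof -
  obtain u v where uv: "norm u < a" "norm v < a" "agree (1 / a) (shift A u) (shift B v)"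
    using assms unfolding close_sets_def by blast
  obtain v' w where vw: "norm v' < b" "norm w < b" "agree (1 / b) (shift B v') (shift C w)"
    using assms unfolding close_sets_def by blast
  have arith: "1 / (s + t) + t \<le> 1 / s" if "0 < s" "0 < t" "s + t < 1" for s t :: real
  proof -
    have "1 / s - 1 / (s + t) = t / (s * (s + t))"
      using that by (simp add: field_simps)
    moreover have "s * (s + t) \<le> 1"
      using that by (intro mult_le_one) auto
    then have "t \<le> t / (s * (s + t))"
      using that by (simp add: le_divide_eq)
    ultimately show ?thesis by linarith
  qed
  have "z \<in> shift A (u + v') \<longleftrightarrow> z \<in> shift C (w + v)" if z: "norm z < 1 / (a + b)" for z
  proof -
    have "norm (z + v') < 1 / a"
      using arith[of a b] ab z vw(1) norm_triangle_ineq[of z v'] by linarith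
    then have "z + v' \<in> shift A u \<longleftrightarrow> z + v' \<in> shift B v"
      using agreeD[OF uv(3)] by blast
    moreover have "norm (z + v) < 1 / b"
      using arith[of b a] ab z uv(2) norm_triangle_ineq[of z v] by (simp add: add.commute)
    then have "z + v \<in> shift B v' \<longleftrightarrow> z + v \<in> shift C w"
      using agreeD[OF vw(3)] by blast
    ultimately show ?thesis by (simp add: algebra_simps)
  qed
  then have "agree (1 / (a + b)) (shift A (u + v')) (shift C (w + v))"
    unfolding agree_def by (auto simp del: in_shift)
  moreover have "norm (u + v') < a + b" "norm (w + v) < a + b"
    using uv vw norm_triangle_ineq[of u v'] norm_triangle_ineq[of w v] by linarith+
  ultimately show ?thesis unfolding close_sets_def by blast
qed

lemma bdd_below_close: "bdd_below (insert (1::real) {e. 0 < e \<and> close_sets e A B})"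
  by (rule bdd_belowI[of _ 0]) auto

lemma delone_dist_lessD:
  assumes "delone_dist A B < r" "r \<le> 1"
  obtains e where "0 < e" "e < r" "close_sets e A B"
proof -
  obtain e where "e \<in> insert 1 {e. 0 < e \<and> close_sets e A B}" "e < r"
    using assms(1) unfolding delone_dist_def
    using cInf_lessD[OF insert_not_empty] by blast
  then show ?thesis using that assms(2) by auto
qed

lemma delone_dist_zero_subset:
  fixes A B :: "'a::real_normed_vector set"
  assumes B: "uniform_discrete B" and zero: "delone_dist A B = 0"
  shows "A \<subseteq> B"
proof
  fix a assume a: "a \<in> A"
  obtain r where r: "r > 0" "\<And>x y. x \<in> B \<Longrightarrow> y \<in> B \<Longrightarrow> dist x y < r \<Longrightarrow> x = y"
    using B unfolding uniform_discrete_def by blast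
  have near: "\<exists>b\<in>B. dist a b < s" if "s > 0" for s
  proof -
    define t where "t = Min {1, s / 2, 1 / (norm a + 1)}"
    have t: "0 < t" "t \<le> 1" "t \<le> s / 2" "t \<le> 1 / (norm a + 1)"
      unfolding t_def using that by (auto simp: add_nonneg_pos)
    obtain e where e: "0 < e" "e < t" "close_sets e A B"
      using delone_dist_lessD[of A B t] zero t by auto
    obtain u v where uv: "norm u < e" "norm v < e" "agree (1 / e) (shift A u) (shift B v)"
      using e unfolding close_sets_def by blast
    have "norm a + 1 < 1 / e"
    proof -
      have "e < 1 / (norm a + 1)" using e t by linarith
      moreover have "0 < norm a + 1" by (simp add: add_nonneg_pos)
      ultimately show ?thesis using e(1) by (simp add: field_simps)
    qed
    then have "norm (a - u) < 1 / e"
      using norm_triangle_ineq4[of a u] uv e t by linarith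
    then have "a - u \<in> shift B v"
      using agreeD[OF uv(3)] a by force
    then have "a - u + v \<in> B" by simp
    moreover have "dist a (a - u + v) < s"
      using norm_triangle_ineq4[of u v] uv e t by (simp add: dist_norm)
    ultimately show ?thesis by blast
  qed
  obtain b where b: "b \<in> B" "dist a b < r / 2"
    using near[of "r / 2"] r(1) by auto
  show "a \<in> B"
  proof (cases "a = b")
    case False
    then obtain c where c: "c \<in> B" "dist a c < min (r / 2) (dist a b)"
      using near[of "min (r / 2) (dist a b)"] r(1) by auto
    then have "dist b c < r"
      using b dist_triangle[of b c a] by (simp add: dist_commute)
    then have "b = c" using r(2) b c by blast
    then show ?thesis using c by simp
  qed (use b in simp)
qed

lemma Metric_space_delone:
  "Metric_space {A :: 'a::real_normed_vector set. delone A} delone_dist"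
proof
  show nonneg: "0 \<le> delone_dist A B" for A B :: "'a set"
    unfolding delone_dist_def by (rule cInf_greatest) auto
  show comm: "delone_dist A B = delone_dist B A" for A B :: "'a set"
    unfolding delone_dist_def by (simp add: close_sets_commute)
  show "delone_dist A B = 0 \<longleftrightarrow> A = B"
    if "A \<in> {A. delone A}" "B \<in> {A. delone A}" for A B :: "'a set"
  proof
    assume "delone_dist A B = 0"
    then show "A = B"
      using that delone_dist_zero_subset[of A B] delone_dist_zero_subset[of B A] comm[of A B]
      by (auto simp: delone_def)
  next
    assume "A = B"
    have "delone_dist A B \<le> e" if "e > 0" for e
    proof -
      have "close_sets e A B"
        unfolding close_sets_def agree_def using \<open>A = B\<close> that by (intro exI[of _ 0]) simp
      then show ?thesis
        unfolding delone_dist_def using that bdd_below_close by (intro cInf_lower) auto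
    qed
    then show "delone_dist A B = 0"
      using nonneg[of A B] by (meson dense_ge order_antisym)
  qed
  show "delone_dist A C \<le> delone_dist A B + delone_dist B C" for A B C :: "'a set"
  proof (rule ccontr)
    assume "\<not> ?thesis"
    moreover have le1: "delone_dist A C \<le> 1"
      unfolding delone_dist_def using bdd_below_close by (intro cInf_lower) auto
    ultimately have less: "delone_dist A B + delone_dist B C < delone_dist A C" by simp
    define h where "h = (delone_dist A C - delone_dist A B - delone_dist B C) / 2"
    have h: "h > 0" "delone_dist A B + h + (delone_dist B C + h) = delone_dist A C"
      using less by (auto simp: h_def field_simps)
    obtain a where a: "0 < a" "a < delone_dist A B + h" "close_sets a A B"
      using delone_dist_lessD[of A B "delone_dist A B + h"] h le1 nonneg[of B C] by auto
    obtain b where b: "0 < b" "b < delone_dist B C + h" "close_sets b B C"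
      using delone_dist_lessD[of B C "delone_dist B C + h"] h le1 nonneg[of A B] by auto
    have "close_sets (a + b) A C"
      using close_sets_trans[OF a(1) b(1) _ a(3) b(3)] a b h le1 by linarith
    then have "delone_dist A C \<le> a + b"
      unfolding delone_dist_def using a b bdd_below_close by (intro cInf_lower) auto
    then show False using a b h by linarith
  qed
qed

definition delone_topology :: "'a::real_normed_vector set topology" where
  "delone_topology = Metric_space.mtopology {A. delone A} delone_dist"

definition translation_hull :: "'a::real_normed_vector set \<Rightarrow> 'a set set" where
  "translation_hull A = delone_topology closure_of (range (shift A))"

definition hull_topology :: "'a::real_normed_vector set \<Rightarrow> 'a set topology" where
  "hull_topology A = subtopology delone_topology (translation_hull A)"

section \<open>Cut and project schemes and model sets\<close>

text \<open>
  The elements of \<open>(H \<times> \<real>\<^sup>d)/\<Gamma>\<close> are the cosets themselves, so that the set written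
  \<open>\<Gamma> + \<xi>\<close> in the usual notation is just \<open>\<xi>\<close>.
\<close>

definition coset :: "'g::ab_group_add set \<Rightarrow> 'g \<Rightarrow> 'g set" where
  "coset \<Gamma> z = (\<lambda>\<gamma>. \<gamma> + z) ` \<Gamma>"

definition torus :: "'g::ab_group_add set \<Rightarrow> 'g set set" where
  "torus \<Gamma> = range (coset \<Gamma>)"

definition torus_topology :: "'g::{ab_group_add,topological_space} set \<Rightarrow> 'g set topology" where
  "torus_topology \<Gamma> = topology (\<lambda>U. U \<subseteq> torus \<Gamma> \<and> open (coset \<Gamma> -` U))"

lemma openin_torus_topology:
  "openin (torus_topology \<Gamma>) U \<longleftrightarrow> U \<subseteq> torus \<Gamma> \<and> open (coset \<Gamma> -` U)"
proof -
  have "istopology (\<lambda>U. U \<subseteq> torus \<Gamma> \<and> open (coset \<Gamma> -` U))"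
    unfolding istopology_def by (auto simp: vimage_Union intro!: open_UN)
  then show ?thesis unfolding torus_topology_def by (simp add: topology_inverse')
qed

lemma topspace_torus_topology: "topspace (torus_topology \<Gamma>) = torus \<Gamma>"
proof (rule antisym)
  show "topspace (torus_topology \<Gamma>) \<subseteq> torus \<Gamma>"
    using openin_topspace[of "torus_topology \<Gamma>"] unfolding openin_torus_topology by blast
  have "coset \<Gamma> -` torus \<Gamma> = UNIV" by (auto simp: torus_def)
  then have "openin (torus_topology \<Gamma>) (torus \<Gamma>)" by (simp add: openin_torus_topology)
  then show "torus \<Gamma> \<subseteq> topspace (torus_topology \<Gamma>)" by (rule openin_subset)
qed

lemma quotient_map_coset: "quotient_map euclidean (torus_topology \<Gamma>) (coset \<Gamma>)"
  unfolding quotient_map_def topspace_torus_topology openin_torus_topology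
  by (auto simp: torus_def vimage_def)

definition lattice :: "'g::{ab_group_add,topological_space} set \<Rightarrow> bool" where
  "lattice \<Gamma> \<longleftrightarrow> 0 \<in> \<Gamma> \<and> (\<forall>x\<in>\<Gamma>. \<forall>y\<in>\<Gamma>. x - y \<in> \<Gamma>) \<and>
     discrete \<Gamma> \<and> compact_space (torus_topology \<Gamma>)"

definition cut_and_project_scheme ::
    "('h::{topological_ab_group_add,t2_space} \<times> 'a::euclidean_space) set \<Rightarrow> bool" where
  "cut_and_project_scheme \<Gamma> \<longleftrightarrow>
     locally_compact_space (euclidean :: 'h topology) \<and>
     lattice \<Gamma> \<and> inj_on snd \<Gamma> \<and> closure (fst ` \<Gamma>) = UNIV"

definition window :: "'h::{ab_group_add,topological_space} set \<Rightarrow> bool" where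
  "window W \<longleftrightarrow> compact W \<and> closure (interior W) = W \<and>
     (\<forall>h. (\<lambda>w. w + h) ` W = W \<longrightarrow> h = 0)"

text \<open>The set usually denoted by a curly wedge with index \<open>\<xi>\<close>.\<close>

definition cut :: "'h set \<Rightarrow> ('h \<times> 'a) set \<Rightarrow> 'a set" where
  "cut W \<xi> = {snd \<gamma> |\<gamma>. \<gamma> \<in> \<xi> \<and> fst \<gamma> \<in> W}"

definition nonsingular ::
    "('h::{ab_group_add,topological_space} \<times> 'a::ab_group_add) set \<Rightarrow> 'h set \<Rightarrow>
     ('h \<times> 'a) set \<Rightarrow> bool" where
  "nonsingular \<Gamma> W \<xi> \<longleftrightarrow> \<xi> \<in> torus \<Gamma> \<and> fst ` \<xi> \<inter> frontier W = {}"

text \<open>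
  For a cut and project scheme with window \<open>W\<close> all members of the following union coincide.
\<close>

definition window_hull ::
    "('h::{ab_group_add,topological_space} \<times> 'a::real_normed_vector) set \<Rightarrow> 'h set \<Rightarrow> 'a set set"
  where "window_hull \<Gamma> W = (\<Union>\<xi>\<in>{\<xi>. nonsingular \<Gamma> W \<xi>}. translation_hull (cut W \<xi>))"

definition model_set ::
    "('h::{topological_ab_group_add,t2_space} \<times> 'a::euclidean_space) set \<Rightarrow> 'h set \<Rightarrow>
     'a set \<Rightarrow> bool" where
  "model_set \<Gamma> W M \<longleftrightarrow>
     cut_and_project_scheme \<Gamma> \<and> window W \<and> M \<in> window_hull \<Gamma> W"

definition pi_max ::
    "('h::{ab_group_add,topological_space} \<times> 'a::real_normed_vector) set \<Rightarrow> 'h set \<Rightarrow>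
     'a set \<Rightarrow> ('h \<times> 'a) set" where
  "pi_max \<Gamma> W = (THE p. p \<in> extensional (window_hull \<Gamma> W) \<and>
     continuous_map (subtopology delone_topology (window_hull \<Gamma> W)) (torus_topology \<Gamma>) p \<and>
     (\<forall>\<xi>. nonsingular \<Gamma> W \<xi> \<longrightarrow> p (cut W \<xi>) = \<xi>))"

text \<open>
  Polyhedra are compact and need be neither convex nor connected.
\<close>

definition solid_polyhedron :: "'a::euclidean_space set \<Rightarrow> bool" where
  "solid_polyhedron P \<longleftrightarrow> (\<exists>\<C>. finite \<C> \<and> (\<forall>C\<in>\<C>. polytope C) \<and> P = \<Union>\<C>)"

definition polyhedral_window :: "'a::euclidean_space set \<Rightarrow> bool" where
  "polyhedral_window W \<longleftrightarrow>
     (\<exists>\<P>. finite \<P> \<and> pairwise disjnt \<P> \<and> (\<forall>P\<in>\<P>. solid_polyhedron P) \<and> W = \<Union>\<P>)"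

section \<open>Pattern equivariance\<close>

text \<open>Here \<open>D\<close> is the domain of \<open>F\<close>: either \<open>M\<close> or the whole space.\<close>

definition spe :: "'a::real_normed_vector set \<Rightarrow> 'a set \<Rightarrow> ('a \<Rightarrow> 'y) \<Rightarrow> bool" where
  "spe M D F \<longleftrightarrow>
     (\<exists>R>0. \<forall>x1\<in>D. \<forall>x2\<in>D. agree R (shift M x1) (shift M x2) \<longrightarrow> F x1 = F x2)"

definition transversal :: "'a::real_normed_vector set \<Rightarrow> 'a set set" where
  "transversal M = hull_topology M closure_of (shift M ` M)"

definition wpe :: "'a::real_normed_vector set \<Rightarrow> ('a \<Rightarrow> 'y::topological_space) \<Rightarrow> bool" where
  "wpe M F \<longleftrightarrow>
     (\<exists>F'. continuous_map (subtopology (hull_topology M) (transversal M)) euclidean F' \<and>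
           (\<forall>x\<in>M. F x = F' (shift M x)))"

definition coboundary :: "('a \<Rightarrow> 'y::ab_group_add) \<Rightarrow> 'a \<Rightarrow> 'a \<Rightarrow> 'y" where
  "coboundary F x y = F y - F x"

definition spe2 :: "'a::real_normed_vector set \<Rightarrow> ('a \<Rightarrow> 'a \<Rightarrow> 'y) \<Rightarrow> bool" where
  "spe2 M \<Psi> \<longleftrightarrow>
     (\<exists>R0. (\<forall>z. M \<inter> ball z (R0 / 3) \<noteq> {}) \<and>
       (\<exists>R>0. \<forall>x1\<in>M. \<forall>y1\<in>M. \<forall>x2\<in>M. \<forall>y2\<in>M.
          norm (y1 - x1) \<le> R0 \<and> norm (y2 - x2) \<le> R0 \<and> y1 - x1 = y2 - x2 \<and>
          agree R (shift M x1) (shift M x2) \<longrightarrow> \<Psi> x1 y1 = \<Psi> x2 y2))"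

section \<open>The complex dual to the Voronoi complex\<close>

definition voronoi_cell :: "'a::euclidean_space set \<Rightarrow> 'a \<Rightarrow> 'a set" where
  "voronoi_cell M x = {z. \<forall>y\<in>M. dist z x \<le> dist z y}"

text \<open>
  Nonemptiness matters: the empty set is a face of every convex set and its affine dimension
  is \<open>-1\<close>, which is the dimension asked of duals of 2-cells when the space is a line.
\<close>

definition voronoi_face :: "'a::euclidean_space set \<Rightarrow> int \<Rightarrow> 'a set \<Rightarrow> bool" where
  "voronoi_face M k G \<longleftrightarrow> G \<noteq> {} \<and> aff_dim G = k \<and> (\<exists>x\<in>M. G face_of voronoi_cell M x)"

text \<open>The vertices of the cell dual to the Voronoi face \<open>G\<close>:\<close>

definition dual_vertices :: "'a::euclidean_space set \<Rightarrow> 'a set \<Rightarrow> 'a set" where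
  "dual_vertices M G = {x \<in> M. G \<subseteq> voronoi_cell M x}"

definition dual_edge :: "'a::euclidean_space set \<Rightarrow> 'a \<Rightarrow> 'a \<Rightarrow> bool" where
  "dual_edge M x y \<longleftrightarrow> x \<noteq> y \<and>
     (\<exists>G. voronoi_face M (int DIM('a) - 1) G \<and> dual_vertices M G = {x, y})"

text \<open>
  A list of vertices that runs once around the boundary polygon of the 2-cell dual to \<open>G\<close>.
\<close>

definition boundary_cycle :: "'a::euclidean_space set \<Rightarrow> 'a set \<Rightarrow> 'a list \<Rightarrow> bool" where
  "boundary_cycle M G xs \<longleftrightarrow> voronoi_face M (int DIM('a) - 2) G \<and>
     distinct xs \<and> set xs = dual_vertices M G \<and>
     (\<forall>i<length xs. dual_edge M (xs ! i) (xs ! (Suc i mod length xs)))"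

section \<open>Pattern equivariant cohomology in degree one\<close>

text \<open>
  A cellular 1-cochain is given by its values on oriented edges. It is encoded as a function of
  the two endpoints, antisymmetric, with value \<open>0\<close> on pairs that do not span an edge.
\<close>

definition on_edges :: "'a::euclidean_space set \<Rightarrow> ('a \<Rightarrow> 'a \<Rightarrow> 'y::zero) \<Rightarrow> 'a \<Rightarrow> 'a \<Rightarrow> 'y" where
  "on_edges M \<Psi> x y = (if dual_edge M x y then \<Psi> x y else 0)"

definition cochain1 :: "'a::euclidean_space set \<Rightarrow> ('a \<Rightarrow> 'a \<Rightarrow> 'y::ab_group_add) \<Rightarrow> bool" where
  "cochain1 M \<alpha> \<longleftrightarrow> on_edges M \<alpha> = \<alpha> \<and> (\<forall>x y. \<alpha> y x = - \<alpha> x y)"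

definition spe_cochain1 :: "'a::euclidean_space set \<Rightarrow> ('a \<Rightarrow> 'a \<Rightarrow> 'y::ab_group_add) \<Rightarrow> bool" where
  "spe_cochain1 M \<alpha> \<longleftrightarrow> cochain1 M \<alpha> \<and>
     (\<exists>R>0. \<forall>x1 y1 x2 y2. dual_edge M x1 y1 \<and> dual_edge M x2 y2 \<and> y1 - x1 = y2 - x2 \<and>
        agree R (shift M x1) (shift M x2) \<longrightarrow> \<alpha> x1 y1 = \<alpha> x2 y2)"

definition spe_cocycles1 :: "'a::euclidean_space set \<Rightarrow> ('a \<Rightarrow> 'a \<Rightarrow> 'y::ab_group_add) set" where
  "spe_cocycles1 M = {\<alpha>. spe_cochain1 M \<alpha> \<and>
     (\<forall>G xs. boundary_cycle M G xs \<longrightarrow>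
        (\<Sum>i<length xs. \<alpha> (xs ! i) (xs ! (Suc i mod length xs))) = 0)}"

definition coh_class ::
    "'a::euclidean_space set \<Rightarrow> ('a \<Rightarrow> 'a \<Rightarrow> 'y::ab_group_add) \<Rightarrow> ('a \<Rightarrow> 'a \<Rightarrow> 'y) set" where
  "coh_class M \<alpha> =
     {(\<lambda>x y. \<alpha> x y + on_edges M (coboundary F) x y) |F. spe M M F}"

definition H1 :: "'a::euclidean_space set \<Rightarrow> ('a \<Rightarrow> 'a \<Rightarrow> 'y::ab_group_add) set set" where
  "H1 M = coh_class M ` spe_cocycles1 M"

definition H1_an :: "'a::euclidean_space set \<Rightarrow> ('a \<Rightarrow> 'a \<Rightarrow> real) set set" where
  "H1_an M = {c \<in> H1 M. \<exists>F. wpe M F \<and> spe2 M (coboundary F) \<and>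
     c = coh_class M (on_edges M (coboundary F))}"

text \<open>
  The set \<open>V\<close> of classes is an \<open>n\<close>-dimensional linear subspace of \<open>H1 M\<close>: there are \<open>n\<close> classes
  such that every element of \<open>V\<close> is a unique linear combination of them, and all their
  linear combinations lie in \<open>V\<close>.
\<close>

definition has_coh_dim ::
    "'a::euclidean_space set \<Rightarrow> ('a \<Rightarrow> 'a \<Rightarrow> real) set set \<Rightarrow> nat \<Rightarrow> bool" where
  "has_coh_dim M V n \<longleftrightarrow>
     (\<exists>b. (\<forall>i<n. b i \<in> spe_cocycles1 M) \<and>
        bij_betw (\<lambda>c. coh_class M (\<lambda>x y. \<Sum>i<n. c i * b i x y)) ({..<n} \<rightarrow>\<^sub>E UNIV) V)"

section \<open>The image of the cohomology of the torus\<close>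

abbreviation circle :: "complex topology" where
  "circle \<equiv> top_of_set (sphere 0 1)"

text \<open>
  \<open>bruschlinsky_lift M f \<tau>\<close>: the isomorphism from the Cech cohomology of the hull to the
  pattern equivariant cohomology sends the homotopy class of \<open>f\<close>, as an element of the integral
  first cohomology, to the class of the coboundary of \<open>\<tau>\<close> restricted to \<open>M\<close>.
\<close>

definition bruschlinsky_lift ::
    "'a::real_normed_vector set \<Rightarrow> ('a set \<Rightarrow> complex) \<Rightarrow> ('a \<Rightarrow> real) \<Rightarrow> bool" where
  "bruschlinsky_lift M f \<tau> \<longleftrightarrow> continuous_on UNIV \<tau> \<and>
     (\<exists>f'. homotopic_with (\<lambda>_. True) (hull_topology M) circle f f' \<and>
           spe M UNIV (\<lambda>x. f' (shift M x)) \<and>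
           (\<forall>x. f' (shift M x) = exp (2 * of_real pi * \<i> * of_real (\<tau> x))))"

text \<open>
  For the compact spaces in question, real first Cech cohomology is the tensor product of the
  group of homotopy classes of maps to the circle with \<open>\<real>\<close>, so its elements are finite real linear
  combinations of such classes. The map induced by \<open>pi_max\<close> is composition with \<open>pi_max\<close>.
\<close>

definition H1_max ::
    "('h::{topological_ab_group_add,t2_space} \<times> 'a::euclidean_space) set \<Rightarrow> 'h set \<Rightarrow> 'a set \<Rightarrow>
     ('a \<Rightarrow> 'a \<Rightarrow> real) set set" where
  "H1_max \<Gamma> W M =
     {coh_class M (\<lambda>x y. \<Sum>k<m. r k * on_edges M (coboundary (\<tau> k)) x y) | (m::nat) r g \<tau>.
        \<forall>k<m. continuous_map (torus_topology \<Gamma>) circle (g k) \<and>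
              bruschlinsky_lift M (g k \<circ> pi_max \<Gamma> W) (\<tau> k)}"

end

theory Submission
  imports Defs "HOL-Library.Diagonal_Subsequence"
begin

text \<open>
  A point \<open>\<gamma>\<close> of the lattice has an internal part \<open>fst \<gamma>\<close> and a physical part \<open>snd \<gamma>\<close>. Every point
  \<open>x\<close> of \<open>M\<close> has a \<open>star\<close> in the window: the point \<open>h\<close> for which \<open>M\<close> is, up to points over the boundary
  of the window, the cut at \<open>(h, x)\<close>. Since no translation preserves the window, \<open>h\<close> is unique, and
  compactness makes it depend continuously on \<open>M - x\<close> (\<open>star_tendsto\<close>). Over a difference \<open>y - x\<close> of
  points of \<open>M\<close> there is only one lattice vector, \<open>(star M y - star M x, y - x)\<close>. Hence for every vector
  \<open>l\<close> of the internal space the function \<open>x \<mapsto> l \<bullet> star M x\<close> is weakly pattern equivariant and its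
  coboundary is strongly pattern equivariant. The theorem says that the classes of these functions
  are all of \<open>H1_an M\<close>, that they are distinct for distinct \<open>l\<close>, and that they come from the torus.

  They are all of \<open>H1_an M\<close>. Let \<open>F\<close> be weakly pattern equivariant with strongly pattern equivariant
  coboundary. Patterns of \<open>M\<close> around \<open>x\<close> are determined by the position of \<open>star M x\<close> relative to
  translates of the walls of the window by internal parts of lattice vectors, so \<open>F\<close> has a limit
  \<open>phi h\<close> as \<open>star M x\<close> tends to a point \<open>h\<close> off all these translates. An increment
  \<open>phi (h + fst \<gamma>) - phi h\<close> changes only at finitely many of them (\<open>phi_increment\<close>), but their number
  grows with \<open>\<gamma>\<close>. The main point (\<open>no_jump_exists\<close>) is that \<open>phi\<close> itself does not jump across any wall
  except for translates by lattice vectors from a fixed finite set: patterns on the two sides of another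
  wall differ only far away from the origin, close to a translate of a linear subspace, and one can walk
  in the opposite direction until the two patterns agree on a ball as large as one likes, while \<open>F\<close>
  changes by the same amount on both sides. So the increments are constant on the cells of a
  finite arrangement of walls (\<open>increment_constant\<close>). This makes them locally additive, hence linear,
  \<open>fst \<gamma> \<mapsto> l \<bullet> fst \<gamma>\<close>, for small \<open>fst \<gamma>\<close>; consequently \<open>phi h - l \<bullet> h\<close> takes one value on each cell, and
  \<open>F - l \<bullet> star M\<close> has finitely many values (\<open>finite_values_minus_linear\<close>). A weakly pattern equivariant
  function with finitely many values is strongly pattern equivariant, so \<open>F\<close> and \<open>l \<bullet> star M\<close> have
  cohomologous coboundaries.

  They are distinct. The graph dual to the Voronoi complex is connected (\<open>constant_on_edges\<close>), so if
  \<open>l\<close> and \<open>l'\<close> define the same class, then \<open>(l - l') \<bullet> star M\<close> is strongly pattern equivariant up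
  to a constant and has finitely many values. The stars are dense in the window, so \<open>l = l'\<close>.

  They come from the torus. A vector \<open>a\<close> with integral inner products with the lattice gives the
  character \<open>z \<mapsto> cis (2 * pi * (a \<bullet> z))\<close> of the torus. Its class in the cohomology of the hull is the
  class of \<open>x \<mapsto> - (a \<bullet> (star M x, x))\<close> (\<open>character_lift\<close>). Such vectors \<open>a\<close> span the space
  (\<open>lattice_dual_span\<close>), and a linear combination of them that equals \<open>(- l, 0)\<close> yields \<open>l \<bullet> star M\<close>.
\<close>

section \<open>Subgroups of vector spaces\<close>

lemma subgroup_of_nat_scale:
  fixes N :: "'v::real_vector set"
  assumes "0 \<in> N" "\<And>x y. x \<in> N \<Longrightarrow> y \<in> N \<Longrightarrow> x - y \<in> N" "v \<in> N"
  shows "real n *\<^sub>R v \<in> N"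
proof (induction n)
  case 0
  then show ?case using assms by simp
next
  case (Suc n)
  have "- v \<in> N" using assms(2)[OF assms(1,3)] by simp
  then have "real n *\<^sub>R v - (- v) \<in> N" using assms(2) Suc by blast
  then show ?case by (simp add: algebra_simps)
qed

lemma subgroup_of_int_scale:
  fixes N :: "'v::real_vector set"
  assumes "0 \<in> N" "\<And>x y. x \<in> N \<Longrightarrow> y \<in> N \<Longrightarrow> x - y \<in> N" "v \<in> N"
  shows "of_int k *\<^sub>R v \<in> N"
proof (cases "k \<ge> 0")
  case True
  then show ?thesis using subgroup_of_nat_scale[OF assms, of "nat k"] by simp
next
  case False
  then have "0 - real (nat (- k)) *\<^sub>R v \<in> N"
    using subgroup_of_nat_scale[OF assms, of "nat (- k)"] assms(1,2) by blast
  then show ?thesis using False by simp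
qed

lemma subgroup_int_combination:
  fixes N :: "'v::real_vector set"
  assumes "0 \<in> N" "\<And>x y. x \<in> N \<Longrightarrow> y \<in> N \<Longrightarrow> x - y \<in> N" "finite B" "B \<subseteq> N"
  shows "(\<Sum>b\<in>B. of_int (k b) *\<^sub>R b) \<in> N"
  using assms(3,4)
proof (induction B rule: finite_induct)
  case empty
  then show ?case using assms(1) by simp
next
  case (insert b B)
  have "of_int (k b) *\<^sub>R b \<in> N" using subgroup_of_int_scale[OF assms(1,2)] insert.prems by blast
  moreover have "0 - (\<Sum>b\<in>B. of_int (k b) *\<^sub>R b) \<in> N"
    using assms(1,2) insert.IH insert.prems by blast
  ultimately have "of_int (k b) *\<^sub>R b - (0 - (\<Sum>b\<in>B. of_int (k b) *\<^sub>R b)) \<in> N"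
    using assms(2) by blast
  then show ?case using insert.hyps by simp
qed

text \<open>
  Coordinates with respect to a basis of the span that consists of elements of \<open>N\<close> can be rounded
  to integers.
\<close>

lemma subgroup_span_cobounded:
  fixes N :: "'v::euclidean_space set"
  assumes "0 \<in> N" "\<And>x y. x \<in> N \<Longrightarrow> y \<in> N \<Longrightarrow> x - y \<in> N"
  obtains \<kappa> where "\<kappa> \<ge> 0" "\<And>v. v \<in> span N \<Longrightarrow> \<exists>\<sigma>\<in>N. norm (v - \<sigma>) \<le> \<kappa>"
proof -
  obtain B where B: "B \<subseteq> N" "independent B" "N \<subseteq> span B"
    using maximal_independent_subset by blast
  have fin: "finite B" using B(2) by (rule independent_imp_finite)
  have spanB: "span N = span B" using B(1,3) by (metis span_eq span_mono span_superset subset_trans)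
  define \<kappa> where "\<kappa> = (\<Sum>b\<in>B. norm b)"
  have "\<exists>\<sigma>\<in>N. norm (v - \<sigma>) \<le> \<kappa>" if v: "v \<in> span N" for v
  proof -
    define \<mu> where "\<mu> = representation B v"
    have v_eq: "(\<Sum>b\<in>B. \<mu> b *\<^sub>R b) = v"
      unfolding \<mu>_def using sum_representation_eq[OF B(2) _ fin order_refl] v spanB by blast
    define \<sigma> where "\<sigma> = (\<Sum>b\<in>B. of_int \<lfloor>\<mu> b\<rfloor> *\<^sub>R b)"
    have "\<sigma> \<in> N" unfolding \<sigma>_def using subgroup_int_combination[OF assms fin B(1)] .
    moreover have "v - \<sigma> = (\<Sum>b\<in>B. frac (\<mu> b) *\<^sub>R b)"
      unfolding \<sigma>_def v_eq[symmetric] frac_def by (simp add: sum_subtractf scaleR_diff_left)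
    then have "norm (v - \<sigma>) \<le> \<kappa>"
      unfolding \<kappa>_def
      by (auto intro!: sum_norm_le simp: frac_ge_0 less_imp_le[OF frac_lt_1] mult_left_le_one_le)
    ultimately show ?thesis by blast
  qed
  moreover have "\<kappa> \<ge> 0" unfolding \<kappa>_def by (simp add: sum_nonneg)
  ultimately show ?thesis using that by blast
qed


section \<open>Locally additive functions on dense subgroups\<close>

lemma linear_functional_inner:
  fixes f :: "'g::euclidean_space \<Rightarrow> real"
  assumes "linear f"
  shows "f v = (\<Sum>i\<in>Basis. f i *\<^sub>R i) \<bullet> v"
proof -
  have "f v = f (\<Sum>i\<in>Basis. (v \<bullet> i) *\<^sub>R i)" by (simp add: euclidean_representation)
  also have "\<dots> = (\<Sum>i\<in>Basis. (v \<bullet> i) * f i)"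
    using assms by (simp add: linear_sum linear_scale)
  also have "\<dots> = (\<Sum>i\<in>Basis. f i *\<^sub>R i) \<bullet> v"
    unfolding inner_sum_left inner_scaleR_left
    by (intro sum.cong refl) (metis inner_commute mult.commute)
  finally show ?thesis .
qed

text \<open>
  A subspace is closed, so the span contains the closure of \<open>G \<inter> ball 0 r\<close>, which contains the ball.
\<close>

lemma dense_span_small:
  fixes G :: "'h::euclidean_space set"
  assumes dense: "closure G = UNIV" and r: "r > 0"
  shows "span (G \<inter> ball 0 r) = UNIV"
proof -
  have "ball 0 r \<subseteq> closure (G \<inter> ball 0 r)"
    using open_Int_closure_subset[of "ball 0 r" G] dense by (simp add: Int_commute)
  also have "\<dots> \<subseteq> closure (span (G \<inter> ball 0 r))"
    by (intro closure_mono span_superset)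
  also have "\<dots> = span (G \<inter> ball 0 r)"
    by (simp add: closed_subspace)
  finally have sub: "ball 0 r \<subseteq> span (G \<inter> ball 0 r)" .
  have "v \<in> span (G \<inter> ball 0 r)" for v
  proof (cases "v = 0")
    case True
    then show ?thesis by (simp add: span_zero)
  next
    case False
    have "(r / (2 * norm v)) *\<^sub>R v \<in> ball 0 r" using False r by simp
    then have "(2 * norm v / r) *\<^sub>R (r / (2 * norm v)) *\<^sub>R v \<in> span (G \<inter> ball 0 r)"
      using sub by (blast intro: span_scale)
    then show ?thesis using False r by simp
  qed
  then show ?thesis by blast
qed

text \<open>
  Partial sums, taken starting from \<open>w\<close>, never leave the ball in which \<open>c\<close> is additive.
\<close>

lemma locally_additive_sum:
  fixes c :: "'h::euclidean_space \<Rightarrow> real"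
  assumes G: "\<And>u v. u \<in> G \<Longrightarrow> v \<in> G \<Longrightarrow> u + v \<in> G" "\<And>u. u \<in> G \<Longrightarrow> - u \<in> G" "0 \<in> G"
    and add: "\<And>u v. u \<in> G \<Longrightarrow> v \<in> G \<Longrightarrow> norm u < r \<Longrightarrow> norm v < r \<Longrightarrow> norm (u + v) < r \<Longrightarrow>
                c (u + v) = c u + c v"
    and B: "finite B" "B \<subseteq> G" "\<And>b. b \<in> B \<Longrightarrow> c b = 0" "(\<Sum>b\<in>B. norm b) < r / 2"
    and m: "\<And>b. b \<in> B \<Longrightarrow> m b \<in> {-1, 0, 1 :: real}"
    and w: "w \<in> G" "norm w < r / 2"
  shows "w + (\<Sum>b\<in>B. m b *\<^sub>R b) \<in> G \<and> c (w + (\<Sum>b\<in>B. m b *\<^sub>R b)) = c w"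
  using B m
proof (induction B rule: finite_induct)
  case empty
  then show ?case using w by simp
next
  case (insert b B)
  define S where "S = w + (\<Sum>b\<in>B. m b *\<^sub>R b)"
  have sums: "norm b + (\<Sum>b\<in>B. norm b) < r / 2" using insert by simp
  have r0: "r > 0" using w(2) norm_ge_zero[of w] by linarith
  have nb: "(\<Sum>b\<in>B. norm b) < r / 2" using sums norm_ge_zero[of b] by linarith
  have IH: "S \<in> G" "c S = c w" using insert.IH insert.prems nb unfolding S_def by auto
  have mm: "norm (m x *\<^sub>R x) \<le> norm x" if "x \<in> insert b B" for x
    using insert.prems(4)[OF that] by auto
  have nS': "norm (\<Sum>b\<in>B. m b *\<^sub>R b) \<le> (\<Sum>b\<in>B. norm b)"
    by (intro sum_norm_le) (use mm in auto)
  have nS: "norm S < r"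
    using norm_triangle_ineq[of w "\<Sum>b\<in>B. m b *\<^sub>R b"] nS' nb w(2) unfolding S_def by linarith
  have nmb: "norm (m b *\<^sub>R b) < r"
  proof -
    have "norm (m b *\<^sub>R b) \<le> norm b" using mm by simp
    also have "\<dots> < r" using sums sum_nonneg[of B norm] r0 by auto
    finally show ?thesis .
  qed
  have nSb: "norm (S + m b *\<^sub>R b) < r"
    using norm_triangle_ineq[of w "\<Sum>b\<in>B. m b *\<^sub>R b"] norm_triangle_ineq[of S "m b *\<^sub>R b"]
      nS' mm[of b] w(2) sums unfolding S_def by auto
  have nb': "norm b < r" using sums sum_nonneg[of B norm] r0 by auto
  have c0: "c 0 = 0" using add[of 0 0] G r0 by simp
  have cneg: "c (- b) = 0"
    using add[of b "- b"] insert.prems nb' c0 G r0 by simp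
  have mb: "m b *\<^sub>R b \<in> G" "c (m b *\<^sub>R b) = 0"
    using insert.prems(4)[of b] insert.prems(1,2) G c0 cneg by auto
  have "c (S + m b *\<^sub>R b) = c S"
    using add[OF IH(1) mb(1) nS nmb nSb] mb by simp
  moreover have "w + (\<Sum>b\<in>insert b B. m b *\<^sub>R b) = S + m b *\<^sub>R b"
    using insert by (simp add: S_def algebra_simps)
  ultimately show ?case using IH mb G by auto
qed

lemma representation_bounded:
  fixes B :: "'h::euclidean_space set"
  assumes "independent B" "span B = UNIV"
  shows "\<exists>K>0. \<forall>v. \<forall>b\<in>B. \<bar>representation B v b\<bar> \<le> K * norm v"
proof -
  have fin: "finite B" using assms(1) by (rule independent_imp_finite)
  have "\<exists>K. \<forall>v. \<bar>representation B v b\<bar> \<le> norm v * K" for b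
  proof -
    have "linear (\<lambda>v. representation B v b)"
      by (rule linearI) (use assms in \<open>auto simp: representation_add representation_scale\<close>)
    then have "bounded_linear (\<lambda>v. representation B v b)" by (rule linear_linear[THEN iffD2])
    then show ?thesis using bounded_linear.bounded by fastforce
  qed
  then obtain K where K: "\<And>b v. \<bar>representation B v b\<bar> \<le> norm v * K b" by metis
  define K' where "K' = 1 + (\<Sum>b\<in>B. \<bar>K b\<bar>)"
  have "\<bar>representation B v b\<bar> \<le> K' * norm v" if "b \<in> B" for v b
  proof -
    have "K b \<le> (\<Sum>b\<in>B. \<bar>K b\<bar>)"
      using member_le_sum[of b B "\<lambda>b. \<bar>K b\<bar>"] that fin by auto
    then have "K b \<le> K'" by (simp add: K'_def)
    then have "norm v * K b \<le> K' * norm v" by (simp add: mult.commute mult_right_mono)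
    then show ?thesis using K[of v b] by linarith
  qed
  moreover have "K' > 0" unfolding K'_def by (simp add: add_pos_nonneg sum_nonneg)
  ultimately show ?thesis by blast
qed

text \<open>
  Let \<open>f\<close> be the linear form that agrees with \<open>c\<close> on a basis of short vectors of \<open>G\<close>. If \<open>c - f\<close> did not
  vanish at some short \<open>v\<close>, then it would grow linearly along the multiples of \<open>v\<close>. But these can be brought
  back to a bounded set by adding basis vectors, which does not change the value of \<open>c - f\<close>.
\<close>

lemma locally_additive_imp_linear:
  fixes c :: "'h::euclidean_space \<Rightarrow> real"
  assumes G: "\<And>u v. u \<in> G \<Longrightarrow> v \<in> G \<Longrightarrow> u + v \<in> G" "\<And>u. u \<in> G \<Longrightarrow> - u \<in> G" "0 \<in> G"
    and dense: "closure G = UNIV" and r: "r > 0"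
    and add: "\<And>u v. u \<in> G \<Longrightarrow> v \<in> G \<Longrightarrow> norm u < r \<Longrightarrow> norm v < r \<Longrightarrow> norm (u + v) < r \<Longrightarrow>
                c (u + v) = c u + c v"
    and bdd: "\<And>u. u \<in> G \<Longrightarrow> norm u < r \<Longrightarrow> \<bar>c u\<bar> \<le> K"
  shows "\<exists>l. \<exists>r'>0. \<forall>v\<in>G. norm v < r' \<longrightarrow> c v = l \<bullet> v"
proof -
  define r1 where "r1 = r / (2 * (real DIM('h) + 1))"
  have r1: "r1 > 0" using r by (simp add: r1_def)
  obtain B where B: "B \<subseteq> G \<inter> ball 0 r1" "independent B" "G \<inter> ball 0 r1 \<subseteq> span B"
    using maximal_independent_subset by blast
  have spanB: "span B = UNIV"
    using dense_span_small[OF dense r1] B(3) by (metis span_eq span_span span_mono top.extremum_uniqueI)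
  have finB: "finite B" using B(2) by (rule independent_imp_finite)
  have rho: "(\<Sum>b\<in>B. norm b) < r / 2"
  proof -
    have "(\<Sum>b\<in>B. norm b) \<le> (\<Sum>b\<in>B. r1)"
      by (intro sum_mono) (use B(1) in \<open>auto simp: less_imp_le\<close>)
    also have "\<dots> \<le> real DIM('h) * r1"
      using B(2) independent_bound[of B] r1 by (simp add: mult_right_mono)
    also have "\<dots> < r / 2" using r unfolding r1_def by (simp add: field_simps)
    finally show ?thesis .
  qed
  obtain f where f: "linear f" "\<And>b. b \<in> B \<Longrightarrow> f b = c b"
    using linear_independent_extend[OF B(2)] by metis
  obtain Kf where Kf: "\<And>x. \<bar>f x\<bar> \<le> norm x * Kf"
    using f(1) linear_linear bounded_linear.bounded by (metis real_norm_def)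
  define c' where "c' v = c v - f v" for v
  have add': "c' (u + v) = c' u + c' v"
    if "u \<in> G" "v \<in> G" "norm u < r" "norm v < r" "norm (u + v) < r" for u v
    using add[OF that] f(1) by (simp add: c'_def linear_add)
  have c'B: "c' b = 0" if "b \<in> B" for b using f(2)[OF that] by (simp add: c'_def)
  define K' where "K' = K + r * \<bar>Kf\<bar>"
  have bdd': "\<bar>c' u\<bar> \<le> K'" if "u \<in> G" "norm u < r" for u
  proof -
    have "norm u * Kf \<le> norm u * \<bar>Kf\<bar>" by (intro mult_left_mono) auto
    also have "\<dots> \<le> r * \<bar>Kf\<bar>" using that(2) by (intro mult_right_mono) auto
    finally have "norm u * Kf \<le> r * \<bar>Kf\<bar>" .
    moreover have "\<bar>c' u\<bar> \<le> \<bar>c u\<bar> + \<bar>f u\<bar>" unfolding c'_def by linarith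
    ultimately show ?thesis using Kf[of u] bdd[OF that] unfolding K'_def by linarith
  qed
  obtain Kr where Kr: "Kr > 0" "\<And>v b. b \<in> B \<Longrightarrow> \<bar>representation B v b\<bar> \<le> Kr * norm v"
    using representation_bounded[OF B(2) spanB] by blast
  define r' where "r' = min (r / 2) (1 / Kr)"
  have r': "r' > 0" using r Kr by (simp add: r'_def)
  have "c' v = 0" if v: "v \<in> G" "norm v < r'" for v
  proof -
    define \<mu> where "\<mu> = representation B v"
    have \<mu>1: "\<bar>\<mu> b\<bar> < 1" if "b \<in> B" for b
    proof -
      have "\<bar>\<mu> b\<bar> \<le> Kr * norm v" using Kr(2)[OF that] by (simp add: \<mu>_def)
      also have "\<dots> < 1" using v(2) Kr(1) by (simp add: r'_def field_simps)
      finally show ?thesis .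
    qed
    have veq: "v = (\<Sum>b\<in>B. \<mu> b *\<^sub>R b)"
      unfolding \<mu>_def using B(2) spanB finB by (simp add: sum_representation_eq)
    \<comment> \<open>The multiples of \<open>v\<close>, reduced modulo the lattice spanned by \<open>B\<close>, stay in a small
        parallelepiped, so \<open>c'\<close> stays bounded on them, although it grows linearly.\<close>
    define w where "w k = (\<Sum>b\<in>B. frac (real k * \<mu> b) *\<^sub>R b)" for k
    have nw: "norm (w k) < r / 2" for k
    proof -
      have "norm (w k) \<le> (\<Sum>b\<in>B. norm b)"
        unfolding w_def
        by (intro sum_norm_le) (auto simp: frac_ge_0 less_imp_le[OF frac_lt_1] mult_left_le_one_le)
      then show ?thesis using rho by linarith
    qed
    have step: "w k \<in> G \<and> c' (w k) = real k * c' v" for k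
    proof (induction k)
      case 0
      have "c' 0 = 0" using add'[of 0 0] G r by simp
      then show ?case using G by (simp add: w_def)
    next
      case (Suc k)
      define m where "m b = real_of_int (\<lfloor>real k * \<mu> b\<rfloor> - \<lfloor>real (Suc k) * \<mu> b\<rfloor>)" for b
      have m: "m b \<in> {-1, 0, 1}" if "b \<in> B" for b
      proof -
        have e: "real (Suc k) * \<mu> b = real k * \<mu> b + \<mu> b" by (simp add: algebra_simps)
        have "\<lfloor>real (Suc k) * \<mu> b\<rfloor> \<le> \<lfloor>real k * \<mu> b\<rfloor> + 1" "\<lfloor>real k * \<mu> b\<rfloor> \<le> \<lfloor>real (Suc k) * \<mu> b\<rfloor> + 1"
          using \<mu>1[OF that] unfolding e by linarith+
        then have "\<lfloor>real k * \<mu> b\<rfloor> - \<lfloor>real (Suc k) * \<mu> b\<rfloor> \<in> {-1, 0, 1}" by auto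
        then show ?thesis unfolding m_def by auto
      qed
      have weq: "w (Suc k) = (w k + v) + (\<Sum>b\<in>B. m b *\<^sub>R b)"
      proof -
        have "w k + v + (\<Sum>b\<in>B. m b *\<^sub>R b) =
          (\<Sum>b\<in>B. frac (real k * \<mu> b) *\<^sub>R b + \<mu> b *\<^sub>R b + m b *\<^sub>R b)"
          by (subst (1) veq) (simp add: w_def sum.distrib)
        also have "\<dots> = (\<Sum>b\<in>B. frac (real (Suc k) * \<mu> b) *\<^sub>R b)"
          by (intro sum.cong refl) (simp add: m_def frac_def algebra_simps flip: scaleR_add_left)
        finally show ?thesis by (simp add: w_def)
      qed
      have Suc1: "w k \<in> G" "c' (w k) = real k * c' v" using Suc by auto
      have c0: "c' 0 = 0" using add'[of 0 0] G r by simp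
      \<comment> \<open>The lattice correction is added to \<open>w k\<close> first, so that all partial sums stay small.\<close>
      have s: "w k + (\<Sum>b\<in>B. m b *\<^sub>R b) \<in> G"
          "c' (w k + (\<Sum>b\<in>B. m b *\<^sub>R b)) = c' (w k)"
        using locally_additive_sum[of G r c' B m "w k", OF G add' finB _ c'B rho m Suc1(1) nw] B(1)
        by blast+
      have nsum: "norm (w k + (\<Sum>b\<in>B. m b *\<^sub>R b)) < r"
      proof -
        have "norm (\<Sum>b\<in>B. m b *\<^sub>R b) \<le> (\<Sum>b\<in>B. norm b)"
          by (intro sum_norm_le) (use m in force)
        then show ?thesis
          using nw[of k] rho norm_triangle_ineq[of "w k" "\<Sum>b\<in>B. m b *\<^sub>R b"] by linarith
      qed
      have nv: "norm v < r" using v(2) r by (simp add: r'_def)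
      have weq': "w (Suc k) = (w k + (\<Sum>b\<in>B. m b *\<^sub>R b)) + v" using weq by (simp add: algebra_simps)
      have "norm (w (Suc k)) < r" using nw[of "Suc k"] r by linarith
      then have "c' (w (Suc k)) = c' (w k) + c' v"
        using add'[OF s(1) v(1) nsum nv] s(2) unfolding weq' by simp
      moreover have "w (Suc k) \<in> G" unfolding weq' by (rule G(1)[OF s(1) v(1)])
      ultimately show ?case using Suc1 by (simp add: algebra_simps)
    qed
    have bound: "real k * \<bar>c' v\<bar> \<le> K'" for k
      using bdd'[of "w k"] step[of k] nw[of k] r by (simp add: abs_mult)
    show "c' v = 0"
    proof (rule ccontr)
      assume "c' v \<noteq> 0"
      then obtain k where "K' < real k * \<bar>c' v\<bar>"
        using reals_Archimedean3[of "\<bar>c' v\<bar>"] by auto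
      then show False using bound[of k] by linarith
    qed
  qed
  moreover have "f v = (\<Sum>i\<in>Basis. f i *\<^sub>R i) \<bullet> v" for v
    by (rule linear_functional_inner[OF f(1)])
  ultimately have "c v = (\<Sum>i\<in>Basis. f i *\<^sub>R i) \<bullet> v" if "v \<in> G" "norm v < r'" for v
    using that unfolding c'_def by (metis eq_iff_diff_eq_0)
  then show ?thesis using r' by blast
qed

section \<open>Lattices\<close>

lemma lattice_zero: "lattice \<Gamma> \<Longrightarrow> 0 \<in> \<Gamma>"
  and lattice_diff: "lattice \<Gamma> \<Longrightarrow> x \<in> \<Gamma> \<Longrightarrow> y \<in> \<Gamma> \<Longrightarrow> x - y \<in> \<Gamma>"
  unfolding lattice_def by blast+

lemma lattice_minus: "lattice \<Gamma> \<Longrightarrow> x \<in> \<Gamma> \<Longrightarrow> - x \<in> \<Gamma>"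
  using lattice_diff[of \<Gamma> 0 x] lattice_zero[of \<Gamma>] by simp

lemma lattice_add: "lattice \<Gamma> \<Longrightarrow> x \<in> \<Gamma> \<Longrightarrow> y \<in> \<Gamma> \<Longrightarrow> x + y \<in> \<Gamma>"
  using lattice_diff[of \<Gamma> x "- y"] lattice_minus[of \<Gamma> y] by simp

lemma mem_coset: "w \<in> coset \<Gamma> z \<longleftrightarrow> w - z \<in> \<Gamma>"
  unfolding coset_def by (force simp: image_iff algebra_simps)

lemma coset_eq_iff:
  assumes "lattice \<Gamma>"
  shows "coset \<Gamma> z = coset \<Gamma> z' \<longleftrightarrow> z - z' \<in> \<Gamma>"
proof
  assume "coset \<Gamma> z = coset \<Gamma> z'"
  moreover have "z \<in> coset \<Gamma> z" using lattice_zero[OF assms] by (simp add: mem_coset)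
  ultimately show "z - z' \<in> \<Gamma>" by (simp add: mem_coset)
next
  assume d: "z - z' \<in> \<Gamma>"
  have "w - z \<in> \<Gamma> \<longleftrightarrow> w - z' \<in> \<Gamma>" for w
    using lattice_add[OF assms, of "w - z" "z - z'"] lattice_diff[OF assms, of "w - z'" "z - z'"] d
    by (auto simp: algebra_simps)
  then show "coset \<Gamma> z = coset \<Gamma> z'" by (auto simp: mem_coset)
qed

lemma coset_in_torus: "coset \<Gamma> z \<in> torus \<Gamma>"
  by (simp add: torus_def)

lemma lattice_uniform_discrete:
  fixes \<Gamma> :: "'g::real_normed_vector set"
  assumes "lattice \<Gamma>"
  shows "uniform_discrete \<Gamma>"
proof -
  have "0 isolated_in \<Gamma>" using assms lattice_zero[OF assms] unfolding lattice_def discrete_def by blast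
  then obtain e where e: "e > 0" "\<forall>y\<in>\<Gamma>. dist 0 y < e \<longrightarrow> y = 0"
    unfolding isolated_in_dist_Ex_iff by blast
  show ?thesis
  proof (rule uniformI1[OF e(1)])
    fix x y assume "x \<in> \<Gamma>" "y \<in> \<Gamma>" "dist x y < e"
    then have "x - y \<in> \<Gamma>" "dist 0 (x - y) < e"
      using lattice_diff[OF assms] by (auto simp: dist_norm norm_minus_commute)
    then have "x - y = 0" using e(2) by blast
    then show "x = y" by simp
  qed
qed

lemma lattice_closed:
  fixes \<Gamma> :: "'g::real_normed_vector set"
  shows "lattice \<Gamma> \<Longrightarrow> closed \<Gamma>"
  using lattice_uniform_discrete uniform_discrete_imp_closed by blast

lemma lattice_finite_bounded:
  fixes \<Gamma> :: "'g::euclidean_space set"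
  assumes "lattice \<Gamma>" "bounded B"
  shows "finite (\<Gamma> \<inter> B)"
proof -
  have "uniform_discrete (\<Gamma> \<inter> B)"
    by (rule uniform_discrete_subset[OF lattice_uniform_discrete[OF assms(1)]]) simp
  moreover have "bounded (\<Gamma> \<inter> B)" using assms(2) by (rule bounded_subset) simp
  ultimately show ?thesis using uniform_discrete_finite_iff by blast
qed

lemma open_coset_image:
  fixes \<Gamma> :: "'g::euclidean_space set"
  assumes "lattice \<Gamma>" "open S"
  shows "openin (torus_topology \<Gamma>) (coset \<Gamma> ` S)"
proof -
  have "coset \<Gamma> -` coset \<Gamma> ` S = (\<Union>\<gamma>\<in>\<Gamma>. (\<lambda>z. z - \<gamma>) -` S)"
  proof (intro set_eqI iffI)
    fix z assume "z \<in> coset \<Gamma> -` coset \<Gamma> ` S"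
    then obtain y where y: "y \<in> S" "coset \<Gamma> z = coset \<Gamma> y" by auto
    then have "z - y \<in> \<Gamma>" using coset_eq_iff[OF assms(1)] by blast
    moreover have "z - (z - y) \<in> S" using y by simp
    ultimately show "z \<in> (\<Union>\<gamma>\<in>\<Gamma>. (\<lambda>z. z - \<gamma>) -` S)" by blast
  next
    fix z assume "z \<in> (\<Union>\<gamma>\<in>\<Gamma>. (\<lambda>z. z - \<gamma>) -` S)"
    then obtain \<gamma> where g: "\<gamma> \<in> \<Gamma>" "z - \<gamma> \<in> S" by auto
    then have "coset \<Gamma> z = coset \<Gamma> (z - \<gamma>)" using coset_eq_iff[OF assms(1)] by simp
    then show "z \<in> coset \<Gamma> -` coset \<Gamma> ` S" using g by simp
  qed
  moreover have "open (\<Union>\<gamma>\<in>\<Gamma>. (\<lambda>z. z - \<gamma>) -` S)"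
    by (intro open_UN ballI open_vimage[OF assms(2)] continuous_intros)
  ultimately show ?thesis unfolding openin_torus_topology by (auto simp: torus_def)
qed

text \<open>
  The images of the balls around the origin are an open cover of the compact torus.
\<close>

lemma lattice_cocompact:
  fixes \<Gamma> :: "'g::euclidean_space set"
  assumes "lattice \<Gamma>"
  obtains r where "r > 0" "\<And>z. \<exists>\<gamma>\<in>\<Gamma>. norm (z - \<gamma>) < r"
proof -
  define V where "V n = coset \<Gamma> ` ball 0 (real n)" for n
  have "\<Union>(range V) = torus \<Gamma>"
  proof -
    have "coset \<Gamma> z \<in> \<Union>(range V)" for z
    proof -
      obtain n where "norm z < real n" using reals_Archimedean2 by blast
      then have "coset \<Gamma> z \<in> V n" unfolding V_def by (intro imageI) simp
      then show ?thesis by blast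
    qed
    then show ?thesis unfolding V_def torus_def by blast
  qed
  moreover have "openin (torus_topology \<Gamma>) (V n)" for n
    unfolding V_def using open_coset_image[OF assms] by blast
  ultimately obtain \<F> where F: "finite \<F>" "\<F> \<subseteq> range V" "\<Union>\<F> = torus \<Gamma>"
    using assms unfolding lattice_def compact_space topspace_torus_topology by (metis rangeE)
  obtain J where J: "finite J" "\<F> = V ` J" using F(1,2) finite_subset_image by metis
  define r where "r = real (Suc (Max (insert 0 J)))"
  have "\<exists>\<gamma>\<in>\<Gamma>. norm (z - \<gamma>) < r" for z
  proof -
    have "coset \<Gamma> z \<in> \<Union>\<F>" using F(3) coset_in_torus by blast
    then obtain n where n: "n \<in> J" "coset \<Gamma> z \<in> V n" using J(2) by blast
    then obtain y where y: "norm y < real n" "coset \<Gamma> z = coset \<Gamma> y" unfolding V_def by auto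
    then have "z - y \<in> \<Gamma>" using coset_eq_iff[OF assms] by blast
    moreover have "n \<le> Max (insert 0 J)" using n(1) J(1) by simp
    then have "norm (z - (z - y)) < r" using y(1) by (simp add: r_def)
    ultimately show ?thesis by blast
  qed
  then show ?thesis using that[of r] by (simp add: r_def)
qed

text \<open>
  A multiple of a vector orthogonal to \<open>\<Gamma>\<close> has the origin as a nearest point of \<open>\<Gamma>\<close>, which contradicts
  cocompactness.
\<close>

lemma lattice_span:
  fixes \<Gamma> :: "'g::euclidean_space set"
  assumes "lattice \<Gamma>"
  shows "span \<Gamma> = UNIV"
proof (rule ccontr)
  assume "span \<Gamma> \<noteq> UNIV"
  then have "dim \<Gamma> < DIM('g)" using dim_eq_full[of \<Gamma>] dim_subset_UNIV[of \<Gamma>] by linarith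
  then obtain a where a: "a \<noteq> 0" "\<And>x. x \<in> span \<Gamma> \<Longrightarrow> orthogonal a x"
    using orthogonal_to_subspace_exists by blast
  obtain r where r: "r > 0" "\<And>z. \<exists>\<gamma>\<in>\<Gamma>. norm (z - \<gamma>) < r" using lattice_cocompact[OF assms] by metis
  obtain \<gamma> where g: "\<gamma> \<in> \<Gamma>" "norm ((r / norm a) *\<^sub>R a - \<gamma>) < r" using r(2) by blast
  have "a \<bullet> \<gamma> = 0" using a(2)[OF span_base[OF g(1)]] by (simp add: orthogonal_def)
  then have "a \<bullet> ((r / norm a) *\<^sub>R a - \<gamma>) = r * norm a"
    using a(1) by (simp add: inner_diff_right dot_square_norm power2_eq_square)
  moreover have "a \<bullet> ((r / norm a) *\<^sub>R a - \<gamma>) < norm a * r"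
  proof -
    have "norm a * norm ((r / norm a) *\<^sub>R a - \<gamma>) < norm a * r"
      using g(2) a(1) by (intro mult_strict_left_mono) auto
    then show ?thesis using norm_cauchy_schwarz[of a "(r / norm a) *\<^sub>R a - \<gamma>"] by linarith
  qed
  ultimately show False by (simp add: mult.commute)
qed

text \<open>
  The vectors with integral inner products with \<open>\<Gamma>\<close> span: for a vector space basis taken from
  \<open>\<Gamma>\<close>, the coordinates of lattice points have a common denominator, by the pigeonhole principle
  for the multiples of a point modulo the sublattice.
\<close>

lemma lattice_dual_span:
  fixes \<Gamma> :: "'g::euclidean_space set"
  assumes "lattice \<Gamma>"
  shows "\<exists>(m::nat) r a. (\<forall>k<m. \<forall>\<gamma>\<in>\<Gamma>. a k \<bullet> \<gamma> \<in> \<int>) \<and> v = (\<Sum>k<m. r k *\<^sub>R a k)"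
proof -
  obtain B where B: "B \<subseteq> \<Gamma>" "independent B" "\<Gamma> \<subseteq> span B"
    using maximal_independent_subset by blast
  have finB: "finite B" using B(2) by (rule independent_imp_finite)
  have spanB: "span B = UNIV"
    using lattice_span[OF assms] B(3) by (metis span_mono span_span top.extremum_uniqueI)
  define \<rho> where "\<rho> w = (\<Sum>b\<in>B. frac (representation B w b) *\<^sub>R b)" for w
  define X where "X = \<Gamma> \<inter> cball 0 (\<Sum>b\<in>B. norm b)"
  have finX: "finite X" unfolding X_def using lattice_finite_bounded[OF assms] by simp
  have rep: "(\<Sum>b\<in>B. representation B w b *\<^sub>R b) = w" for w
    using sum_representation_eq[OF B(2) _ finB order_refl] spanB by blast
  have inX: "\<rho> w \<in> X" if "w \<in> \<Gamma>" for w
  proof -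
    have eq: "\<rho> w = w - (\<Sum>b\<in>B. of_int \<lfloor>representation B w b\<rfloor> *\<^sub>R b)"
      by (subst (2) rep[symmetric]) (simp add: \<rho>_def frac_def sum_subtractf scaleR_diff_left)
    have "(\<Sum>b\<in>B. of_int \<lfloor>representation B w b\<rfloor> *\<^sub>R b) \<in> \<Gamma>"
      by (rule subgroup_int_combination[OF lattice_zero[OF assms] lattice_diff[OF assms] finB B(1)])
    then have "\<rho> w \<in> \<Gamma>" unfolding eq using lattice_diff[OF assms that] by blast
    moreover have "norm (\<rho> w) \<le> (\<Sum>b\<in>B. norm b)"
      unfolding \<rho>_def
      by (intro sum_norm_le) (auto simp: frac_ge_0 less_imp_le[OF frac_lt_1] mult_left_le_one_le)
    ultimately show ?thesis by (simp add: X_def)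
  qed
  \<comment> \<open>A common denominator: every number from 1 to the cardinality of \<open>X\<close> divides it.\<close>
  define q :: nat where "q = fact (card X)"
  have integral: "real q * representation B \<gamma> b \<in> \<int>" if g: "\<gamma> \<in> \<Gamma>" and b: "b \<in> B" for \<gamma> b
  proof -
    have "(\<lambda>k. \<rho> (real k *\<^sub>R \<gamma>)) ` {..card X} \<subseteq> X"
      using inX subgroup_of_nat_scale[OF lattice_zero[OF assms] lattice_diff[OF assms] g] by blast
    then have "card ((\<lambda>k. \<rho> (real k *\<^sub>R \<gamma>)) ` {..card X}) \<le> card X" using card_mono[OF finX] by blast
    then have "\<not> inj_on (\<lambda>k. \<rho> (real k *\<^sub>R \<gamma>)) {..card X}" using card_image by fastforce
    then obtain k l where kl: "k \<le> card X" "l \<le> card X" "k < l" "\<rho> (real k *\<^sub>R \<gamma>) = \<rho> (real l *\<^sub>R \<gamma>)"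
      unfolding inj_on_def by (metis atMost_iff linorder_neqE_nat)
    have "(\<Sum>b\<in>B. (frac (representation B (real l *\<^sub>R \<gamma>) b) - frac (representation B (real k *\<^sub>R \<gamma>) b)) *\<^sub>R b) = 0"
      using kl(4) unfolding \<rho>_def by (simp add: scaleR_diff_left sum_subtractf)
    then have "frac (representation B (real l *\<^sub>R \<gamma>) b) - frac (representation B (real k *\<^sub>R \<gamma>) b) = 0"
      by (rule independentD[OF B(2) finB order_refl, where v = b and u = "\<lambda>b. frac (representation B (real l *\<^sub>R \<gamma>) b) - frac (representation B (real k *\<^sub>R \<gamma>) b)"])
         (use b in simp)
    then have "representation B (real l *\<^sub>R \<gamma>) b - representation B (real k *\<^sub>R \<gamma>) b =
        of_int (\<lfloor>representation B (real l *\<^sub>R \<gamma>) b\<rfloor> - \<lfloor>representation B (real k *\<^sub>R \<gamma>) b\<rfloor>)"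
      unfolding frac_def by linarith
    moreover have "representation B (c *\<^sub>R \<gamma>) b = c * representation B \<gamma> b" for c
      using B(2) spanB by (simp add: representation_scale)
    ultimately have "real l * representation B \<gamma> b - real k * representation B \<gamma> b \<in> \<int>"
      by (metis Ints_of_int)
    then have i: "real (l - k) * representation B \<gamma> b \<in> \<int>"
      using kl(3) by (simp add: of_nat_diff left_diff_distrib)
    have "l - k dvd q" unfolding q_def using kl by (intro dvd_fact) auto
    then obtain c where c: "q = (l - k) * c" by blast
    have "real q * representation B \<gamma> b = real c * (real (l - k) * representation B \<gamma> b)"
      by (simp add: c)
    then show ?thesis using i by (metis Ints_mult Ints_of_nat)
  qed
  define L where "L b = (\<Sum>i\<in>Basis. (real q * representation B i b) *\<^sub>R i)" for b
  have L: "L b \<bullet> w = real q * representation B w b" for b w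
  proof -
    have "linear (\<lambda>w. real q * representation B w b)"
      by (rule linearI) (use B(2) spanB in \<open>auto simp: representation_add representation_scale algebra_simps\<close>)
    from linear_functional_inner[OF this, of w] show ?thesis by (simp add: L_def)
  qed
  have q0: "real q > 0" by (simp add: q_def)
  have v_eq: "v = (\<Sum>b\<in>B. ((v \<bullet> b) / real q) *\<^sub>R L b)"
  proof (rule vector_eq_ldot[THEN iffD1], rule allI)
    fix w
    have "w \<bullet> v = (\<Sum>b\<in>B. representation B w b *\<^sub>R b) \<bullet> v" by (simp only: rep)
    also have "\<dots> = (\<Sum>b\<in>B. representation B w b * (b \<bullet> v))"
      by (simp only: inner_sum_left inner_scaleR_left)
    also have "\<dots> = (\<Sum>b\<in>B. ((v \<bullet> b) / real q) * (w \<bullet> L b))"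
      by (intro sum.cong refl) (use q0 L in \<open>simp add: inner_commute[of w] inner_commute[of v]\<close>)
    also have "\<dots> = w \<bullet> (\<Sum>b\<in>B. ((v \<bullet> b) / real q) *\<^sub>R L b)"
      by (simp only: inner_sum_right inner_scaleR_right)
    finally show "w \<bullet> v = w \<bullet> (\<Sum>b\<in>B. ((v \<bullet> b) / real q) *\<^sub>R L b)" .
  qed
  obtain f where f: "bij_betw f {..<card B} B"
    using ex_bij_betw_nat_finite[OF finB] unfolding atLeast0LessThan by blast
  have fB: "f k \<in> B" if "k < card B" for k using f that by (auto simp: bij_betw_def)
  have "(\<Sum>k<card B. ((v \<bullet> f k) / real q) *\<^sub>R L (f k)) = (\<Sum>b\<in>B. ((v \<bullet> b) / real q) *\<^sub>R L b)"
    by (rule sum.reindex_bij_betw[OF f])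
  then have 1: "v = (\<Sum>k<card B. ((v \<bullet> f k) / real q) *\<^sub>R L (f k))"
    using v_eq by (rule trans[OF _ sym, rotated])
  have 2: "\<forall>k<card B. \<forall>\<gamma>\<in>\<Gamma>. L (f k) \<bullet> \<gamma> \<in> \<int>"
    unfolding L using integral fB by blast
  show ?thesis
    by (rule exI[of _ "card B"], rule exI[of _ "\<lambda>k. (v \<bullet> f k) / real q"], rule exI[of _ "\<lambda>k. L (f k)"],
        rule conjI[OF 2 1])
qed

lemma Hausdorff_torus:
  fixes \<Gamma> :: "'g::euclidean_space set"
  assumes "lattice \<Gamma>"
  shows "Hausdorff_space (torus_topology \<Gamma>)"
  unfolding Hausdorff_space_def topspace_torus_topology
proof (intro allI impI)
  fix x y assume xy: "x \<in> torus \<Gamma> \<and> y \<in> torus \<Gamma> \<and> x \<noteq> y"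
  obtain z where z: "x = coset \<Gamma> z" using xy unfolding torus_def by blast
  obtain w where w: "y = coset \<Gamma> w" using xy unfolding torus_def by blast
  have zw: "x = coset \<Gamma> z" "y = coset \<Gamma> w" "z - w \<notin> \<Gamma>"
    using z w xy coset_eq_iff[OF assms] by auto
  have "open (- \<Gamma>)" using lattice_closed[OF assms] by (simp add: open_Compl)
  then obtain e where e: "e > 0" "ball (z - w) e \<subseteq> - \<Gamma>" using zw(3) openE by blast
  have "disjnt (coset \<Gamma> ` ball z (e / 2)) (coset \<Gamma> ` ball w (e / 2))"
  proof (rule ccontr)
    assume "\<not> disjnt (coset \<Gamma> ` ball z (e / 2)) (coset \<Gamma> ` ball w (e / 2))"
    then obtain a b where ab: "a \<in> ball z (e / 2)" "b \<in> ball w (e / 2)" "coset \<Gamma> a = coset \<Gamma> b"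
      unfolding disjnt_def by blast
    have "a - b \<in> \<Gamma>" using ab(3) coset_eq_iff[OF assms] by blast
    moreover have "dist (z - w) (a - b) < e"
    proof -
      have "dist (z - w) (a - b) = norm ((z - a) - (w - b))" by (simp add: dist_norm algebra_simps)
      also have "\<dots> \<le> norm (z - a) + norm (w - b)" by (rule norm_triangle_ineq4)
      also have "\<dots> < e" using ab(1,2) by (simp add: dist_norm)
      finally show ?thesis .
    qed
    ultimately show False using e(2) by (auto simp: subset_iff)
  qed
  then show "\<exists>U V. openin (torus_topology \<Gamma>) U \<and> openin (torus_topology \<Gamma>) V \<and> x \<in> U \<and> y \<in> V \<and> disjnt U V"
    using open_coset_image[OF assms open_ball, of z "e / 2"] open_coset_image[OF assms open_ball, of w "e / 2"]
      zw(1,2) e(1) by (intro exI[of _ "coset \<Gamma> ` ball z (e / 2)"] exI[of _ "coset \<Gamma> ` ball w (e / 2)"]) auto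
qed

section \<open>Convergence of Delone sets\<close>

lemma agree_iff: "agree R A B \<longleftrightarrow> (\<forall>z. norm z < R \<longrightarrow> (z \<in> A \<longleftrightarrow> z \<in> B))"
  unfolding agree_def by (auto simp: set_eq_iff)

lemma agree_mono: "agree L A B \<Longrightarrow> L' \<le> L \<Longrightarrow> agree L' A B"
  unfolding agree_iff by (meson less_le_trans)

lemma delone_dist_commute: "delone_dist A B = delone_dist B A"
  unfolding delone_dist_def by (simp add: close_sets_commute)

lemma delone_dist_nonneg: "0 \<le> delone_dist A B"
  unfolding delone_dist_def by (rule cInf_greatest) auto

lemma delone_dist_le: "0 < e \<Longrightarrow> close_sets e A B \<Longrightarrow> delone_dist A B \<le> e"
  unfolding delone_dist_def using bdd_below_close by (intro cInf_lower) auto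

lemma delone_closed: "delone A \<Longrightarrow> closed A"
  unfolding delone_def using uniform_discrete_imp_closed by blast

lemma shift_shift: "shift (shift A x) y = shift A (x + y)"
  by (auto simp: algebra_simps)

lemma close_point:
  fixes A B :: "'a::real_normed_vector set"
  assumes e: "0 < e" "e \<le> 1" "e * (norm b + 1) \<le> 1"
    and AB: "delone_dist A B < e" and b: "b \<in> B"
  obtains a where "a \<in> A" "norm (a - b) < 2 * e"
proof -
  obtain e' where e': "0 < e'" "e' < e" "close_sets e' A B"
    using delone_dist_lessD[OF AB e(2)] by blast
  obtain u v where uv: "norm u < e'" "norm v < e'" "agree (1 / e') (shift A u) (shift B v)"
    using e'(3) unfolding close_sets_def by blast
  have "norm b + 1 \<le> 1 / e" using e by (simp add: pos_le_divide_eq mult.commute)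
  also have "\<dots> < 1 / e'" using e' by (intro divide_strict_left_mono) auto
  finally have "norm (b - v) < 1 / e'"
    using norm_triangle_ineq4[of b v] uv(2) e' e by linarith
  moreover have "b - v \<in> shift B v" using b by simp
  ultimately have "b - v \<in> shift A u" using agreeD[OF uv(3)] by blast
  then have "b - v + u \<in> A" by simp
  moreover have "norm (b - v + u - b) < 2 * e"
    using norm_triangle_ineq4[of u v] uv e' by simp
  ultimately show ?thesis by (rule that)
qed

text \<open>
  The form in which convergence of Delone sets is mostly used: in a bounded region, points of each set
  are close to points of the other one.
\<close>

lemma close_points_eventually:
  fixes A :: "'a::real_normed_vector set"
  assumes conv: "(\<lambda>k. delone_dist A (B k)) \<longlonglongrightarrow> 0" and e: "e > 0"
  shows "\<forall>\<^sub>F k in sequentially. (\<forall>b\<in>B k. norm b \<le> K \<longrightarrow> (\<exists>a\<in>A. norm (a - b) < e)) \<and>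
    (\<forall>a\<in>A. norm a \<le> K \<longrightarrow> (\<exists>b\<in>B k. norm (b - a) < e))"
proof -
  have K1: "\<bar>K\<bar> + 1 > 0" by linarith
  define d where "d = min (min (e / 2) 1) (1 / (\<bar>K\<bar> + 1))"
  have d: "0 < d" "d \<le> 1" "2 * d \<le> e"
    using e K1 by (auto simp: d_def)
  have dK: "d * (norm c + 1) \<le> 1" if "norm c \<le> K" for c :: 'a
  proof -
    have "d * (norm c + 1) \<le> (1 / (\<bar>K\<bar> + 1)) * (\<bar>K\<bar> + 1)"
      using that by (intro mult_mono) (auto simp: d_def)
    also have "\<dots> = 1" using K1 by simp
    finally show ?thesis .
  qed
  have "\<forall>\<^sub>F k in sequentially. delone_dist A (B k) < d"
    using conv d(1) by (rule order_tendstoD(2))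
  then show ?thesis
  proof (rule eventually_mono)
    fix k assume k: "delone_dist A (B k) < d"
    have "\<exists>a\<in>A. norm (a - b) < e" if b: "b \<in> B k" "norm b \<le> K" for b
    proof -
      obtain a where "a \<in> A" "norm (a - b) < 2 * d"
        by (rule close_point[OF d(1,2) dK[OF b(2)] k b(1)])
      then show ?thesis using d(3) by (intro bexI[of _ a]) auto
    qed
    moreover have "\<exists>b\<in>B k. norm (b - a) < e" if a: "a \<in> A" "norm a \<le> K" for a
    proof -
      have k': "delone_dist (B k) A < d" using k by (simp add: delone_dist_commute)
      obtain b where "b \<in> B k" "norm (b - a) < 2 * d"
        by (rule close_point[OF d(1,2) dK[OF a(2)] k' a(1)])
      then show ?thesis using d(3) by (intro bexI[of _ b]) auto
    qed
    ultimately show "(\<forall>b\<in>B k. norm b \<le> K \<longrightarrow> (\<exists>a\<in>A. norm (a - b) < e)) \<and>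
      (\<forall>a\<in>A. norm a \<le> K \<longrightarrow> (\<exists>b\<in>B k. norm (b - a) < e))" by blast
  qed
qed

lemma limit_of_points:
  fixes A :: "'a::real_normed_vector set"
  assumes conv: "(\<lambda>k. delone_dist A (B k)) \<longlonglongrightarrow> 0" and A: "closed A"
    and b: "\<forall>\<^sub>F k in sequentially. b k \<in> B k" "b \<longlonglongrightarrow> l"
  shows "l \<in> A"
proof -
  have "\<exists>a\<in>A. dist a l < e" if e: "e > 0" for e
  proof -
    have e2: "e / 2 > 0" using e by simp
    have "\<forall>\<^sub>F k in sequentially. norm (b k - l) < min (e / 2) 1"
      using tendstoD[OF b(2), of "min (e / 2) 1"] e by (simp add: dist_norm)
    with b(1) close_points_eventually[OF conv e2, of "norm l + 1"]
    have "\<forall>\<^sub>F k in sequentially. norm (b k - l) < min (e / 2) 1 \<and> b k \<in> B k \<and>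
      (\<forall>b\<in>B k. norm b \<le> norm l + 1 \<longrightarrow> (\<exists>a\<in>A. norm (a - b) < e / 2))"
      by eventually_elim blast
    then obtain k where k: "norm (b k - l) < min (e / 2) 1" "b k \<in> B k"
      "\<forall>b\<in>B k. norm b \<le> norm l + 1 \<longrightarrow> (\<exists>a\<in>A. norm (a - b) < e / 2)"
      using eventually_happens'[OF sequentially_bot] by blast
    have "norm (b k) \<le> norm l + 1"
      using norm_triangle_ineq[of "b k - l" l] k(1) by simp
    then obtain a where a: "a \<in> A" "norm (a - b k) < e / 2" using k(2,3) by blast
    have "dist a l < e"
      using norm_triangle_ineq[of "a - b k" "b k - l"] a(2) k(1) by (simp add: dist_norm)
    then show ?thesis using a(1) by blast
  qed
  then have "l \<in> closure A" unfolding closure_approachable by blast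
  then show ?thesis using A by simp
qed

lemma shift_conv:
  fixes A :: "'a::real_normed_vector set"
  assumes conv: "(\<lambda>k. delone_dist A (B k)) \<longlonglongrightarrow> 0"
  shows "(\<lambda>k. delone_dist (shift A x) (shift (B k) x)) \<longlonglongrightarrow> 0"
proof (rule LIMSEQ_I)
  fix r :: real assume "r > 0"
  define e where "e = min (r / 2) 1"
  have e: "0 < e" "e < r" "e \<le> 1" using \<open>r > 0\<close> by (auto simp: e_def)
  define d where "d = 1 / (1 / e + norm x)"
  have pos: "1 / e + norm x > 0" using e(1) by (simp add: add_pos_nonneg)
  have d: "0 < d" "d \<le> 1"
  proof -
    show "0 < d" unfolding d_def using pos by simp
    have "1 / e \<ge> 1" using e by simp
    then have "1 / e + norm x \<ge> 1" using norm_ge_zero[of x] by linarith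
    then show "d \<le> 1" unfolding d_def by simp
  qed
  obtain N where N: "\<forall>k\<ge>N. delone_dist A (B k) < d"
    using order_tendstoD(2)[OF conv d(1)] unfolding eventually_sequentially by blast
  have "norm (delone_dist (shift A x) (shift (B k) x) - 0) < r" if "k \<ge> N" for k
  proof -
    have "delone_dist A (B k) < d" using N that by blast
    then obtain e' where e': "0 < e'" "e' < d" "close_sets e' A (B k)"
      using delone_dist_lessD[OF _ d(2)] by blast
    obtain u v where uv: "norm u < e'" "norm v < e'" "agree (1 / e') (shift A u) (shift (B k) v)"
      using e'(3) unfolding close_sets_def by blast
    have de: "1 / d = 1 / e + norm x" by (simp add: d_def)
    have "1 / d < 1 / e'" using e' by (intro divide_strict_left_mono) auto
    then have lt: "1 / e + norm x < 1 / e'" using de by simp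
    have "1 / e < 1 / e'" using lt norm_ge_zero[of x] by linarith
    then have "e' < e" using e(1) e'(1) by (simp add: field_simps)
    have "z \<in> shift (shift A x) u \<longleftrightarrow> z \<in> shift (shift (B k) x) v" if z: "norm z < 1 / e" for z
    proof -
      have "norm (z + x) < 1 / e'" using norm_triangle_ineq[of z x] z lt by linarith
      then have "z + x \<in> shift A u \<longleftrightarrow> z + x \<in> shift (B k) v" using agreeD[OF uv(3)] by blast
      then show ?thesis by (simp add: algebra_simps)
    qed
    then have "agree (1 / e) (shift (shift A x) u) (shift (shift (B k) x) v)"
      unfolding agree_def by (auto simp del: in_shift)
    moreover have "norm u < e" "norm v < e" using uv \<open>e' < e\<close> by auto
    ultimately have "close_sets e (shift A x) (shift (B k) x)" unfolding close_sets_def by blast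
    then have "delone_dist (shift A x) (shift (B k) x) \<le> e" by (rule delone_dist_le[OF e(1)])
    then show ?thesis using e(2) delone_dist_nonneg[of "shift A x" "shift (B k) x"] by simp
  qed
  then show "\<exists>N. \<forall>k\<ge>N. norm (delone_dist (shift A x) (shift (B k) x) - 0) < r" by blast
qed

lemma delone_shift: "delone A \<Longrightarrow> delone (shift A x)"
  for A :: "'a::real_normed_vector set"
proof -
  assume A: "delone A"
  obtain r where r: "r > 0" "\<forall>a\<in>A. \<forall>b\<in>A. dist a b < r \<longrightarrow> a = b"
    using conjunct1[OF A[unfolded delone_def]] unfolding uniform_discrete_def by blast
  have ud: "uniform_discrete (shift A x)"
  proof (rule uniformI1[OF r(1)])
    fix a b assume "a \<in> shift A x" "b \<in> shift A x" "dist a b < r"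
    then have "a + x \<in> A" "b + x \<in> A" "dist (a + x) (b + x) < r" by (simp_all add: dist_norm)
    then have "a + x = b + x" using r(2) by blast
    then show "a = b" by simp
  qed
  obtain R where R: "R > 0" "\<forall>z. A \<inter> ball z R \<noteq> {}"
    using conjunct2[OF A[unfolded delone_def]] by blast
  have "shift A x \<inter> ball z R \<noteq> {}" for z
  proof -
    have "A \<inter> ball (z + x) R \<noteq> {}" using R(2) by blast
    then obtain a where a: "a \<in> A" "a \<in> ball (z + x) R" by blast
    then have "a - x \<in> shift A x \<inter> ball z R" by (simp add: dist_norm algebra_simps)
    then show ?thesis by blast
  qed
  then show ?thesis unfolding delone_def by (intro conjI ud exI[of _ R] R(1) allI)
qed

lemma inverse_Suc_tendsto: "(\<lambda>k. 1 / real (Suc k)) \<longlonglongrightarrow> 0"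
  using LIMSEQ_inverse_real_of_nat by (simp only: inverse_eq_divide)

lemma delone_closure_seq:
  assumes "A \<in> delone_topology closure_of S"
  obtains B where "delone A" "\<forall>k. B k \<in> S" "\<forall>k. delone (B k)" "(\<lambda>k::nat. delone_dist A (B k)) \<longlonglongrightarrow> 0"
proof -
  interpret Metric_space "{A :: 'a set. delone A}" delone_dist by (rule Metric_space_delone)
  have A: "delone A" and near: "\<And>r. r > 0 \<Longrightarrow> \<exists>B\<in>S. delone B \<and> delone_dist A B < r"
    using assms unfolding delone_topology_def metric_closure_of by auto
  then have "\<exists>B\<in>S. delone B \<and> delone_dist A B < 1 / real (Suc k)" for k by simp
  then obtain B where B: "\<And>k. B k \<in> S" "\<And>k. delone (B k)" "\<And>k. delone_dist A (B k) < 1 / real (Suc k)"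
    by metis
  have "(\<lambda>k. delone_dist A (B k)) \<longlonglongrightarrow> 0"
  proof (rule tendsto_sandwich[of "\<lambda>_. 0" _ _ "\<lambda>k. 1 / real (Suc k)"])
    show "\<forall>\<^sub>F k in sequentially. 0 \<le> delone_dist A (B k)" using delone_dist_nonneg by simp
    show "\<forall>\<^sub>F k in sequentially. delone_dist A (B k) \<le> 1 / real (Suc k)"
      by (intro always_eventually allI less_imp_le B(3))
  qed (rule tendsto_const inverse_Suc_tendsto)+
  then show ?thesis using that A B(1,2) by blast
qed

lemma delone_seq_closure:
  assumes "delone A" "\<And>k. B k \<in> S" "\<And>k. delone (B k)" "(\<lambda>k::nat. delone_dist A (B k)) \<longlonglongrightarrow> 0"
  shows "A \<in> delone_topology closure_of S"
proof -
  interpret Metric_space "{A :: 'a set. delone A}" delone_dist by (rule Metric_space_delone)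
  have "\<exists>y\<in>S. y \<in> mball A r" if r: "r > 0" for r
  proof -
    obtain k where "delone_dist A (B k) < r"
      using order_tendstoD(2)[OF assms(4) r] eventually_happens'[OF sequentially_bot] by blast
    then show ?thesis using assms(1-3) by (intro bexI[of _ "B k"]) auto
  qed
  then show ?thesis unfolding delone_topology_def metric_closure_of using assms(1) by blast
qed

text \<open>
  Continuity can be tested on sequences. It suffices that a single member of the image sequence lies in
  \<open>U\<close>, since a failure of continuity yields a sequence all of whose images lie outside \<open>U\<close>.
\<close>

lemma delone_continuous_mapI:
  assumes S: "\<And>A. A \<in> S \<Longrightarrow> delone A"
    and p: "\<And>A. A \<in> S \<Longrightarrow> p A \<in> topspace Y"
    and seq: "\<And>U A B. openin Y U \<Longrightarrow> A \<in> S \<Longrightarrow> p A \<in> U \<Longrightarrow> (\<forall>k::nat. B k \<in> S) \<Longrightarrow>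
      (\<lambda>k. delone_dist A (B k)) \<longlonglongrightarrow> 0 \<Longrightarrow> \<exists>k. p (B k) \<in> U"
  shows "continuous_map (subtopology delone_topology S) Y p"
proof -
  interpret Metric_space "{A :: 'a set. delone A}" delone_dist by (rule Metric_space_delone)
  have top: "topspace (subtopology delone_topology S) = S"
    using S by (auto simp: delone_topology_def)
  have "openin (subtopology delone_topology S) {A \<in> S. p A \<in> U}" if U: "openin Y U" for U
  proof -
    have "\<exists>e>0. \<forall>B\<in>S. delone_dist A B < e \<longrightarrow> p B \<in> U" if A: "A \<in> S" "p A \<in> U" for A
    proof (rule ccontr)
      assume "\<not> ?thesis"
      then have no: "\<not> (\<forall>B\<in>S. delone_dist A B < e \<longrightarrow> p B \<in> U)" if "e > 0" for e
        using that by blast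
      have ex: "\<exists>B. B \<in> S \<and> delone_dist A B < 1 / real (Suc k) \<and> p B \<notin> U" for k
        using no[of "1 / real (Suc k)"] by auto
      define B where "B k = (SOME B. B \<in> S \<and> delone_dist A B < 1 / real (Suc k) \<and> p B \<notin> U)" for k
      have Bk: "B k \<in> S \<and> delone_dist A (B k) < 1 / real (Suc k) \<and> p (B k) \<notin> U" for k
        unfolding B_def by (rule someI_ex[OF ex])
      then have B: "\<forall>k. B k \<in> S" "\<And>k. delone_dist A (B k) < 1 / real (Suc k)" "\<And>k. p (B k) \<notin> U"
        by auto
      have "(\<lambda>k. delone_dist A (B k)) \<longlonglongrightarrow> 0"
      proof (rule tendsto_sandwich[of "\<lambda>_. 0" _ _ "\<lambda>k. 1 / real (Suc k)"])
        show "\<forall>\<^sub>F k in sequentially. 0 \<le> delone_dist A (B k)" using delone_dist_nonneg by simp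
        show "\<forall>\<^sub>F k in sequentially. delone_dist A (B k) \<le> 1 / real (Suc k)"
          by (intro always_eventually allI less_imp_le B(2))
      qed (rule tendsto_const inverse_Suc_tendsto)+
      from seq[OF U A B(1) this] show False using B(3) by blast
    qed
    note pre = this
    define V where "V = \<Union>{mball A e |A e. A \<in> S \<and> e > 0 \<and> (\<forall>B\<in>S. delone_dist A B < e \<longrightarrow> p B \<in> U)}"
    have "openin mtopology V" unfolding V_def by (intro openin_Union) auto
    moreover have "{A \<in> S. p A \<in> U} = V \<inter> S"
    proof (intro set_eqI iffI)
      fix A assume A: "A \<in> {A \<in> S. p A \<in> U}"
      then obtain e where e: "e > 0" "\<forall>B\<in>S. delone_dist A B < e \<longrightarrow> p B \<in> U" using pre by blast
      have "A \<in> mball A e" using A S e(1) by simp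
      then show "A \<in> V \<inter> S" using A e unfolding V_def by blast
    next
      fix A assume A: "A \<in> V \<inter> S"
      then obtain A' e where "A \<in> mball A' e" "\<forall>B\<in>S. delone_dist A' B < e \<longrightarrow> p B \<in> U"
        unfolding V_def by blast
      then show "A \<in> {A \<in> S. p A \<in> U}" using A by simp
    qed
    ultimately show ?thesis unfolding openin_subtopology delone_topology_def by blast
  qed
  then show ?thesis unfolding continuous_map top using p by blast
qed

section \<open>The star map on the hull of a model set\<close>

locale scheme =
  fixes \<Gamma> :: "('h::euclidean_space \<times> 'a::euclidean_space) set" and W :: "'h set"
  assumes lat: "lattice \<Gamma>" and inj: "inj_on snd \<Gamma>" and dense: "closure (fst ` \<Gamma>) = UNIV"
    and win: "window W"
begin

lemmas zero = lattice_zero[OF lat] and diff = lattice_diff[OF lat]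
  and minus = lattice_minus[OF lat] and add = lattice_add[OF lat]

lemma W_compact: "compact W" and W_closure: "closure (interior W) = W"
  and W_aperiodic: "(\<lambda>w. w + h) ` W = W \<Longrightarrow> h = 0"
  using win unfolding window_def by blast+

lemma W_closed: "closed W" using W_compact by (rule compact_imp_closed)

text \<open>
  An empty window would be invariant under all translations.
\<close>

lemma W_interior: "interior W \<noteq> {}"
proof
  assume "interior W = {}"
  then have "W = {}" using W_closure by simp
  then have "h = 0" for h :: 'h using W_aperiodic[of h] by simp
  then show False using nonzero_Basis SOME_Basis by blast
qed

lemma W_bound: obtains C where "C > 0" "\<And>w. w \<in> W \<Longrightarrow> norm w \<le> C"
proof -
  obtain C where C: "\<forall>w\<in>W. norm w \<le> C" using compact_imp_bounded[OF W_compact] bounded_iff by blast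
  have "norm w \<le> max C 1" if "w \<in> W" for w using C that by (simp add: max.coboundedI1)
  then show ?thesis using that[of "max C 1"] by simp
qed

text \<open>
  A set \<open>A\<close> has parameter \<open>z\<close> if it is the cut at \<open>z\<close>, up to points over the boundary of the window.
  Unlike being a cut, having a parameter is preserved by limits, so all elements of the hull have one.
\<close>

definition rel :: "('h \<times> 'a) \<Rightarrow> 'a set \<Rightarrow> bool" where
  "rel z A \<longleftrightarrow> (\<forall>\<gamma>\<in>\<Gamma>. fst (\<gamma> + z) \<in> interior W \<longrightarrow> snd (\<gamma> + z) \<in> A) \<and>
     (\<forall>a\<in>A. \<exists>\<gamma>\<in>\<Gamma>. snd (\<gamma> + z) = a \<and> fst (\<gamma> + z) \<in> W)"

lemma rel_interior: "rel z A \<Longrightarrow> \<gamma> \<in> \<Gamma> \<Longrightarrow> fst (\<gamma> + z) \<in> interior W \<Longrightarrow> snd (\<gamma> + z) \<in> A"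
  unfolding rel_def by blast

lemma rel_point:
  assumes "rel z A" "a \<in> A"
  obtains \<gamma> where "\<gamma> \<in> \<Gamma>" "snd (\<gamma> + z) = a" "fst (\<gamma> + z) \<in> W"
  using assms unfolding rel_def by blast

lemma rel_translate:
  assumes "rel z A" "\<gamma> \<in> \<Gamma>"
  shows "rel (\<gamma> + z) A"
  unfolding rel_def
proof (intro conjI ballI impI)
  fix \<delta> assume d: "\<delta> \<in> \<Gamma>" "fst (\<delta> + (\<gamma> + z)) \<in> interior W"
  then show "snd (\<delta> + (\<gamma> + z)) \<in> A"
    using rel_interior[OF assms(1) add[OF d(1) assms(2)]] by (simp add: add.assoc)
next
  fix a assume "a \<in> A"
  then obtain \<delta> where d: "\<delta> \<in> \<Gamma>" "snd (\<delta> + z) = a" "fst (\<delta> + z) \<in> W" by (rule rel_point[OF assms(1)])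
  show "\<exists>\<delta>\<in>\<Gamma>. snd (\<delta> + (\<gamma> + z)) = a \<and> fst (\<delta> + (\<gamma> + z)) \<in> W"
    using d diff[OF d(1) assms(2)] by (intro bexI[of _ "\<delta> - \<gamma>"]) simp_all
qed

lemma rel_shift:
  assumes "rel z A"
  shows "rel (z - (0, x)) (shift A x)"
  unfolding rel_def
proof (intro conjI ballI impI)
  fix \<delta> assume d: "\<delta> \<in> \<Gamma>" "fst (\<delta> + (z - (0, x))) \<in> interior W"
  then show "snd (\<delta> + (z - (0, x))) \<in> shift A x"
    using rel_interior[OF assms d(1)] by simp
next
  fix a assume "a \<in> shift A x"
  then have "a + x \<in> A" by simp
  then obtain \<delta> where "\<delta> \<in> \<Gamma>" "snd (\<delta> + z) = a + x" "fst (\<delta> + z) \<in> W" by (rule rel_point[OF assms])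
  then show "\<exists>\<delta>\<in>\<Gamma>. snd (\<delta> + (z - (0, x))) = a \<and> fst (\<delta> + (z - (0, x))) \<in> W"
    by (intro bexI[of _ \<delta>]) (simp_all add: algebra_simps)
qed

lemma mem_cut_coset: "a \<in> cut W (coset \<Gamma> z) \<longleftrightarrow> (\<exists>\<gamma>\<in>\<Gamma>. snd (\<gamma> + z) = a \<and> fst (\<gamma> + z) \<in> W)"
  unfolding cut_def coset_def by blast

lemma rel_cut: "rel z (cut W (coset \<Gamma> z))"
  unfolding rel_def
proof (intro conjI ballI impI)
  fix \<gamma> assume "\<gamma> \<in> \<Gamma>" "fst (\<gamma> + z) \<in> interior W"
  then show "snd (\<gamma> + z) \<in> cut W (coset \<Gamma> z)"
    unfolding mem_cut_coset using subsetD[OF interior_subset] by blast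
next
  fix a assume "a \<in> cut W (coset \<Gamma> z)"
  then show "\<exists>\<gamma>\<in>\<Gamma>. snd (\<gamma> + z) = a \<and> fst (\<gamma> + z) \<in> W" by (simp only: mem_cut_coset)
qed

text \<open>
  The parameter is unique: if \<open>A\<close> has parameters \<open>y\<close> and \<open>y'\<close> over the same point of \<open>A\<close>, then
  moving by \<open>fst y' - fst y\<close> maps a dense subset of the window into the window, and conversely.
\<close>

lemma rel_window_translate:
  assumes y: "rel y A" "rel y' A" "snd y = snd y'" and w: "w \<in> W"
  shows "w + (fst y' - fst y) \<in> W"
proof -
  define h where "h = fst y' - fst y"
  define S where "S = {w. w + h \<in> W}"
  have "S = (\<lambda>w. w + h) -` W" by (auto simp: S_def)
  then have S: "closed S" using W_closed by (auto intro!: closed_vimage continuous_intros)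
  define D where "D = (\<lambda>v. v + fst y) ` fst ` \<Gamma>"
  have D: "closure D = UNIV"
    unfolding D_def using closure_translation[of "fst y" "fst ` \<Gamma>"] dense
    by (simp add: add.commute surj_plus)
  have "interior W \<inter> D \<subseteq> S"
  proof
    fix w assume "w \<in> interior W \<inter> D"
    then obtain \<gamma> where g: "\<gamma> \<in> \<Gamma>" "w = fst (\<gamma> + y)" "fst (\<gamma> + y) \<in> interior W" unfolding D_def by auto
    then have "snd (\<gamma> + y) \<in> A" using rel_interior[OF y(1)] by blast
    then obtain \<delta> where d: "\<delta> \<in> \<Gamma>" "snd (\<delta> + y') = snd (\<gamma> + y)" "fst (\<delta> + y') \<in> W"
      by (rule rel_point[OF y(2)])
    have "\<delta> = \<gamma>" using d(2) y(3) inj_onD[OF inj _ d(1) g(1)] by simp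
    then show "w \<in> S" using d(3) g(2) by (simp add: S_def h_def algebra_simps)
  qed
  then have "closure (interior W \<inter> D) \<subseteq> S" using S by (rule closure_minimal)
  moreover have "interior W \<subseteq> closure (interior W \<inter> D)"
    using open_Int_closure_subset[OF open_interior, of W D] D by simp
  ultimately have "interior W \<subseteq> S" by blast
  then have "closure (interior W) \<subseteq> S" using S by (rule closure_minimal)
  then show ?thesis using w W_closure unfolding S_def h_def by blast
qed

lemma rel_unique_fst:
  assumes "rel (h, a) A" "rel (h', a) A"
  shows "h = h'"
proof -
  have "(\<lambda>w. w + (h' - h)) ` W = W"
  proof
    show "(\<lambda>w. w + (h' - h)) ` W \<subseteq> W"
      using rel_window_translate[OF assms(1,2)] by auto
    show "W \<subseteq> (\<lambda>w. w + (h' - h)) ` W"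
    proof
      fix w assume "w \<in> W"
      then have "w + (h - h') \<in> W" using rel_window_translate[OF assms(2,1)] by simp
      moreover have "w = (w + (h - h')) + (h' - h)" by simp
      ultimately show "w \<in> (\<lambda>w. w + (h' - h)) ` W" by (rule rev_image_eqI)
    qed
  qed
  then have "h' - h = 0" by (rule W_aperiodic)
  then show ?thesis by simp
qed

text \<open>
  The internal coordinate of the point \<open>a\<close> of \<open>A\<close>: all parameters of \<open>A\<close> are congruent modulo \<open>\<Gamma>\<close> to
  \<open>(star A a, a)\<close>.
\<close>

definition star :: "'a set \<Rightarrow> 'a \<Rightarrow> 'h" where
  "star A a = (THE h. rel (h, a) A)"

lemma star_eq: "rel (h, a) A \<Longrightarrow> star A a = h"
  unfolding star_def using rel_unique_fst by blast

lemma star_rel: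
  assumes "rel z A" "a \<in> A"
  shows "rel (star A a, a) A" "star A a \<in> W" "(star A a, a) - z \<in> \<Gamma>"
proof -
  obtain \<gamma> where g: "\<gamma> \<in> \<Gamma>" "snd (\<gamma> + z) = a" "fst (\<gamma> + z) \<in> W" by (rule rel_point[OF assms])
  have eq: "\<gamma> + z = (fst (\<gamma> + z), a)" using g(2) by (metis prod.collapse)
  have r: "rel (fst (\<gamma> + z), a) A" using rel_translate[OF assms(1) g(1)] eq by simp
  then have s: "star A a = fst (\<gamma> + z)" by (rule star_eq)
  show "rel (star A a, a) A" "star A a \<in> W" using r g(3) s by auto
  show "(star A a, a) - z \<in> \<Gamma>" using g(1) s eq by (metis add_diff_cancel_right')
qed

lemma star_diff:
  assumes "rel z A" "a \<in> A" "b \<in> A"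
  shows "(star A b - star A a, b - a) \<in> \<Gamma>"
  using diff[OF star_rel(3)[OF assms(1,3)] star_rel(3)[OF assms(1,2)]] by simp

lemma rel_unique:
  assumes "rel z A" "rel z' A" "a \<in> A"
  shows "z - z' \<in> \<Gamma>"
  using diff[OF star_rel(3)[OF assms(2,3)] star_rel(3)[OF assms(1,3)]] by simp

lemma star_interior:
  assumes "rel z A" "a \<in> A" "\<gamma> \<in> \<Gamma>" "star A a + fst \<gamma> \<in> interior W"
  shows "a + snd \<gamma> \<in> A" "star A (a + snd \<gamma>) = star A a + fst \<gamma>"
proof -
  have r: "rel (star A a, a) A" using star_rel(1)[OF assms(1,2)] .
  show "a + snd \<gamma> \<in> A"
    using rel_interior[OF r assms(3)] assms(4) by (simp add: add.commute)
  have "\<gamma> + (star A a, a) = (star A a + fst \<gamma>, a + snd \<gamma>)"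
    by (simp add: prod_eq_iff add.commute)
  then show "star A (a + snd \<gamma>) = star A a + fst \<gamma>"
    using star_eq rel_translate[OF r assms(3)] by simp
qed

lemma star_shift:
  assumes "rel z A" "a \<in> A"
  shows "star (shift A x) (a - x) = star A a"
proof (rule star_eq)
  show "rel (star A a, a - x) (shift A x)"
    using rel_shift[OF star_rel(1)[OF assms], of x] by simp
qed

text \<open>
  Membership in the interior of the window is an open condition, membership in the window is a closed
  one, and for each point only finitely many lattice vectors matter, so parameters pass to the limit.
\<close>

lemma rel_limit:
  assumes conv: "(\<lambda>k. delone_dist A (B k)) \<longlonglongrightarrow> 0" and A: "delone A"
    and B: "\<And>k. rel (z k) (B k)" and z: "z \<longlonglongrightarrow> l"
  shows "rel l A"
  unfolding rel_def
proof (intro conjI ballI impI)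
  fix \<gamma> assume g: "\<gamma> \<in> \<Gamma>" "fst (\<gamma> + l) \<in> interior W"
  have "(\<lambda>k. fst (\<gamma> + z k)) \<longlonglongrightarrow> fst (\<gamma> + l)" by (intro tendsto_intros z)
  then have "\<forall>\<^sub>F k in sequentially. fst (\<gamma> + z k) \<in> interior W"
    using topological_tendstoD open_interior g(2) by blast
  then have "\<forall>\<^sub>F k in sequentially. snd (\<gamma> + z k) \<in> B k"
    by (rule eventually_mono) (rule rel_interior[OF B g(1)])
  moreover have "(\<lambda>k. snd (\<gamma> + z k)) \<longlonglongrightarrow> snd (\<gamma> + l)" by (intro tendsto_intros z)
  ultimately show "snd (\<gamma> + l) \<in> A" by (rule limit_of_points[OF conv delone_closed[OF A]])
next
  fix a assume a: "a \<in> A"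
  obtain C where C: "C > 0" "\<And>w. w \<in> W \<Longrightarrow> norm w \<le> C" using W_bound by blast
  define K where "K = C + norm (fst l) + norm a + norm (snd l) + 4"
  define X where "X = \<Gamma> \<inter> cball 0 K"
  have finX: "finite X" unfolding X_def using lattice_finite_bounded[OF lat] by simp
  have ev: "\<forall>\<^sub>F k in sequentially. \<exists>\<gamma>\<in>X. fst (\<gamma> + z k) \<in> W \<and> norm (snd (\<gamma> + z k) - a) < e"
    if e: "0 < e" "e \<le> 1" for e
  proof -
    have "\<forall>\<^sub>F k in sequentially. dist (z k) l < 1" using z tendstoD by force
    with close_points_eventually[OF conv e(1), of "norm a"]
    show ?thesis
    proof eventually_elim
      case (elim k)
      then obtain b where b: "b \<in> B k" "norm (b - a) < e" using a by blast
      obtain \<gamma> where g: "\<gamma> \<in> \<Gamma>" "snd (\<gamma> + z k) = b" "fst (\<gamma> + z k) \<in> W" by (rule rel_point[OF B b(1)])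
      have zl: "norm (z k - l) < 1" using elim by (simp add: dist_norm)
      have "norm (fst (z k - l)) < 1" "norm (snd (z k - l)) < 1"
        using zl norm_fst_le[of "fst (z k - l)" "snd (z k - l)"] norm_snd_le[of "snd (z k - l)" "fst (z k - l)"]
        unfolding prod.collapse by linarith+
      then have n: "norm (fst (z k)) \<le> norm (fst l) + 1" "norm (snd (z k)) \<le> norm (snd l) + 1"
        using norm_triangle_ineq[of "fst (z k - l)" "fst l"] norm_triangle_ineq[of "snd (z k - l)" "snd l"]
        by simp_all
      have "norm (fst \<gamma>) \<le> norm (fst (\<gamma> + z k)) + norm (fst (z k))"
        using norm_triangle_ineq4[of "fst (\<gamma> + z k)" "fst (z k)"] by simp
      then have 1: "norm (fst \<gamma>) \<le> C + norm (fst l) + 1" using C(2)[OF g(3)] n(1) by simp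
      have "norm (snd \<gamma>) \<le> norm b + norm (snd (z k))"
        using norm_triangle_ineq4[of "snd (\<gamma> + z k)" "snd (z k)"] g(2) by simp
      moreover have "norm b \<le> norm a + 1" using norm_triangle_ineq[of "b - a" a] b(2) e by simp
      ultimately have 2: "norm (snd \<gamma>) \<le> norm a + norm (snd l) + 2" using n(2) by simp
      have "norm \<gamma> \<le> norm (fst \<gamma>) + norm (snd \<gamma>)" using norm_Pair_le[of "fst \<gamma>" "snd \<gamma>"] by simp
      then have "\<gamma> \<in> X" using 1 2 g(1) unfolding X_def K_def by simp
      then show ?case using g(2,3) b(2) by blast
    qed
  qed
  \<comment> \<open>Only finitely many lattice points are involved, so one of them works in the limit.\<close>
  have "\<exists>\<gamma>\<in>X. fst (\<gamma> + l) \<in> W \<and> snd (\<gamma> + l) = a"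
  proof (rule ccontr)
    assume no: "\<not> ?thesis"
    define T0 where "T0 = W \<times> {a}"
    have T0: "closed T0" unfolding T0_def by (intro closed_Times W_closed closed_singleton)
    have "\<exists>e>0. e \<le> 1 \<and> (\<forall>\<^sub>F k in sequentially. \<not> (fst (\<gamma> + z k) \<in> W \<and> norm (snd (\<gamma> + z k) - a) < e))"
      if g: "\<gamma> \<in> X" for \<gamma>
    proof -
      have "\<gamma> + l \<notin> T0" using no g unfolding T0_def by (auto simp: mem_Times_iff)
      then obtain e where e: "e > 0" "ball (\<gamma> + l) e \<subseteq> - T0"
        using T0 openE[of "- T0"] by (metis ComplI open_Compl)
      have "(\<lambda>k. \<gamma> + z k) \<longlonglongrightarrow> \<gamma> + l" by (intro tendsto_intros z)
      then have "\<forall>\<^sub>F k in sequentially. dist (\<gamma> + z k) (\<gamma> + l) < e / 2" using e(1) tendstoD half_gt_zero by blast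
      then have "\<forall>\<^sub>F k in sequentially. \<not> (fst (\<gamma> + z k) \<in> W \<and> norm (snd (\<gamma> + z k) - a) < min (e / 2) 1)"
      proof (rule eventually_mono, intro notI)
        fix k assume k: "dist (\<gamma> + z k) (\<gamma> + l) < e / 2"
          and *: "fst (\<gamma> + z k) \<in> W \<and> norm (snd (\<gamma> + z k) - a) < min (e / 2) 1"
        have "dist (fst (\<gamma> + z k), a) (\<gamma> + z k) = norm (snd (\<gamma> + z k) - a)"
          by (simp add: dist_norm norm_prod_def norm_minus_commute)
        then have "dist (fst (\<gamma> + z k), a) (\<gamma> + l) < e"
          using k * dist_triangle[of "(fst (\<gamma> + z k), a)" "\<gamma> + l" "\<gamma> + z k"] by simp
        then have "(fst (\<gamma> + z k), a) \<in> ball (\<gamma> + l) e" by (simp add: dist_commute)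
        then have "(fst (\<gamma> + z k), a) \<notin> T0" using e(2) by blast
        then show False using * by (simp add: T0_def)
      qed
      then show ?thesis using e(1) by (intro exI[of _ "min (e / 2) 1"]) simp
    qed
    then have "\<forall>\<gamma>\<in>X. \<exists>e. e > 0 \<and> e \<le> 1 \<and> (\<forall>\<^sub>F k in sequentially. \<not> (fst (\<gamma> + z k) \<in> W \<and> norm (snd (\<gamma> + z k) - a) < e))"
      by blast
    from bchoice[OF this] obtain \<epsilon> where eps: "\<forall>\<gamma>\<in>X. \<epsilon> \<gamma> > 0 \<and> \<epsilon> \<gamma> \<le> (1::real) \<and>
      (\<forall>\<^sub>F k in sequentially. \<not> (fst (\<gamma> + z k) \<in> W \<and> norm (snd (\<gamma> + z k) - a) < \<epsilon> \<gamma>))" ..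
    define e where "e = Min (insert 1 (\<epsilon> ` X))"
    have e: "0 < e" "e \<le> 1" using eps finX by (auto simp: e_def)
    have e_le: "e \<le> \<epsilon> \<gamma>" if "\<gamma> \<in> X" for \<gamma> unfolding e_def using that finX by (intro Min_le) auto
    have "\<forall>\<^sub>F k in sequentially. \<forall>\<gamma>\<in>X. \<not> (fst (\<gamma> + z k) \<in> W \<and> norm (snd (\<gamma> + z k) - a) < \<epsilon> \<gamma>)"
      using eps by (intro eventually_ball_finite[OF finX]) blast
    with ev[OF e] have "\<forall>\<^sub>F k in sequentially. False"
    proof eventually_elim
      case (elim k)
      then obtain \<gamma> where "\<gamma> \<in> X" "fst (\<gamma> + z k) \<in> W" "norm (snd (\<gamma> + z k) - a) < e" by blast
      then show False using elim e_le[of \<gamma>] by force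
    qed
    then show False by simp
  qed
  then show "\<exists>\<gamma>\<in>\<Gamma>. snd (\<gamma> + l) = a \<and> fst (\<gamma> + l) \<in> W" unfolding X_def by blast
qed

text \<open>
  Parameters may be changed by lattice vectors, and the lattice is cocompact.
\<close>

lemma bounded_parameters:
  assumes "\<forall>k::nat. \<exists>z. rel z (B k)"
  obtains z \<sigma> l where "\<forall>k. rel (z k) (B k)" "strict_mono (\<sigma> :: nat \<Rightarrow> nat)" "(z \<circ> \<sigma>) \<longlonglongrightarrow> l"
proof -
  obtain r where r: "r > 0" "\<And>z. \<exists>\<gamma>\<in>\<Gamma>. norm (z - \<gamma>) < r" using lattice_cocompact[OF lat] by metis
  have ex: "\<exists>z. rel z (B k) \<and> norm z \<le> r" for k
  proof -
    obtain z where z: "rel z (B k)" using assms by blast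
    obtain \<gamma> where g: "\<gamma> \<in> \<Gamma>" "norm (z - \<gamma>) < r" using r(2) by blast
    have "rel (- \<gamma> + z) (B k)" using rel_translate[OF z minus[OF g(1)]] .
    then show ?thesis using g(2) by (intro exI[of _ "- \<gamma> + z"]) simp
  qed
  define z where "z k = (SOME z. rel z (B k) \<and> norm z \<le> r)" for k
  have z: "\<forall>k. rel (z k) (B k)" "\<forall>k. norm (z k) \<le> r"
    using someI_ex[OF ex] unfolding z_def by blast+
  have "\<forall>n. z n \<in> cball 0 r" using z(2) by simp
  then obtain l \<sigma> where "strict_mono (\<sigma> :: nat \<Rightarrow> nat)" "(z \<circ> \<sigma>) \<longlonglongrightarrow> l"
    by (rule seq_compactE[OF compact_imp_seq_compact[OF compact_cball]])
  then show ?thesis using that[of z] z(1) by blast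
qed

lemma subseq_conv:
  assumes "(\<lambda>k. delone_dist A (B k)) \<longlonglongrightarrow> 0" "strict_mono (\<sigma> :: nat \<Rightarrow> nat)"
  shows "(\<lambda>k. delone_dist A (B (\<sigma> k))) \<longlonglongrightarrow> 0"
  using LIMSEQ_subseq_LIMSEQ[OF assms] by (simp add: o_def)

text \<open>
  Stars lie in the compact window, and by the previous lemmas every limit of a subsequence of
  them is the star of the limit.
\<close>

lemma star_tendsto:
  assumes conv: "(\<lambda>k. delone_dist A (B k)) \<longlonglongrightarrow> 0" and A: "delone A"
    and B: "\<And>k. \<exists>z. rel z (B k)" and b: "\<And>k. b k \<in> B k" "b \<longlonglongrightarrow> a"
  shows "(\<lambda>k. star (B k) (b k)) \<longlonglongrightarrow> star A a"
proof (rule ccontr)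
  assume "\<not> ?thesis"
  then obtain e where e: "e > 0" "\<not> (\<forall>\<^sub>F k in sequentially. dist (star (B k) (b k)) (star A a) < e)"
    unfolding tendsto_iff by blast
  have "\<exists>k>N. e \<le> dist (star (B k) (b k)) (star A a)" for N
    using e(2) unfolding eventually_sequentially by (meson Suc_le_lessD not_le_imp_less)
  then obtain \<sigma> where s: "strict_mono (\<sigma> :: nat \<Rightarrow> nat)"
    "\<And>k. e \<le> dist (star (B (\<sigma> k)) (b (\<sigma> k))) (star A a)"
    using infinite_enumerate[of "{k. e \<le> dist (star (B k) (b k)) (star A a)}"]
    by (auto simp: infinite_nat_iff_unbounded)
  have relb: "rel (star (B k) (b k), b k) (B k)" "star (B k) (b k) \<in> W" for k
  proof -
    obtain z where "rel z (B k)" using B by blast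
    then show "rel (star (B k) (b k), b k) (B k)" "star (B k) (b k) \<in> W"
      using star_rel(1,2)[OF _ b(1)] by blast+
  qed
  have "\<forall>n. star (B (\<sigma> n)) (b (\<sigma> n)) \<in> W" using relb(2) by blast
  then obtain h \<tau> where t: "strict_mono (\<tau> :: nat \<Rightarrow> nat)"
    "((\<lambda>n. star (B (\<sigma> n)) (b (\<sigma> n))) \<circ> \<tau>) \<longlonglongrightarrow> h"
    by (rule seq_compactE[OF compact_imp_seq_compact[OF W_compact]])
  have mono: "strict_mono (\<lambda>n. \<sigma> (\<tau> n))" using s(1) t(1) by (simp add: strict_mono_def)
  have "(\<lambda>n. (star (B (\<sigma> (\<tau> n))) (b (\<sigma> (\<tau> n))), b (\<sigma> (\<tau> n)))) \<longlonglongrightarrow> (h, a)"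
    using tendsto_Pair[OF t(2) LIMSEQ_subseq_LIMSEQ[OF b(2) mono]] by (simp add: o_def)
  from rel_limit[OF subseq_conv[OF conv mono] A relb(1) this] have "star A a = h" by (rule star_eq)
  moreover have "(\<lambda>n. dist (star (B (\<sigma> (\<tau> n))) (b (\<sigma> (\<tau> n)))) h) \<longlonglongrightarrow> 0"
    using tendsto_dist[OF t(2) tendsto_const[of h]] by (simp add: o_def)
  then have "\<exists>n. dist (star (B (\<sigma> (\<tau> n))) (b (\<sigma> (\<tau> n)))) h < e"
    using order_tendstoD(2)[OF _ e(1)] eventually_happens'[OF sequentially_bot] by blast
  ultimately show False using s(2) by (metis not_le)
qed

end

section \<open>The maximal equicontinuous factor\<close>

context scheme
begin

text \<open>
  Points of a cut that are close to each other differ by one of finitely many lattice vectors, since their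
  internal coordinates lie in the bounded window. Relative density holds because, by compactness,
  finitely many lattice vectors suffice to move any parameter from a bounded set over the interior of the
  window, and all parameters are bounded modulo the lattice.
\<close>

lemma cut_delone: "delone (cut W (coset \<Gamma> z))"
proof -
  obtain C where C: "C > 0" "\<And>w. w \<in> W \<Longrightarrow> norm w \<le> C" using W_bound by blast
  define X where "X = \<Gamma> \<inter> (cball 0 (2 * C) \<times> cball 0 1)"
  have "finite X" unfolding X_def
    using lattice_finite_bounded[OF lat] bounded_Times bounded_cball by blast
  then obtain d where d: "d > 0" "\<forall>x\<in>snd ` X. x \<noteq> 0 \<longrightarrow> d \<le> dist 0 x"
    using finite_set_avoid[of "snd ` X" 0] by auto
  have ud: "uniform_discrete (cut W (coset \<Gamma> z))"
  proof (rule uniformI1[of "min d 1"])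
    show "min d 1 > 0" using d(1) by simp
    fix a b assume a: "a \<in> cut W (coset \<Gamma> z)" and b: "b \<in> cut W (coset \<Gamma> z)" and ab: "dist a b < min d 1"
    obtain \<gamma> where g: "\<gamma> \<in> \<Gamma>" "snd (\<gamma> + z) = a" "fst (\<gamma> + z) \<in> W" using a unfolding mem_cut_coset by blast
    obtain \<delta> where de: "\<delta> \<in> \<Gamma>" "snd (\<delta> + z) = b" "fst (\<delta> + z) \<in> W" using b unfolding mem_cut_coset by blast
    have s: "snd (\<gamma> - \<delta>) = a - b" using g(2) de(2) by auto
    have "norm (fst (\<gamma> - \<delta>)) \<le> norm (fst (\<gamma> + z)) + norm (fst (\<delta> + z))"
      using norm_triangle_ineq4[of "fst (\<gamma> + z)" "fst (\<delta> + z)"] by simp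
    then have "norm (fst (\<gamma> - \<delta>)) \<le> 2 * C" using C(2)[OF g(3)] C(2)[OF de(3)] by linarith
    then have "\<gamma> - \<delta> \<in> X"
      using diff[OF g(1) de(1)] s ab unfolding X_def by (simp add: mem_Times_iff dist_norm norm_minus_commute)
    then have "a - b \<in> snd ` X" using s by (metis imageI)
    moreover have "dist 0 (a - b) < d" using ab by (simp add: dist_norm norm_minus_commute)
    ultimately have "a - b = 0" using d(2) by (meson not_le)
    then show "a = b" by simp
  qed
  obtain r where r: "r > 0" "\<And>z. \<exists>\<gamma>\<in>\<Gamma>. norm (z - \<gamma>) < r" using lattice_cocompact[OF lat] by metis
  define O1 where "O1 \<gamma> = (\<lambda>k :: 'h \<times> 'a. fst (\<gamma> + k)) -` interior W" for \<gamma>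
  have "compact (cball (0 :: 'h \<times> 'a) r)" by (rule compact_cball)
  moreover have "open (O1 \<gamma>)" if "\<gamma> \<in> \<Gamma>" for \<gamma>
    unfolding O1_def by (intro open_vimage open_interior continuous_intros)
  moreover have "cball 0 r \<subseteq> (\<Union>\<gamma>\<in>\<Gamma>. O1 \<gamma>)"
  proof
    fix k :: "'h \<times> 'a"
    obtain w where w: "w \<in> interior W" using W_interior by blast
    obtain e where e: "e > 0" "ball w e \<subseteq> interior W" using w open_interior openE by blast
    have "w - fst k \<in> closure (fst ` \<Gamma>)" using dense by simp
    then obtain v where v: "v \<in> fst ` \<Gamma>" "dist v (w - fst k) < e" using closure_approachable e(1) by blast
    then obtain \<gamma> where g: "\<gamma> \<in> \<Gamma>" "v = fst \<gamma>" by blast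
    have "fst (\<gamma> + k) \<in> ball w e" using v(2) g(2) by (simp add: dist_norm norm_minus_commute algebra_simps)
    then show "k \<in> (\<Union>\<gamma>\<in>\<Gamma>. O1 \<gamma>)" using e(2) g(1) unfolding O1_def by blast
  qed
  ultimately obtain X' where X': "X' \<subseteq> \<Gamma>" "finite X'" "cball 0 r \<subseteq> (\<Union>\<gamma>\<in>X'. O1 \<gamma>)"
    by (rule compactE_image)
  define R where "R = (\<Sum>\<gamma>\<in>X'. norm \<gamma>) + r"
  have "cut W (coset \<Gamma> z) \<inter> ball x R \<noteq> {}" for x
  proof -
    obtain \<gamma>1 where g1: "\<gamma>1 \<in> \<Gamma>" "norm (z - (0, x) - \<gamma>1) < r" using r(2) by blast
    define k where "k = z - (0, x) - \<gamma>1"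
    have "k \<in> cball 0 r" using g1(2) by (simp add: k_def)
    then obtain \<gamma>2 where g2: "\<gamma>2 \<in> X'" "k \<in> O1 \<gamma>2" using X'(3) by blast
    have g2G: "\<gamma>2 \<in> \<Gamma>" using g2(1) X'(1) by blast
    have "fst (\<gamma>2 - \<gamma>1 + z) = fst (\<gamma>2 + k)" by (simp add: k_def)
    moreover have "fst (\<gamma>2 + k) \<in> interior W" using g2(2) unfolding O1_def by blast
    ultimately have W: "fst (\<gamma>2 - \<gamma>1 + z) \<in> W" using subsetD[OF interior_subset, of "fst (\<gamma>2 + k)" W] by metis
    have "snd (\<gamma>2 - \<gamma>1 + z) \<in> cut W (coset \<Gamma> z)"
      unfolding mem_cut_coset using diff[OF g2G g1(1)] W by blast
    moreover have "snd (\<gamma>2 - \<gamma>1 + z) \<in> ball x R"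
    proof -
      have eq: "snd (\<gamma>2 - \<gamma>1 + z) - x = snd (\<gamma>2 + k)" by (simp add: k_def)
      have "norm (snd (\<gamma>2 + k)) \<le> norm (\<gamma>2 + k)" by (metis norm_snd_le prod.collapse)
      also have "\<dots> \<le> norm \<gamma>2 + norm k" by (rule norm_triangle_ineq)
      also have "norm \<gamma>2 \<le> (\<Sum>\<gamma>\<in>X'. norm \<gamma>)" using g2(1) X'(2) by (intro member_le_sum) auto
      also have "(\<Sum>\<gamma>\<in>X'. norm \<gamma>) + norm k < R" using g1(2) by (simp add: R_def k_def)
      finally have "dist (snd (\<gamma>2 - \<gamma>1 + z)) x < R" unfolding dist_norm eq by simp
      then show ?thesis by (metis mem_ball dist_commute)
    qed
    ultimately show ?thesis by blast
  qed
  moreover have "R > 0" unfolding R_def using r(1) by (simp add: add_nonneg_pos sum_nonneg)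
  ultimately show ?thesis unfolding delone_def by (intro conjI ud exI[of _ R] allI)
qed

lemma shift_cut: "shift (cut W (coset \<Gamma> z)) x = cut W (coset \<Gamma> (z - (0, x)))"
proof (rule set_eqI)
  fix a
  have "snd (\<gamma> + z) = a + x \<longleftrightarrow> snd (\<gamma> + (z - (0, x))) = a" "fst (\<gamma> + z) = fst (\<gamma> + (z - (0, x)))" for \<gamma>
    by (auto simp: algebra_simps)
  then show "a \<in> shift (cut W (coset \<Gamma> z)) x \<longleftrightarrow> a \<in> cut W (coset \<Gamma> (z - (0, x)))"
    unfolding in_shift mem_cut_coset by presburger
qed

lemma nonsingular_shift:
  assumes "nonsingular \<Gamma> W (coset \<Gamma> z)"
  shows "nonsingular \<Gamma> W (coset \<Gamma> (z - (0, x)))"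
proof -
  have "fst ` coset \<Gamma> (z - (0, x)) = fst ` coset \<Gamma> z"
    unfolding coset_def image_image by simp
  then show ?thesis using assms coset_in_torus unfolding nonsingular_def by metis
qed

text \<open>
  The hull is the closure of the translates of one non-singular cut, and these are non-singular cuts.
\<close>

lemma window_hull_seq:
  assumes "A \<in> window_hull \<Gamma> W"
  obtains z where "delone A" "\<forall>k. nonsingular \<Gamma> W (coset \<Gamma> (z k))"
    "(\<lambda>k::nat. delone_dist A (cut W (coset \<Gamma> (z k)))) \<longlonglongrightarrow> 0"
proof -
  obtain \<xi> where xi: "nonsingular \<Gamma> W \<xi>" "A \<in> translation_hull (cut W \<xi>)"
    using assms unfolding window_hull_def by blast
  obtain y where y: "\<xi> = coset \<Gamma> y" using xi(1) unfolding nonsingular_def torus_def by blast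
  obtain B where B: "delone A" "\<forall>k. B k \<in> range (shift (cut W \<xi>))" "\<forall>k. delone (B k)"
    "(\<lambda>k::nat. delone_dist A (B k)) \<longlonglongrightarrow> 0"
    using xi(2) unfolding translation_hull_def by (rule delone_closure_seq)
  have "\<forall>k. \<exists>x. B k = shift (cut W \<xi>) x" using B(2) by blast
  from choice[OF this] obtain x where x: "\<forall>k. B k = shift (cut W \<xi>) (x k)" ..
  have Bk: "B k = cut W (coset \<Gamma> (y - (0, x k)))" for k using x shift_cut y by simp
  have ns: "\<forall>k. nonsingular \<Gamma> W (coset \<Gamma> (y - (0, x k)))"
    using nonsingular_shift xi(1) unfolding y by blast
  show ?thesis
    by (rule that[OF B(1) ns B(4)[unfolded Bk]])
qed

lemma window_hull_rel:
  assumes "A \<in> window_hull \<Gamma> W"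
  shows "delone A" "\<exists>z. rel z A"
proof -
  obtain y where y: "delone A" "\<forall>k. nonsingular \<Gamma> W (coset \<Gamma> (y k))"
    "(\<lambda>k::nat. delone_dist A (cut W (coset \<Gamma> (y k)))) \<longlonglongrightarrow> 0"
    using assms by (rule window_hull_seq)
  show "delone A" by (rule y(1))
  have "\<forall>k. \<exists>z. rel z (cut W (coset \<Gamma> (y k)))" using rel_cut by blast
  then obtain z \<sigma> l where z: "\<forall>k. rel (z k) (cut W (coset \<Gamma> (y k)))" "strict_mono (\<sigma> :: nat \<Rightarrow> nat)"
    "(z \<circ> \<sigma>) \<longlonglongrightarrow> l" by (rule bounded_parameters)
  have "rel l A"
    using rel_limit[OF subseq_conv[OF y(3) z(2)] y(1), of "z \<circ> \<sigma>" l] z by simp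
  then show "\<exists>z. rel z A" by blast
qed

lemma shift_in_translation_hull:
  assumes "delone M"
  shows "shift M x \<in> translation_hull M"
  unfolding translation_hull_def
proof (rule delone_seq_closure[where B = "\<lambda>_. shift M x"])
  have "delone_dist (shift M x) (shift M x) = 0"
    using Metric_space.mdist_zero[OF Metric_space_delone] delone_shift[OF assms] by blast
  then show "(\<lambda>k. delone_dist (shift M x) (shift M x)) \<longlonglongrightarrow> 0" by simp
qed (use delone_shift[OF assms] in auto)

lemma cut_in_window_hull:
  assumes "nonsingular \<Gamma> W \<xi>"
  shows "cut W \<xi> \<in> window_hull \<Gamma> W"
proof -
  obtain z where "\<xi> = coset \<Gamma> z" using assms unfolding nonsingular_def torus_def by blast
  then have "shift (cut W \<xi>) 0 \<in> translation_hull (cut W \<xi>)"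
    using shift_in_translation_hull cut_delone by blast
  moreover have "shift (cut W \<xi>) 0 = cut W \<xi>" by (simp add: shift_def)
  ultimately show ?thesis using assms unfolding window_hull_def by auto
qed

lemma translation_hull_window_hull:
  assumes "M \<in> window_hull \<Gamma> W"
  shows "translation_hull M \<subseteq> window_hull \<Gamma> W"
proof -
  obtain \<xi> where xi: "nonsingular \<Gamma> W \<xi>" "M \<in> translation_hull (cut W \<xi>)"
    using assms unfolding window_hull_def by blast
  have "shift M x \<in> translation_hull (cut W \<xi>)" for x
  proof -
    obtain B where B: "delone M" "\<forall>k. B k \<in> range (shift (cut W \<xi>))" "\<forall>k. delone (B k)"
      "(\<lambda>k::nat. delone_dist M (B k)) \<longlonglongrightarrow> 0"
      using xi(2) unfolding translation_hull_def by (rule delone_closure_seq)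
    show ?thesis unfolding translation_hull_def
    proof (rule delone_seq_closure[where B = "\<lambda>k. shift (B k) x"])
      show "shift (B k) x \<in> range (shift (cut W \<xi>))" for k
      proof -
        obtain y where "B k = shift (cut W \<xi>) y" using B(2) by blast
        then show ?thesis by (simp add: shift_shift)
      qed
      show "delone (shift (B k) x)" for k using delone_shift B(3) by blast
    qed (rule delone_shift[OF B(1)], rule shift_conv[OF B(4)])
  qed
  then have "range (shift M) \<subseteq> translation_hull (cut W \<xi>)" by blast
  then have "translation_hull M \<subseteq> translation_hull (cut W \<xi>)"
    unfolding translation_hull_def by (intro closure_of_minimal closedin_closure_of)
  then show ?thesis using xi(1) unfolding window_hull_def by blast
qed

lemma delone_nonempty: "delone A \<Longrightarrow> A \<noteq> {}"
  for A :: "'a set" unfolding delone_def by auto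

lemma rel_coset:
  assumes "delone A" "rel z A" "rel z' A"
  shows "coset \<Gamma> z = coset \<Gamma> z'"
proof -
  obtain a where "a \<in> A" using delone_nonempty[OF assms(1)] by blast
  then show ?thesis using rel_unique[OF assms(2,3)] coset_eq_iff[OF lat] by blast
qed

text \<open>
  A map into the torus whose values are parameters is continuous, since the torus is compact and
  the parameter relation is closed.
\<close>

lemma parameter_continuous:
  assumes p: "\<And>A. A \<in> window_hull \<Gamma> W \<Longrightarrow> \<exists>z. rel z A \<and> p A = coset \<Gamma> z"
  shows "continuous_map (subtopology delone_topology (window_hull \<Gamma> W)) (torus_topology \<Gamma>) p"
proof (rule delone_continuous_mapI)
  show "delone A" if "A \<in> window_hull \<Gamma> W" for A using window_hull_rel(1)[OF that] .
  show "p A \<in> topspace (torus_topology \<Gamma>)" if "A \<in> window_hull \<Gamma> W" for A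
    using p[OF that] coset_in_torus unfolding topspace_torus_topology by metis
  fix U A B assume U: "openin (torus_topology \<Gamma>) U" and A: "A \<in> window_hull \<Gamma> W" "p A \<in> U"
    and B: "\<forall>k::nat. B k \<in> window_hull \<Gamma> W" and conv: "(\<lambda>k. delone_dist A (B k)) \<longlonglongrightarrow> 0"
  have dA: "delone A" and dB: "\<And>k. delone (B k)" using window_hull_rel(1) A(1) B by blast+
  have "\<forall>k. \<exists>z. rel z (B k)" using window_hull_rel(2) B by blast
  then obtain z \<sigma> l where z: "\<forall>k. rel (z k) (B k)" "strict_mono (\<sigma> :: nat \<Rightarrow> nat)"
    "(z \<circ> \<sigma>) \<longlonglongrightarrow> l" by (rule bounded_parameters)
  have l: "rel l A"
    using rel_limit[OF subseq_conv[OF conv z(2)] dA, of "z \<circ> \<sigma>" l] z by simp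
  obtain z' where z': "rel z' A" "p A = coset \<Gamma> z'" using p[OF A(1)] by blast
  have "coset \<Gamma> l \<in> U" using rel_coset[OF dA l z'(1)] z'(2) A(2) by simp
  moreover have "open (coset \<Gamma> -` U)" using U unfolding openin_torus_topology by blast
  ultimately have "\<forall>\<^sub>F k in sequentially. (z \<circ> \<sigma>) k \<in> coset \<Gamma> -` U"
    using topological_tendstoD[OF z(3)] by blast
  then obtain k where k: "coset \<Gamma> (z (\<sigma> k)) \<in> U"
    using eventually_happens'[OF sequentially_bot] by fastforce
  obtain z'' where z'': "rel z'' (B (\<sigma> k))" "p (B (\<sigma> k)) = coset \<Gamma> z''" using p B by blast
  have "p (B (\<sigma> k)) \<in> U" using rel_coset[OF dB z''(1) z(1)[rule_format]] z''(2) k by simp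
  then show "\<exists>k. p (B k) \<in> U" by blast
qed

text \<open>
  Sending a set to the coset of its parameters has the properties that define \<open>pi_max\<close>. Only one map has
  them, since the non-singular cuts are dense in the hull and the torus is a Hausdorff space.
\<close>

lemma pi_max_props:
  "pi_max \<Gamma> W \<in> extensional (window_hull \<Gamma> W) \<and>
   continuous_map (subtopology delone_topology (window_hull \<Gamma> W)) (torus_topology \<Gamma>) (pi_max \<Gamma> W) \<and>
   (\<forall>\<xi>. nonsingular \<Gamma> W \<xi> \<longrightarrow> pi_max \<Gamma> W (cut W \<xi>) = \<xi>) \<and>
   (\<forall>A\<in>window_hull \<Gamma> W. \<exists>z. rel z A \<and> pi_max \<Gamma> W A = coset \<Gamma> z)"
proof -
  define Q where "Q p \<longleftrightarrow> p \<in> extensional (window_hull \<Gamma> W) \<and>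
     continuous_map (subtopology delone_topology (window_hull \<Gamma> W)) (torus_topology \<Gamma>) p \<and>
     (\<forall>\<xi>. nonsingular \<Gamma> W \<xi> \<longrightarrow> p (cut W \<xi>) = \<xi>)" for p
  define p where "p = (\<lambda>A\<in>window_hull \<Gamma> W. coset \<Gamma> (SOME z. rel z A))"
  have p: "\<exists>z. rel z A \<and> p A = coset \<Gamma> z" if "A \<in> window_hull \<Gamma> W" for A
    using that someI_ex[OF window_hull_rel(2)[OF that]] unfolding p_def
    by (intro exI[of _ "SOME z. rel z A"]) simp
  have p_cut: "p (cut W \<xi>) = \<xi>" if ns: "nonsingular \<Gamma> W \<xi>" for \<xi>
  proof -
    obtain y where y: "\<xi> = coset \<Gamma> y" using ns unfolding nonsingular_def torus_def by blast
    have h: "cut W \<xi> \<in> window_hull \<Gamma> W" by (rule cut_in_window_hull[OF ns])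
    obtain z where z: "rel z (cut W \<xi>)" "p (cut W \<xi>) = coset \<Gamma> z" using p[OF h] by blast
    have "rel y (cut W \<xi>)" unfolding y by (rule rel_cut)
    from rel_coset[OF window_hull_rel(1)[OF h] z(1) this] show ?thesis using z(2) y by simp
  qed
  have "p \<in> extensional (window_hull \<Gamma> W)" unfolding p_def by (rule restrict_extensional)
  then have Qp: "Q p" unfolding Q_def using parameter_continuous[OF p] p_cut by blast
  have unique: "q = p" if q: "Q q" for q
  proof (rule extensionalityI)
    show "q \<in> extensional (window_hull \<Gamma> W)" "p \<in> extensional (window_hull \<Gamma> W)"
      using q Qp unfolding Q_def by blast+
    fix A assume A: "A \<in> window_hull \<Gamma> W"
    define S where "S = cut W ` {\<xi>. nonsingular \<Gamma> W \<xi>}"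
    obtain z where z: "delone A" "\<forall>k. nonsingular \<Gamma> W (coset \<Gamma> (z k))"
      "(\<lambda>k::nat. delone_dist A (cut W (coset \<Gamma> (z k)))) \<longlonglongrightarrow> 0"
      using A by (rule window_hull_seq)
    have "A \<in> delone_topology closure_of (window_hull \<Gamma> W \<inter> S)"
    proof (rule delone_seq_closure[OF z(1) _ cut_delone z(3)])
      fix k show "cut W (coset \<Gamma> (z k)) \<in> window_hull \<Gamma> W \<inter> S"
        unfolding S_def using z(2)[rule_format, of k] cut_in_window_hull[OF z(2)[rule_format, of k]] by blast
    qed
    then have "A \<in> subtopology delone_topology (window_hull \<Gamma> W) closure_of S"
      unfolding closure_of_subtopology using A by blast
    moreover have "q x = p x" if "x \<in> S" for x
      using that q Qp unfolding S_def Q_def by auto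
    ultimately show "q A = p A"
      using forall_in_closure_of_eq[OF _ Hausdorff_torus[OF lat], of A _ S q p] q Qp unfolding Q_def by blast
  qed
  have "pi_max \<Gamma> W = (THE p. Q p)" unfolding pi_max_def Q_def by simp
  also have "\<dots> = p" using Qp unique by (rule the_equality)
  finally show ?thesis using Qp p unfolding Q_def by metis
qed

lemma pi_max_eq:
  assumes "A \<in> window_hull \<Gamma> W" "rel z A"
  shows "pi_max \<Gamma> W A = coset \<Gamma> z"
proof -
  obtain z' where "rel z' A" "pi_max \<Gamma> W A = coset \<Gamma> z'" using pi_max_props assms(1) by blast
  then show ?thesis using rel_coset[OF window_hull_rel(1)[OF assms(1)] _ assms(2)] by simp
qed

end

section \<open>Weak and strong pattern equivariance\<close>

lemma agree_delone_dist:
  assumes "R > 0" "agree R A B"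
  shows "delone_dist A B \<le> 1 / R"
proof (rule delone_dist_le)
  have "shift A 0 = A" "shift B 0 = B" by (simp_all add: shift_def)
  then show "close_sets (1 / R) A B"
    using assms unfolding close_sets_def by (intro exI[of _ 0]) simp
qed (use assms in simp)

lemma agree_conv:
  assumes "\<And>n. \<forall>k\<ge>n. agree (real n) A (B k)"
  shows "(\<lambda>k. delone_dist A (B k)) \<longlonglongrightarrow> 0"
proof (rule LIMSEQ_I)
  fix r :: real assume r: "r > 0"
  obtain n where n: "1 / real (Suc n) < r" using nat_approx_posE[OF r] by blast
  have "norm (delone_dist A (B k) - 0) < r" if "k \<ge> Suc n" for k
    using agree_delone_dist[of "real (Suc n)" A "B k"] assms[of "Suc n"] that n delone_dist_nonneg[of A "B k"]
    by simp
  then show "\<exists>N. \<forall>k\<ge>N. norm (delone_dist A (B k) - 0) < r" by blast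
qed

lemma delone_continuous_seq:
  assumes F: "continuous_map (subtopology delone_topology S) euclidean F"
    and S: "\<And>A. A \<in> S \<Longrightarrow> delone A" and A: "A \<in> S" and B: "\<And>k. B k \<in> S"
    and conv: "(\<lambda>k::nat. delone_dist A (B k)) \<longlonglongrightarrow> 0"
  shows "(\<lambda>k. F (B k)) \<longlonglongrightarrow> F A"
proof (rule topological_tendstoI)
  interpret Metric_space "{A :: 'a set. delone A}" delone_dist by (rule Metric_space_delone)
  fix U assume U: "open U" "F A \<in> U"
  have top: "topspace (subtopology delone_topology S) = S"
    using S by (auto simp: delone_topology_def)
  have "openin (subtopology delone_topology S) {x \<in> S. F x \<in> U}"
    using openin_continuous_map_preimage[OF F, of U] U(1) unfolding top by simp
  then obtain V where V: "openin mtopology V" "{x \<in> S. F x \<in> U} = V \<inter> S"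
    unfolding openin_subtopology delone_topology_def by blast
  have "A \<in> V" using V(2) A U(2) by blast
  then obtain r where r: "r > 0" "mball A r \<subseteq> V" using V(1) unfolding openin_mtopology by blast
  have "\<forall>\<^sub>F k in sequentially. delone_dist A (B k) < r" by (rule order_tendstoD(2)[OF conv r(1)])
  then show "\<forall>\<^sub>F k in sequentially. F (B k) \<in> U"
  proof (rule eventually_mono)
    fix k assume "delone_dist A (B k) < r"
    then have "B k \<in> mball A r" using S A B by simp
    then show "F (B k) \<in> U" using r(2) V(2) B by blast
  qed
qed

lemma transversal_topology:
  "subtopology (hull_topology M) (transversal M) = subtopology delone_topology (transversal M)"
proof -
  have "transversal M \<subseteq> topspace (hull_topology M)"
    unfolding transversal_def by (rule closure_of_subset_topspace)
  then have "transversal M \<subseteq> translation_hull M" unfolding hull_topology_def by simp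
  then show ?thesis unfolding hull_topology_def by (simp add: subtopology_subtopology inf_absorb2)
qed

lemma transversal_iff:
  "A \<in> transversal M \<longleftrightarrow> A \<in> translation_hull M \<and> A \<in> delone_topology closure_of (translation_hull M \<inter> shift M ` M)"
  unfolding transversal_def hull_topology_def closure_of_subtopology by blast

context scheme
begin

text \<open>
  Finite local complexity: a short difference of points of \<open>M\<close> is the physical part of a lattice vector
  whose internal part is bounded by the diameter of the window.
\<close>

lemma differences_finite:
  obtains P where "finite P"
    "\<forall>z M x y. rel z M \<longrightarrow> x \<in> M \<longrightarrow> y \<in> M \<longrightarrow> norm (y - x) \<le> R \<longrightarrow> y - x \<in> P"
proof -
  obtain C where C: "C > 0" "\<And>w. w \<in> W \<Longrightarrow> norm w \<le> C" using W_bound by blast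
  define X where "X = \<Gamma> \<inter> (cball 0 (2 * C) \<times> cball 0 R)"
  have "finite X" unfolding X_def
    using lattice_finite_bounded[OF lat] bounded_Times bounded_cball by blast
  moreover have "y - x \<in> snd ` X" if "rel z M" "x \<in> M" "y \<in> M" "norm (y - x) \<le> R" for z M x y
  proof -
    have "norm (star M y - star M x) \<le> 2 * C"
      using norm_triangle_ineq4[of "star M y" "star M x"] C(2)[OF star_rel(2)[OF that(1,2)]]
        C(2)[OF star_rel(2)[OF that(1,3)]] by linarith
    then have "(star M y - star M x, y - x) \<in> X"
      using star_diff[OF that(1-3)] that(4) unfolding X_def by simp
    then show ?thesis by (metis imageI snd_conv)
  qed
  ultimately show ?thesis by (intro that[of "snd ` X"] finite_imageI) blast+
qed

lemma patches_finite:
  assumes "rel z M"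
  shows "finite ((\<lambda>x. shift M x \<inter> ball 0 R) ` M)"
proof -
  obtain P where P: "finite P"
    "\<forall>z M x y. rel z M \<longrightarrow> x \<in> M \<longrightarrow> y \<in> M \<longrightarrow> norm (y - x) \<le> R \<longrightarrow> y - x \<in> P"
    by (rule differences_finite[of R])
  have "(\<lambda>x. shift M x \<inter> ball 0 R) ` M \<subseteq> Pow P"
  proof (intro image_subsetI PowI subsetI)
    fix x y assume x: "x \<in> M" and y: "y \<in> shift M x \<inter> ball 0 R"
    then have "(y + x) - x \<in> P" using P(2)[rule_format, OF assms x, of "y + x"] by simp
    then show "y \<in> P" by simp
  qed
  then show ?thesis using P(1) finite_subset by blast
qed

lemma spe_finite_values:
  assumes "rel z M" "spe M M F"
  shows "finite (F ` M)"
proof -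
  obtain R where R: "\<forall>x1\<in>M. \<forall>x2\<in>M. agree R (shift M x1) (shift M x2) \<longrightarrow> F x1 = F x2"
    using assms(2) unfolding spe_def by blast
  define pat where "pat x = shift M x \<inter> ball 0 R" for x
  have "F x = F (inv_into M pat (pat x))" if "x \<in> M" for x
  proof -
    have i: "inv_into M pat (pat x) \<in> M" "pat (inv_into M pat (pat x)) = pat x"
      using inv_into_into[OF imageI[OF that]] f_inv_into_f[OF imageI[OF that]] by auto
    then have "agree R (shift M x) (shift M (inv_into M pat (pat x)))" unfolding agree_def pat_def by simp
    then show ?thesis using R that i(1) by blast
  qed
  then have "F ` M \<subseteq> (\<lambda>p. F (inv_into M pat p)) ` (pat ` M)" by blast
  then show ?thesis using patches_finite[OF assms(1), of R] unfolding pat_def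
    by (meson finite_imageI finite_subset)
qed

text \<open>Finite local complexity makes the transversal sequentially compact.\<close>

lemma transversal_seq_compact:
  assumes M: "delone M" "rel z M" and x: "\<And>k::nat. x k \<in> M"
  obtains \<sigma> A where "strict_mono (\<sigma> :: nat \<Rightarrow> nat)" "A \<in> transversal M" "delone A"
    "\<forall>n k. n \<le> k \<longrightarrow> agree (real n) A (shift M (x (\<sigma> k)))"
proof -
  define P where "P n s \<longleftrightarrow> (\<forall>i j. agree (real n) (shift M (x (s i))) (shift M (x (s j))))"
    for n and s :: "nat \<Rightarrow> nat"
  interpret subseqs P
  proof
    fix n and s :: "nat \<Rightarrow> nat" assume s: "strict_mono s"
    define f where "f k = shift M (x (s k)) \<inter> ball 0 (real n)" for k
    have "finite (range f)"
      by (rule finite_subset[OF _ patches_finite[OF M(2), of "real n"]]) (use x in \<open>auto simp: f_def\<close>)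
    then obtain k0 where "infinite {k. f k = f k0}"
      using pigeonhole_infinite[OF infinite_UNIV_nat, of f] by auto
    from infinite_enumerate[OF this] obtain r :: "nat \<Rightarrow> nat" where r: "strict_mono r" "\<forall>k. r k \<in> {k. f k = f k0}"
      by blast
    have "P n (s \<circ> r)" unfolding P_def agree_def using r(2) by (simp add: f_def)
    then show "\<exists>r'. strict_mono r' \<and> P n (s \<circ> r')" using r(1) by blast
  qed
  have diag: "P n (diagseq \<circ> (+) (Suc n))" for n
    by (rule diagseq_holds) (auto simp: P_def)
  define \<sigma> where "\<sigma> k = diagseq (Suc k)" for k
  have mono: "strict_mono \<sigma>" using subseq_diagseq unfolding \<sigma>_def strict_mono_def by simp
  have ag: "agree (real n) (shift M (x (\<sigma> i))) (shift M (x (\<sigma> j)))" if ij: "n \<le> i" "n \<le> j" for n i j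
  proof -
    have "agree (real n) (shift M (x (diagseq (Suc n + (i - n))))) (shift M (x (diagseq (Suc n + (j - n)))))"
      using diag[of n] unfolding P_def o_def by blast
    then show ?thesis using ij by (simp add: \<sigma>_def)
  qed
  define A where "A = {y. \<exists>n. norm y < real n \<and> y \<in> shift M (x (\<sigma> n))}"
  have agA: "agree (real n) A (shift M (x (\<sigma> k)))" if nk: "n \<le> k" for n k
    unfolding agree_iff
  proof (intro allI impI iffI)
    fix y assume y: "norm y < real n" "y \<in> A"
    then obtain m where m: "norm y < real m" "y \<in> shift M (x (\<sigma> m))" unfolding A_def by blast
    define N where "N = max m k"
    have "y \<in> shift M (x (\<sigma> N))" using agreeD[OF ag[of m m N] m(1)] m(2) by (simp add: N_def)
    then show "y \<in> shift M (x (\<sigma> k))" using agreeD[OF ag[of n k N] y(1)] nk by (simp add: N_def)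
  next
    fix y assume y: "norm y < real n" "y \<in> shift M (x (\<sigma> k))"
    then have "y \<in> shift M (x (\<sigma> n))" using agreeD[OF ag[of n n k] y(1)] nk by simp
    then show "y \<in> A" unfolding A_def using y(1) by blast
  qed
  have dM: "delone (shift M y)" for y by (rule delone_shift[OF M(1)])
  obtain r where r: "r > 0" "\<forall>a\<in>M. \<forall>b\<in>M. dist a b < r \<longrightarrow> a = b"
    using conjunct1[OF M(1)[unfolded delone_def]] unfolding uniform_discrete_def by blast
  have ud: "uniform_discrete A"
  proof (rule uniformI1[OF r(1)])
    fix a b assume a: "a \<in> A" and b: "b \<in> A" and ab: "dist a b < r"
    obtain n where n: "max (norm a) (norm b) < real n" using reals_Archimedean2 by blast
    have "a + x (\<sigma> n) \<in> M" "b + x (\<sigma> n) \<in> M"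
      using agreeD[OF agA[of n n], of a] agreeD[OF agA[of n n], of b] a b n by auto
    moreover have "dist (a + x (\<sigma> n)) (b + x (\<sigma> n)) < r" using ab by (simp add: dist_norm)
    ultimately have "a + x (\<sigma> n) = b + x (\<sigma> n)" using r(2) by blast
    then show "a = b" by simp
  qed
  obtain R where R: "R > 0" "\<forall>z. M \<inter> ball z R \<noteq> {}"
    using conjunct2[OF M(1)[unfolded delone_def]] by blast
  have "A \<inter> ball y R \<noteq> {}" for y
  proof -
    obtain n where n: "norm y + R < real n" using reals_Archimedean2 by blast
    have "M \<inter> ball (y + x (\<sigma> n)) R \<noteq> {}" using R(2) by blast
    then obtain a where a: "a \<in> M" "dist (y + x (\<sigma> n)) a < R" by auto
    define b where "b = a - x (\<sigma> n)"
    have yb: "dist y b < R" using a(2) by (simp add: b_def dist_norm algebra_simps)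
    have "norm b < real n"
      using norm_triangle_ineq4[of y "y - b"] yb n by (simp add: dist_norm)
    moreover have "b \<in> shift M (x (\<sigma> n))" using a(1) by (simp add: b_def)
    ultimately have "b \<in> A" unfolding A_def by blast
    then show ?thesis using yb by auto
  qed
  then have dA: "delone A" unfolding delone_def by (intro conjI ud exI[of _ R] R(1) allI)
  have conv: "(\<lambda>k. delone_dist A (shift M (x (\<sigma> k)))) \<longlonglongrightarrow> 0"
    by (rule agree_conv) (use agA in blast)
  have "A \<in> translation_hull M" unfolding translation_hull_def
    by (rule delone_seq_closure[OF dA _ dM conv]) blast
  moreover have "A \<in> delone_topology closure_of (translation_hull M \<inter> shift M ` M)"
    by (rule delone_seq_closure[OF dA _ dM conv]) (use x shift_in_translation_hull[OF M(1)] in blast)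
  ultimately have "A \<in> transversal M" unfolding transversal_iff by blast
  then show ?thesis using that[OF mono _ dA] agA by blast
qed

lemma transversal_delone: "A \<in> transversal M \<Longrightarrow> delone A"
  unfolding transversal_iff by (elim conjE, erule delone_closure_seq)

text \<open>
  Continuity on the transversal becomes uniform continuity by sequential compactness.
\<close>

lemma wpe_uniform:
  fixes F :: "'a \<Rightarrow> 'y::metric_space"
  assumes M: "delone M" "rel z M" and F: "wpe M F" and e: "e > 0"
  shows "\<exists>L. \<forall>x\<in>M. \<forall>y\<in>M. agree L (shift M x) (shift M y) \<longrightarrow> dist (F x) (F y) < e"
proof (rule ccontr)
  assume no: "\<not> ?thesis"
  obtain F' where F': "continuous_map (subtopology delone_topology (transversal M)) euclidean F'"
    "\<forall>x\<in>M. F x = F' (shift M x)" using F unfolding wpe_def transversal_topology by blast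
  have "\<forall>k::nat. \<exists>p. fst p \<in> M \<and> snd p \<in> M \<and> agree (real k) (shift M (fst p)) (shift M (snd p)) \<and>
      \<not> dist (F (fst p)) (F (snd p)) < e"
  proof
    fix k :: nat
    obtain x y where "x \<in> M" "y \<in> M" "agree (real k) (shift M x) (shift M y)" "\<not> dist (F x) (F y) < e"
      using no by blast
    then show "\<exists>p. fst p \<in> M \<and> snd p \<in> M \<and> agree (real k) (shift M (fst p)) (shift M (snd p)) \<and>
      \<not> dist (F (fst p)) (F (snd p)) < e" by (intro exI[of _ "(x, y)"]) simp
  qed
  from choice[OF this] obtain p where p: "\<forall>k::nat. fst (p k) \<in> M \<and> snd (p k) \<in> M \<and>
      agree (real k) (shift M (fst (p k))) (shift M (snd (p k))) \<and> \<not> dist (F (fst (p k))) (F (snd (p k))) < e" ..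
  define x y where "x k = fst (p k)" and "y k = snd (p k)" for k
  have xy: "x k \<in> M" "y k \<in> M" "agree (real k) (shift M (x k)) (shift M (y k))" "\<not> dist (F (x k)) (F (y k)) < e" for k
    using p unfolding x_def y_def by auto
  obtain \<sigma> A where A: "strict_mono (\<sigma> :: nat \<Rightarrow> nat)" "A \<in> transversal M" "delone A"
    "\<forall>n k. n \<le> k \<longrightarrow> agree (real n) A (shift M (x (\<sigma> k)))"
    by (rule transversal_seq_compact[OF M xy(1)])
  have "agree (real n) A (shift M (y (\<sigma> k)))" if "n \<le> k" for n k
  proof -
    have "n \<le> \<sigma> k" using seq_suble[OF A(1), of k] that by simp
    then have "agree (real n) (shift M (x (\<sigma> k))) (shift M (y (\<sigma> k)))" using agree_mono[OF xy(3)] by simp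
    then show ?thesis using A(4) that unfolding agree_def by simp
  qed
  then have cy: "(\<lambda>k. delone_dist A (shift M (y (\<sigma> k)))) \<longlonglongrightarrow> 0" by (intro agree_conv) blast
  have cx: "(\<lambda>k. delone_dist A (shift M (x (\<sigma> k)))) \<longlonglongrightarrow> 0" using A(4) by (intro agree_conv) blast
  have inT: "shift M a \<in> transversal M" if a: "a \<in> M" for a
  proof -
    have h: "shift M a \<in> translation_hull M" by (rule shift_in_translation_hull[OF M(1)])
    have "delone_dist (shift M a) (shift M a) = 0"
      using Metric_space.mdist_zero[OF Metric_space_delone] delone_shift[OF M(1)] by blast
    then have "shift M a \<in> delone_topology closure_of (translation_hull M \<inter> shift M ` M)"
      using h a delone_shift[OF M(1)] by (intro delone_seq_closure[where B = "\<lambda>_. shift M a"]) auto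
    then show ?thesis using h unfolding transversal_iff by blast
  qed
  have lim: "(\<lambda>k. F (u k)) \<longlonglongrightarrow> F' A"
    if "\<And>k. u k \<in> M" "(\<lambda>k. delone_dist A (shift M (u k))) \<longlonglongrightarrow> 0" for u :: "nat \<Rightarrow> 'a"
  proof -
    have "(\<lambda>k. F' (shift M (u k))) \<longlonglongrightarrow> F' A"
      by (rule delone_continuous_seq[OF F'(1) transversal_delone A(2) inT[OF that(1)] that(2)])
    then show ?thesis using F'(2) that(1) by simp
  qed
  have "(\<lambda>k. dist (F (x (\<sigma> k))) (F (y (\<sigma> k)))) \<longlonglongrightarrow> dist (F' A) (F' A)"
    by (intro tendsto_dist lim[OF xy(1) cx] lim[OF xy(2) cy])
  then have "\<forall>\<^sub>F k in sequentially. dist (F (x (\<sigma> k))) (F (y (\<sigma> k))) < e"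
    using order_tendstoD(2) e by (metis dist_self)
  then show False using xy(4) eventually_happens'[OF sequentially_bot] by blast
qed

text \<open>
  Finitely many values have a positive minimal distance.
\<close>

lemma spe_of_finite_values:
  fixes F :: "'a \<Rightarrow> real"
  assumes unif: "\<And>e. e > 0 \<Longrightarrow> \<exists>L. \<forall>x\<in>M. \<forall>y\<in>M. agree L (shift M x) (shift M y) \<longrightarrow> dist (F x) (F y) < e"
    and fin: "finite (F ` M)"
  shows "spe M M F"
proof -
  have "uniform_discrete (F ` M)" using fin uniform_discrete_finite_iff by blast
  then obtain e where e: "e > 0" "\<forall>a\<in>F ` M. \<forall>b\<in>F ` M. dist a b < e \<longrightarrow> a = b"
    unfolding uniform_discrete_def by blast
  obtain L where L: "\<forall>x\<in>M. \<forall>y\<in>M. agree L (shift M x) (shift M y) \<longrightarrow> dist (F x) (F y) < e"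
    using unif[OF e(1)] by blast
  have "F x = F y" if "x \<in> M" "y \<in> M" "agree (max L 1) (shift M x) (shift M y)" for x y
    using L e(2) that agree_mono[OF that(3), of L] by simp
  then show ?thesis unfolding spe_def by (intro exI[of _ "max L 1"]) auto
qed

text \<open>
  The sets in the transversal contain the origin, and the star of the origin is a continuous function
  of the set.
\<close>

lemma star_wpe:
  fixes g :: "'h \<Rightarrow> 'y::topological_space"
  assumes M: "M \<in> window_hull \<Gamma> W" and g: "continuous_on UNIV g"
  shows "wpe M (\<lambda>x. g (star M x))"
proof -
  have dM: "delone M" by (rule window_hull_rel(1)[OF M])
  obtain z where z: "rel z M" using window_hull_rel(2)[OF M] by blast
  have T_hull: "A \<in> window_hull \<Gamma> W" if "A \<in> transversal M" for A
    using that translation_hull_window_hull[OF M] unfolding transversal_iff by blast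
  have T0: "0 \<in> A" if A: "A \<in> transversal M" for A
  proof -
    obtain B where B: "delone A" "\<forall>k. B k \<in> translation_hull M \<inter> shift M ` M" "\<forall>k. delone (B k)"
      "(\<lambda>k::nat. delone_dist A (B k)) \<longlonglongrightarrow> 0"
      using A unfolding transversal_iff by (elim conjE) (erule delone_closure_seq)
    have "0 \<in> B k" for k
    proof -
      obtain x where "x \<in> M" "B k = shift M x" using B(2) by blast
      then show ?thesis by simp
    qed
    then have "\<forall>\<^sub>F k in sequentially. 0 \<in> B k" by simp
    then show ?thesis by (rule limit_of_points[OF B(4) delone_closed[OF B(1)] _ tendsto_const])
  qed
  have "continuous_map (subtopology delone_topology (transversal M)) euclidean (\<lambda>A. g (star A 0))"
  proof (rule delone_continuous_mapI)
    fix U A B assume U: "openin euclidean U" and A: "A \<in> transversal M" "g (star A 0) \<in> U"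
      and B: "\<forall>k::nat. B k \<in> transversal M" and conv: "(\<lambda>k. delone_dist A (B k)) \<longlonglongrightarrow> 0"
    have "(\<lambda>k. star (B k) 0) \<longlonglongrightarrow> star A 0"
    proof (rule star_tendsto[OF conv transversal_delone[OF A(1)], of "\<lambda>_. 0"])
      show "\<exists>z. rel z (B k)" for k using window_hull_rel(2)[OF T_hull] B by blast
      show "0 \<in> B k" for k using T0 B by blast
    qed (rule tendsto_const)
    moreover have "isCont g (star A 0)" using g continuous_on_eq_continuous_at open_UNIV by blast
    ultimately have "(\<lambda>k. g (star (B k) 0)) \<longlonglongrightarrow> g (star A 0)" by (rule isCont_tendsto_compose[rotated])
    then have "\<forall>\<^sub>F k in sequentially. g (star (B k) 0) \<in> U"
      using topological_tendstoD U A(2) by (metis open_openin)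
    then show "\<exists>k. g (star (B k) 0) \<in> U" using eventually_happens'[OF sequentially_bot] by blast
  qed (use transversal_delone in auto)
  moreover have "\<forall>x\<in>M. g (star M x) = g (star (shift M x) 0)"
    using star_shift[OF z] by (metis diff_self)
  ultimately show ?thesis unfolding wpe_def transversal_topology by blast
qed

text \<open>
  The patch of \<open>M\<close> around \<open>x\<close> occurs in a non-singular cut. There none of the finitely many lattice
  vectors that decide about the patch leads to a boundary point of the window, so the patch persists
  under small changes of the internal coordinate.
\<close>

lemma patch_region:
  assumes M: "M \<in> window_hull \<Gamma> W" and x: "x \<in> M" and e: "e > 0"
  shows "\<exists>h \<delta>. h \<in> interior W \<and> \<delta> > 0 \<and>
    (\<forall>y\<in>M. norm (star M y - h) < \<delta> \<longrightarrow> agree L (shift M x) (shift M y) \<and> norm (star M y - star M x) < e)"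
proof -
  have dM: "delone M" by (rule window_hull_rel(1)[OF M])
  obtain zM where zM: "rel zM M" using window_hull_rel(2)[OF M] by blast
  have "wpe M (\<lambda>x. star M x)" by (rule star_wpe[OF M continuous_on_id])
  from wpe_uniform[OF dM zM this e] obtain L1 where
    L1: "\<forall>x\<in>M. \<forall>y\<in>M. agree L1 (shift M x) (shift M y) \<longrightarrow> dist (star M x) (star M y) < e" by blast
  define L2 where "L2 = max L L1"
  obtain z where z: "delone M" "\<forall>k. nonsingular \<Gamma> W (coset \<Gamma> (z k))"
    "(\<lambda>k::nat. delone_dist M (cut W (coset \<Gamma> (z k)))) \<longlonglongrightarrow> 0"
    using M by (rule window_hull_seq)
  define e1 where "e1 = 1 / (\<bar>L2\<bar> + norm x + 3)"
  have den: "\<bar>L2\<bar> + norm x + 3 \<ge> 1" using norm_ge_zero[of x] by linarith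
  have e1: "0 < e1" "e1 \<le> 1"
  proof -
    have "0 < \<bar>L2\<bar> + norm x + 3" using den by linarith
    then show "0 < e1" unfolding e1_def by (rule divide_pos_pos[OF zero_less_one])
    have "1 / (\<bar>L2\<bar> + norm x + 3) \<le> 1 / 1" by (rule frac_le) (use den in auto)
    then show "e1 \<le> 1" unfolding e1_def by (simp only: div_by_1)
  qed
  obtain k where k: "delone_dist M (cut W (coset \<Gamma> (z k))) < e1"
    using order_tendstoD(2)[OF z(3) e1(1)] eventually_happens'[OF sequentially_bot] by blast
  obtain e' where e': "0 < e'" "e' < e1" "close_sets e' M (cut W (coset \<Gamma> (z k)))"
    by (rule delone_dist_lessD[OF k e1(2)])
  define B where "B = cut W (coset \<Gamma> (z k))"
  obtain u v where uv: "norm u < e'" "norm v < e'" "agree (1 / e') (shift M u) (shift B v)"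
    using e'(3) unfolding close_sets_def B_def by blast
  have big: "\<bar>L2\<bar> + norm x + 3 < 1 / e'"
  proof -
    have "1 / e1 < 1 / e'" using e'(1,2) by (intro divide_strict_left_mono) auto
    then show ?thesis unfolding e1_def by simp
  qed
  define b where "b = x - u + v"
  have transfer: "w + x \<in> M \<longleftrightarrow> w + b \<in> B" if w: "norm w \<le> \<bar>L2\<bar>" for w
  proof -
    have "norm (w + x - u) \<le> norm w + norm x + norm u"
      using norm_triangle_ineq4[of "w + x" u] norm_triangle_ineq[of w x] by linarith
    then have "norm (w + x - u) < 1 / e'" using big w uv(1) e'(2) e1(2) by linarith
    then have "w + x - u \<in> shift M u \<longleftrightarrow> w + x - u \<in> shift B v" using agreeD[OF uv(3)] by blast
    then show ?thesis by (simp add: b_def algebra_simps)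
  qed
  have bB: "b \<in> B" using transfer[of 0] x by simp
  obtain \<gamma>0 where g0: "\<gamma>0 \<in> \<Gamma>" "snd (\<gamma>0 + z k) = b" "fst (\<gamma>0 + z k) \<in> W"
    using bB unfolding B_def mem_cut_coset by blast
  define h where "h = fst (\<gamma>0 + z k)"
  have hb: "\<gamma>0 + z k = (h, b)" using g0(2) by (simp add: h_def prod_eq_iff)
  have Bmem: "w + b \<in> B \<longleftrightarrow> (\<exists>\<gamma>\<in>\<Gamma>. snd \<gamma> = w \<and> h + fst \<gamma> \<in> W)" for w
  proof -
    have "coset \<Gamma> (z k) = coset \<Gamma> (h, b)"
      unfolding hb[symmetric] using coset_eq_iff[OF lat] minus[OF g0(1)] by simp
    then have "w + b \<in> B \<longleftrightarrow> (\<exists>\<gamma>\<in>\<Gamma>. snd (\<gamma> + (h, b)) = w + b \<and> fst (\<gamma> + (h, b)) \<in> W)"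
      unfolding B_def by (simp only: mem_cut_coset)
    then show ?thesis by (simp add: add.commute)
  qed
  have reg: "h + fst \<gamma> \<notin> frontier W" if "\<gamma> \<in> \<Gamma>" for \<gamma>
  proof -
    have "(\<gamma> + \<gamma>0) + z k \<in> coset \<Gamma> (z k)" using add[OF that g0(1)] unfolding coset_def by blast
    then have "fst ((\<gamma> + \<gamma>0) + z k) \<notin> frontier W"
      using z(2) unfolding nonsingular_def by blast
    then show ?thesis by (simp add: h_def algebra_simps)
  qed
  have int: "h + fst \<gamma> \<in> interior W" if "\<gamma> \<in> \<Gamma>" "h + fst \<gamma> \<in> W" for \<gamma>
    using reg[OF that(1)] that(2) W_closed by (simp add: frontier_def closure_closed)
  have hW: "h \<in> interior W" using int[OF zero] g0(3) by (simp add: h_def)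
  obtain C where C: "C > 0" "\<And>w. w \<in> W \<Longrightarrow> norm w \<le> C" using W_bound by blast
  define X where "X = \<Gamma> \<inter> (cball 0 (2 * C) \<times> cball 0 \<bar>L2\<bar>)"
  have finX: "finite X" unfolding X_def
    using lattice_finite_bounded[OF lat] bounded_Times bounded_cball by blast
  define S where "S = (\<Inter>\<gamma>\<in>X. (\<lambda>k. k + fst \<gamma>) -` (if h + fst \<gamma> \<in> W then interior W else - W))"
  have "open S" unfolding S_def
    by (intro open_INT finX ballI open_vimage continuous_intros) (simp add: W_closed open_Compl)
  moreover have "h \<in> S" unfolding S_def using int by (auto simp: X_def)
  ultimately obtain \<delta> where d: "\<delta> > 0" "ball h \<delta> \<subseteq> S" using openE by blast
  have main: "agree L2 (shift M x) (shift M y)" if y: "y \<in> M" "norm (star M y - h) < \<delta>" for y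
    unfolding agree_iff in_shift
  proof (intro allI impI)
    fix w :: 'a assume w: "norm w < L2"
    have sS: "star M y \<in> S" using d(2) y(2) by (auto simp: dist_norm norm_minus_commute subset_iff)
    have S_iff: "(star M y + fst \<gamma> \<in> interior W \<longleftrightarrow> h + fst \<gamma> \<in> W) \<and> (star M y + fst \<gamma> \<in> W \<longleftrightarrow> h + fst \<gamma> \<in> W)"
      if "\<gamma> \<in> X" for \<gamma>
    proof -
      have "star M y + fst \<gamma> \<in> (if h + fst \<gamma> \<in> W then interior W else - W)"
        using sS that unfolding S_def by blast
      then show ?thesis using interior_subset[of W] by (auto split: if_splits)
    qed
    have "w + y \<in> M \<longleftrightarrow> w + b \<in> B"
    proof
      assume wy: "w + y \<in> M"
      define \<gamma> where "\<gamma> = (star M (w + y) - star M y, w)"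
      have g: "\<gamma> \<in> \<Gamma>" using star_diff[OF zM y(1) wy] by (simp add: \<gamma>_def)
      have sW: "star M (w + y) \<in> W" "star M y \<in> W" using star_rel(2)[OF zM] wy y(1) by blast+
      have "norm (fst \<gamma>) \<le> 2 * C"
        using norm_triangle_ineq4[of "star M (w + y)" "star M y"] C(2)[OF sW(1)] C(2)[OF sW(2)]
        by (simp add: \<gamma>_def)
      then have gX: "\<gamma> \<in> X" using g w by (simp add: X_def mem_Times_iff \<gamma>_def)
      have "star M y + fst \<gamma> \<in> W" using sW by (simp add: \<gamma>_def)
      then have "h + fst \<gamma> \<in> W" using S_iff[OF gX] by blast
      then show "w + b \<in> B" unfolding Bmem using g by (intro bexI[of _ \<gamma>]) (simp_all add: \<gamma>_def)
    next
      assume "w + b \<in> B"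
      then obtain \<gamma> where g: "\<gamma> \<in> \<Gamma>" "snd \<gamma> = w" "h + fst \<gamma> \<in> W" unfolding Bmem by blast
      have "norm (fst \<gamma>) \<le> norm (h + fst \<gamma>) + norm h" using norm_triangle_ineq4[of "h + fst \<gamma>" h] by simp
      then have "norm (fst \<gamma>) \<le> 2 * C" using C(2)[OF g(3)] C(2)[OF g0(3)] by (simp add: h_def)
      then have gX: "\<gamma> \<in> X" using g(1,2) w by (simp add: X_def mem_Times_iff)
      have "star M y + fst \<gamma> \<in> interior W" using S_iff[OF gX] g(3) by blast
      then show "w + y \<in> M" using star_interior(1)[OF zM y(1) g(1)] g(2) by (simp add: add.commute)
    qed
    then show "w + x \<in> M \<longleftrightarrow> w + y \<in> M" using transfer[of w] w by simp
  qed
  have "agree L (shift M x) (shift M y) \<and> norm (star M y - star M x) < e"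
    if "y \<in> M" "norm (star M y - h) < \<delta>" for y
  proof -
    have "agree L2 (shift M x) (shift M y)" using main that by blast
    then have "agree L (shift M x) (shift M y)" "agree L1 (shift M x) (shift M y)"
      by (auto elim: agree_mono simp: L2_def)
    then show ?thesis using L1 x that(1) by (metis dist_norm norm_minus_commute)
  qed
  then show ?thesis using hW d(1) by blast
qed

end

section \<open>The graph dual to the Voronoi complex is connected\<close>

lemma closer_iff: "dist z x \<le> dist z y \<longleftrightarrow> 2 * ((y - x) \<bullet> z) \<le> y \<bullet> y - x \<bullet> x"
  for x y z :: "'a::euclidean_space"
proof -
  have "dist z x \<le> dist z y \<longleftrightarrow> (z - x) \<bullet> (z - x) \<le> (z - y) \<bullet> (z - y)"
    unfolding dist_norm by (rule norm_le)
  also have "\<dots> \<longleftrightarrow> 2 * ((y - x) \<bullet> z) \<le> y \<bullet> y - x \<bullet> x"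
    unfolding inner_diff_left inner_diff_right inner_commute[of z x] inner_commute[of z y]
      right_diff_distrib by (rule iffI; linarith)
  finally show ?thesis .
qed

lemma equidistant_iff: "dist z x = dist z y \<longleftrightarrow> 2 * ((y - x) \<bullet> z) = y \<bullet> y - x \<bullet> x"
  for x y z :: "'a::euclidean_space"
proof -
  have "dist z y \<le> dist z x \<longleftrightarrow> 2 * ((y - x) \<bullet> z) \<ge> y \<bullet> y - x \<bullet> x"
    unfolding closer_iff[of z y x] inner_diff_left right_diff_distrib by (rule iffI; linarith)
  then show ?thesis using closer_iff[of z x y] by (metis antisym_conv order_refl)
qed

lemma bisector_unique:
  fixes x y u :: "'a::euclidean_space"
  assumes "y \<noteq> x" "u \<noteq> x" "{z. (y - x) \<bullet> z = (y \<bullet> y - x \<bullet> x) / 2} = {z. (u - x) \<bullet> z = (u \<bullet> u - x \<bullet> x) / 2}"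
  shows "u = y"
proof -
  define a b where "a = y - x" and "b = u - x"
  have aa: "a \<bullet> a > 0" using assms(1) by (simp add: a_def)
  define m where "m = (1/2) *\<^sub>R (x + y)"
  have m: "a \<bullet> m = (y \<bullet> y - x \<bullet> x) / 2"
    by (simp add: a_def m_def inner_diff_left inner_add_right inner_commute[of y x])
  have sets: "a \<bullet> z = (y \<bullet> y - x \<bullet> x) / 2 \<longleftrightarrow> b \<bullet> z = (u \<bullet> u - x \<bullet> x) / 2" for z
    using assms(3) unfolding a_def b_def set_eq_iff mem_Collect_eq by blast
  have bm: "b \<bullet> m = (u \<bullet> u - x \<bullet> x) / 2" using sets[of m] m by simp
  define v where "v = b - ((a \<bullet> b) / (a \<bullet> a)) *\<^sub>R a"
  have av: "a \<bullet> v = 0" using aa by (simp add: v_def inner_diff_right)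
  have "b \<bullet> (m + v) = (u \<bullet> u - x \<bullet> x) / 2"
    using sets[of "m + v"] m av by (simp add: inner_add_right)
  then have bv: "b \<bullet> v = 0" using bm unfolding inner_add_right by linarith
  have "v \<bullet> v = b \<bullet> v - ((a \<bullet> b) / (a \<bullet> a)) * (a \<bullet> v)" by (simp add: v_def inner_diff_left)
  then have "v = 0" using av bv by simp
  then obtain l where l: "b = l *\<^sub>R a" unfolding v_def by simp
  have l0: "l \<noteq> 0" using assms(2) l by (auto simp: b_def)
  have u: "u = x + l *\<^sub>R a" using l by (simp add: b_def algebra_simps)
  have y: "y = x + a" by (simp add: a_def)
  have "l * (a \<bullet> m) = (u \<bullet> u - x \<bullet> x) / 2" using bm l by simp
  moreover have "a \<bullet> m = a \<bullet> x + (a \<bullet> a) / 2" by (simp add: m_def y inner_add_right algebra_simps)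
  moreover have "(u \<bullet> u - x \<bullet> x) / 2 = l * (a \<bullet> x) + l * l * (a \<bullet> a) / 2"
    by (simp add: u inner_add_left inner_add_right inner_commute[of x a] algebra_simps)
  ultimately have "l * (a \<bullet> a) = l * l * (a \<bullet> a)" by (simp add: algebra_simps)
  then have "l = 1" using l0 aa by simp
  then show ?thesis using u y by simp
qed

lemma dual_edge_sym: "dual_edge M x y \<longleftrightarrow> dual_edge M y x"
  unfolding dual_edge_def by (metis insert_commute)

lemma dual_edge_mem: "dual_edge M x y \<Longrightarrow> x \<in> M \<and> y \<in> M"
  unfolding dual_edge_def dual_vertices_def by blast

text \<open>
  Both ends of an edge are nearest points of \<open>M\<close> to a common point.
\<close>

lemma dual_edge_length:
  assumes "\<And>z. M \<inter> ball z r \<noteq> {}" "dual_edge M x y"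
  shows "norm (y - x) < 2 * r"
proof -
  obtain G where G: "voronoi_face M (int DIM('a) - 1) G" "dual_vertices M G = {x, y}"
    using assms(2) unfolding dual_edge_def by blast
  obtain z where z: "z \<in> G" using G(1) unfolding voronoi_face_def by blast
  have "x \<in> dual_vertices M G" "y \<in> dual_vertices M G" using G(2) by auto
  then have near: "\<forall>m\<in>M. dist z x \<le> dist z m" "\<forall>m\<in>M. dist z y \<le> dist z m"
    using z unfolding dual_vertices_def voronoi_cell_def by blast+
  obtain m where "m \<in> M" "dist z m < r" using assms(1)[of z] by auto
  then have "dist z x < r" "dist z y < r" using near by force+
  then show ?thesis
    using dist_triangle[of y x z] by (simp add: dist_norm norm_minus_commute)
qed

text \<open>
  Some facet of the Voronoi cell of \<open>x\<close> lies in a hyperplane that separates \<open>q\<close> from the cell. This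
  hyperplane is the bisector of \<open>x\<close> and a point \<open>y\<close> of \<open>M\<close>, which is therefore closer to \<open>q\<close>. No other
  point of \<open>M\<close> has the facet in its cell, since a bisector with \<open>x\<close> determines the other point.
\<close>

lemma dual_neighbour_closer:
  fixes M :: "'a::euclidean_space set"
  assumes M: "delone M" and x: "x \<in> M" and q: "q \<notin> voronoi_cell M x"
  shows "\<exists>y. dual_edge M x y \<and> dist q y < dist q x"
proof -
  obtain r where r: "r > 0" "\<forall>a\<in>M. \<forall>b\<in>M. dist a b < r \<longrightarrow> a = b"
    using conjunct1[OF M[unfolded delone_def]] unfolding uniform_discrete_def by blast
  have ud: "uniform_discrete M" using M unfolding delone_def by (rule conjunct1)
  obtain R where R: "R > 0" "\<forall>z. M \<inter> ball z R \<noteq> {}"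
    using conjunct2[OF M[unfolded delone_def]] by blast
  define H where "H y = {z. (y - x) \<bullet> z \<le> (y \<bullet> y - x \<bullet> x) / 2}" for y
  have H: "z \<in> H y \<longleftrightarrow> dist z x \<le> dist z y" for z y unfolding H_def closer_iff by auto
  define N where "N = {y \<in> M. y \<noteq> x \<and> dist x y < 2 * R}"
  have finN: "finite N"
  proof -
    have "finite (M \<inter> ball x (2 * R))"
      using uniform_discrete_finite_iff[of "M \<inter> ball x (2 * R)"] ud by (auto intro: bounded_subset)
    then show ?thesis by (rule rev_finite_subset) (auto simp: N_def)
  qed
  \<comment> \<open>Finitely many half-spaces cut out the cell, since the cell has radius less than \<open>R\<close>.\<close>
  have cell: "voronoi_cell M x = \<Inter>(H ` N)"
  proof
    show "voronoi_cell M x \<subseteq> \<Inter>(H ` N)" unfolding voronoi_cell_def N_def by (auto simp: H)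
    show "\<Inter>(H ` N) \<subseteq> voronoi_cell M x"
    proof
      fix z assume z: "z \<in> \<Inter>(H ` N)"
      have zR: "dist z x < R"
      proof (rule ccontr)
        assume "\<not> dist z x < R"
        then have zx: "dist z x \<ge> R" by simp
        have pos: "dist z x > 0" using zx R(1) by linarith
        define t where "t = R / dist z x"
        have t: "0 < t" "t \<le> 1" using zx R(1) pos unfolding t_def by simp_all
        define p where "p = x + t *\<^sub>R (z - x)"
        have "dist p x = t * dist z x" using t(1) by (simp add: p_def dist_norm)
        then have px: "dist p x = R" using pos by (simp add: t_def)
        obtain m where m: "m \<in> M" "dist p m < R" using R(2) by (metis disjoint_iff mem_ball)
        have "m \<noteq> x" using m(2) px by auto
        moreover have "dist x m < 2 * R"
          using dist_triangle[of x m p] px m(2) by (simp add: dist_commute)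
        ultimately have "m \<in> N" using m(1) by (simp add: N_def)
        then have "z \<in> H m" "x \<in> H m" using z by (auto simp: H)
        moreover have "convex (H m)" unfolding H_def by (rule convex_halfspace_le)
        moreover have "p = (1 - t) *\<^sub>R x + t *\<^sub>R z" by (simp add: p_def algebra_simps)
        ultimately have "p \<in> H m" using t convexD[of "H m" x z "1 - t" t] by simp
        then show False using px m(2) by (simp add: H)
      qed
      have "dist z x \<le> dist z y" if y: "y \<in> M" for y
      proof (rule ccontr)
        assume c: "\<not> ?thesis"
        then have "dist x y < 2 * R" using dist_triangle[of x y z] zR by (simp add: dist_commute)
        then have "y \<in> N" using c y by (auto simp: N_def)
        then show False using z c by (auto simp: H)
      qed
      then show "z \<in> voronoi_cell M x" by (simp add: voronoi_cell_def)
    qed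
  qed
  \<comment> \<open>A minimal family of half-spaces: its boundaries support the facets.\<close>
  define \<F> where "\<F> = {F. F \<subseteq> H ` N \<and> \<Inter>F = voronoi_cell M x}"
  have "finite \<F>" unfolding \<F>_def using finN by simp
  moreover have "H ` N \<in> \<F>" unfolding \<F>_def using cell by simp
  ultimately obtain F where F: "F \<in> \<F>" "\<And>F'. F' \<in> \<F> \<Longrightarrow> F' \<subseteq> F \<Longrightarrow> F' = F"
    using finite_has_minimal[of \<F>] by (metis empty_iff)
  have FH: "F \<subseteq> H ` N" "\<Inter>F = voronoi_cell M x" using F(1) unfolding \<F>_def by auto
  have finF: "finite F" using FH(1) finN finite_subset by blast
  define n where "n h = inv_into N H h" for h
  have n: "n h \<in> N" "H (n h) = h" if "h \<in> F" for h
    using that FH(1) inv_into_into[of h H N] f_inv_into_f[of h H N] unfolding n_def by blast+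
  have full: "affine hull voronoi_cell M x = UNIV"
  proof (rule affine_hull_nonempty_interior)
    have "ball x (r / 2) \<subseteq> voronoi_cell M x"
    proof
      fix z assume z: "z \<in> ball x (r / 2)"
      have "dist z x \<le> dist z y" if y: "y \<in> M" for y
      proof (rule ccontr)
        assume c: "\<not> ?thesis"
        have "dist x z < r / 2" using z by simp
        then have "dist x y < r" using c dist_triangle[of x y z] by (simp add: dist_commute)
        then have "x = y" using r(2) x y by blast
        then show False using c by simp
      qed
      then show "z \<in> voronoi_cell M x" by (simp add: voronoi_cell_def)
    qed
    then have "x \<in> interior (voronoi_cell M x)"
      using r(1) by (meson centre_in_ball half_gt_zero interior_maximal open_ball subsetD)
    then show "interior (voronoi_cell M x) \<noteq> {}" by blast
  qed
  have facet: "C facet_of voronoi_cell M x \<longleftrightarrow>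
      (\<exists>h. h \<in> F \<and> C = voronoi_cell M x \<inter> {z. (n h - x) \<bullet> z = (n h \<bullet> n h - x \<bullet> x) / 2})" for C
  proof (rule facet_of_polyhedron_explicit[OF finF])
    show "voronoi_cell M x = affine hull voronoi_cell M x \<inter> \<Inter>F" using FH(2) full by simp
    show "n h - x \<noteq> 0 \<and> h = {z. (n h - x) \<bullet> z \<le> (n h \<bullet> n h - x \<bullet> x) / 2}" if "h \<in> F" for h
      using n[OF that] unfolding H_def N_def by auto
    show "voronoi_cell M x \<subset> affine hull voronoi_cell M x \<inter> \<Inter>F'" if "F' \<subset> F" for F'
    proof -
      have "F' \<notin> \<F>" using F(2)[of F'] that by blast
      then have "\<Inter>F' \<noteq> voronoi_cell M x" using that FH(1) unfolding \<F>_def by blast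
      moreover have "voronoi_cell M x \<subseteq> \<Inter>F'" using that FH(2) by blast
      ultimately show ?thesis using full by auto
    qed
  qed
  obtain h where h: "h \<in> F" "q \<notin> h" using q FH(2) by blast
  define y where "y = n h"
  have y: "y \<in> M" "y \<noteq> x" "dist q y < dist q x"
    using n[OF h(1)] h(2) H[of q y] unfolding y_def N_def by auto
  define T where "T u = {z. (u - x) \<bullet> z = (u \<bullet> u - x \<bullet> x) / 2}" for u
  have T: "z \<in> T u \<longleftrightarrow> dist z x = dist z u" for z u unfolding T_def equidistant_iff by auto
  define G where "G = voronoi_cell M x \<inter> T y"
  have Gf: "G facet_of voronoi_cell M x" unfolding facet using h(1) unfolding G_def y_def T_def by blast
  have dimx: "aff_dim (voronoi_cell M x) = int DIM('a)" using full aff_dim_eq_full by blast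
  have G: "G face_of voronoi_cell M x" "G \<noteq> {}" "aff_dim G = int DIM('a) - 1"
    using Gf dimx unfolding facet_of_def by auto
  have hyp: "affine hull G = T u" if "G \<subseteq> T u" "u \<noteq> x" for u
  proof (rule affine_dim_equal)
    show "affine (T u)" unfolding T_def by (rule affine_hyperplane)
    then show "affine hull G \<subseteq> T u" using that(1) by (rule hull_minimal[rotated])
    show "aff_dim (affine hull G) = aff_dim (T u)"
      unfolding T_def aff_dim_affine_hull G(3) using that(2) by (subst aff_dim_hyperplane) auto
  qed (use G(2) in auto)
  have "dual_vertices M G = {x, y}"
  proof
    show "{x, y} \<subseteq> dual_vertices M G"
      unfolding dual_vertices_def G_def voronoi_cell_def using x y(1) by (auto simp: T)
    show "dual_vertices M G \<subseteq> {x, y}"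
    proof
      fix u assume u: "u \<in> dual_vertices M G"
      show "u \<in> {x, y}"
      proof (cases "u = x")
        case False
        have "dist z x = dist z u" if z: "z \<in> G" for z
        proof (rule antisym)
          have "u \<in> M" using u unfolding dual_vertices_def by blast
          then show "dist z x \<le> dist z u" using z unfolding G_def voronoi_cell_def by blast
          have "z \<in> voronoi_cell M u" using u z unfolding dual_vertices_def by blast
          then show "dist z u \<le> dist z x" using x unfolding voronoi_cell_def by blast
        qed
        then have "G \<subseteq> T u" by (auto simp: T)
        then have "T y = T u" using hyp[of u] hyp[of y] False y(2) unfolding G_def by blast
        then have "u = y" unfolding T_def by (rule bisector_unique[OF y(2) False])
        then show ?thesis by simp
      qed simp
    qed
  qed
  then have "dual_edge M x y"
    unfolding dual_edge_def voronoi_face_def using G x y(2) by blast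
  then show ?thesis using y(3) by blast
qed

text \<open>
  Walking greedily towards \<open>q\<close> along dual edges reaches \<open>q\<close>, since only finitely many points of \<open>M\<close> are
  closer to \<open>q\<close> than the starting point.
\<close>

lemma constant_on_edges:
  fixes M :: "'a::euclidean_space set"
  assumes M: "delone M" and F: "\<And>x y. dual_edge M x y \<Longrightarrow> F x = F y"
    and xq: "x \<in> M" "q \<in> M"
  shows "F x = F q"
proof -
  have ud: "uniform_discrete M" using M unfolding delone_def by (rule conjunct1)
  have fin: "finite (M \<inter> ball q d)" for d
    using uniform_discrete_finite_iff[of "M \<inter> ball q d"] ud by (auto intro: bounded_subset)
  show ?thesis using xq(1)
  proof (induction "card (M \<inter> ball q (dist q x))" arbitrary: x rule: less_induct)
    case less
    show ?case
    proof (cases "x = q")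
      case False
      then have "q \<notin> voronoi_cell M x" using xq(2) unfolding voronoi_cell_def by (auto intro!: bexI[of _ q])
      then obtain y where y: "dual_edge M x y" "dist q y < dist q x"
        using dual_neighbour_closer[OF M less.prems] by blast
      have yM: "y \<in> M" using dual_edge_mem[OF y(1)] by blast
      have "M \<inter> ball q (dist q y) \<subset> M \<inter> ball q (dist q x)" using y(2) yM by auto
      then have "card (M \<inter> ball q (dist q y)) < card (M \<inter> ball q (dist q x))"
        by (rule psubset_card_mono[OF fin])
      then have "F y = F q" using less.hyps yM by blast
      then show ?thesis using F[OF y(1)] by simp
    qed simp
  qed
qed

section \<open>Cohomology classes of coboundaries\<close>

lemma spe_zero: "spe M M (\<lambda>x. 0)"
  unfolding spe_def by (intro exI[of _ 1]) simp

lemma spe_diff: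
  assumes "spe M M F" "spe M M G"
  shows "spe M M (\<lambda>x. F x - G x)"
proof -
  obtain R1 where R1: "R1 > 0" "\<forall>x1\<in>M. \<forall>x2\<in>M. agree R1 (shift M x1) (shift M x2) \<longrightarrow> F x1 = F x2"
    using assms(1) unfolding spe_def by blast
  obtain R2 where R2: "R2 > 0" "\<forall>x1\<in>M. \<forall>x2\<in>M. agree R2 (shift M x1) (shift M x2) \<longrightarrow> G x1 = G x2"
    using assms(2) unfolding spe_def by blast
  have "F x1 - G x1 = F x2 - G x2"
    if "x1 \<in> M" "x2 \<in> M" "agree (max R1 R2) (shift M x1) (shift M x2)" for x1 x2
  proof -
    have "agree R1 (shift M x1) (shift M x2)" "agree R2 (shift M x1) (shift M x2)"
      using agree_mono[OF that(3)] by simp_all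
    then have "F x1 = F x2" "G x1 = G x2" using R1(2) R2(2) that(1,2) by blast+
    then show ?thesis by simp
  qed
  moreover have "max R1 R2 > 0" using R1(1) by simp
  ultimately show ?thesis unfolding spe_def by blast
qed

lemma spe_add:
  fixes F G :: "'a::real_normed_vector \<Rightarrow> 'y::ab_group_add"
  assumes "spe M M F" "spe M M G"
  shows "spe M M (\<lambda>x. F x + G x)"
  using spe_diff[OF assms(1) spe_diff[OF spe_zero assms(2)]] by simp

lemma coh_class_subset:
  assumes G: "spe M M G" and eq: "\<And>x y. \<alpha> x y = \<beta> x y + on_edges M (coboundary G) x y"
  shows "coh_class M \<alpha> \<subseteq> coh_class M \<beta>"
proof
  fix \<gamma> assume "\<gamma> \<in> coh_class M \<alpha>"
  then obtain F where F: "spe M M F" "\<gamma> = (\<lambda>x y. \<alpha> x y + on_edges M (coboundary F) x y)"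
    unfolding coh_class_def by blast
  have "\<gamma> = (\<lambda>x y. \<beta> x y + on_edges M (coboundary (\<lambda>z. G z + F z)) x y)"
    unfolding F(2) eq by (intro ext) (simp add: on_edges_def coboundary_def algebra_simps)
  then show "\<gamma> \<in> coh_class M \<beta>" unfolding coh_class_def using spe_add[OF G F(1)] by blast
qed

lemma coh_class_eqI:
  assumes G: "spe M M G" and eq: "\<And>x y. \<alpha> x y = \<beta> x y + on_edges M (coboundary G) x y"
  shows "coh_class M \<alpha> = coh_class M \<beta>"
proof
  show "coh_class M \<alpha> \<subseteq> coh_class M \<beta>" by (rule coh_class_subset[OF assms])
  show "coh_class M \<beta> \<subseteq> coh_class M \<alpha>"
  proof (rule coh_class_subset)
    show "spe M M (\<lambda>x. 0 - G x)" by (rule spe_diff[OF spe_zero G])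
    show "\<beta> x y = \<alpha> x y + on_edges M (coboundary (\<lambda>x. 0 - G x)) x y" for x y
      unfolding eq by (simp add: on_edges_def coboundary_def)
  qed
qed

lemma coh_class_eqD:
  assumes "coh_class M \<alpha> = coh_class M \<beta>"
  obtains G where "spe M M G" "\<alpha> = (\<lambda>x y. \<beta> x y + on_edges M (coboundary G) x y)"
proof -
  have "\<alpha> = (\<lambda>x y. \<alpha> x y + on_edges M (coboundary (\<lambda>x. 0)) x y)"
    by (intro ext) (simp add: on_edges_def coboundary_def)
  then have "\<alpha> \<in> coh_class M \<alpha>" unfolding coh_class_def using spe_zero by blast
  then have "\<alpha> \<in> coh_class M \<beta>" using assms by simp
  then obtain G where "spe M M G" "\<alpha> = (\<lambda>x y. \<beta> x y + on_edges M (coboundary G) x y)"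
    unfolding coh_class_def by blast
  then show ?thesis by (rule that)
qed

lemma sum_cyclic_differences:
  fixes f :: "nat \<Rightarrow> 'y::ab_group_add"
  shows "(\<Sum>i<n. f (Suc i mod n) - f i) = 0"
proof (cases n)
  case (Suc m)
  have "(\<Sum>i<Suc m. f (Suc i mod Suc m)) = (\<Sum>i<m. f (Suc i)) + f 0"
    by simp
  also have "\<dots> = (\<Sum>i<Suc m. f i)" by (simp only: sum.lessThan_Suc_shift add.commute)
  finally show ?thesis unfolding Suc sum_subtractf by simp
qed simp

text \<open>
  The radius in the definition of \<open>spe2\<close> exceeds the lengths of all edges.
\<close>

lemma coboundary_cocycle:
  fixes F :: "'a::euclidean_space \<Rightarrow> 'y::ab_group_add"
  assumes "spe2 M (coboundary F)"
  shows "on_edges M (coboundary F) \<in> spe_cocycles1 M"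
proof -
  obtain R0 R where R0: "\<forall>z. M \<inter> ball z (R0 / 3) \<noteq> {}" and R: "R > 0"
    "\<forall>x1\<in>M. \<forall>y1\<in>M. \<forall>x2\<in>M. \<forall>y2\<in>M. norm (y1 - x1) \<le> R0 \<and> norm (y2 - x2) \<le> R0 \<and> y1 - x1 = y2 - x2 \<and>
          agree R (shift M x1) (shift M x2) \<longrightarrow> coboundary F x1 y1 = coboundary F x2 y2"
    using assms unfolding spe2_def by blast
  have "cochain1 M (on_edges M (coboundary F))"
    unfolding cochain1_def
  proof (intro conjI allI)
    show "on_edges M (on_edges M (coboundary F)) = on_edges M (coboundary F)"
      by (intro ext) (simp add: on_edges_def)
    show "on_edges M (coboundary F) y x = - on_edges M (coboundary F) x y" for x y
      using dual_edge_sym[of M x y] by (simp add: on_edges_def coboundary_def)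
  qed
  moreover have "on_edges M (coboundary F) x1 y1 = on_edges M (coboundary F) x2 y2"
    if e: "dual_edge M x1 y1" "dual_edge M x2 y2" "y1 - x1 = y2 - x2" "agree R (shift M x1) (shift M x2)"
    for x1 y1 x2 y2
  proof -
    have len: "norm (y - x) \<le> R0" if "dual_edge M x y" for x y
    proof -
      have "norm (y - x) < 2 * (R0 / 3)" using dual_edge_length[OF _ that] R0 by blast
      then show ?thesis using norm_ge_zero[of "y - x"] by linarith
    qed
    have mem: "x1 \<in> M" "y1 \<in> M" "x2 \<in> M" "y2 \<in> M" using dual_edge_mem e(1,2) by blast+
    have "coboundary F x1 y1 = coboundary F x2 y2"
      using R(2) mem len[OF e(1)] len[OF e(2)] e(3,4) by blast
    then show ?thesis using e(1,2) by (simp add: on_edges_def)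
  qed
  moreover have "(\<Sum>i<length xs. on_edges M (coboundary F) (xs ! i) (xs ! (Suc i mod length xs))) = 0"
    if "boundary_cycle M G xs" for G xs
  proof -
    have "(\<Sum>i<length xs. on_edges M (coboundary F) (xs ! i) (xs ! (Suc i mod length xs))) =
        (\<Sum>i<length xs. F (xs ! (Suc i mod length xs)) - F (xs ! i))"
      using that unfolding boundary_cycle_def by (intro sum.cong) (simp_all add: on_edges_def coboundary_def)
    also have "\<dots> = 0" by (rule sum_cyclic_differences)
    finally show ?thesis .
  qed
  ultimately show ?thesis unfolding spe_cocycles1_def spe_cochain1_def using R(1) by blast
qed

section \<open>The cohomology of the torus\<close>

context scheme
begin

text \<open>
  Sums of a continuous function over the points of a set in the hull depend continuously on the set
  when they are localised by a weight that vanishes continuously at the boundary of a ball.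
\<close>

definition weight :: "real \<Rightarrow> 'a \<Rightarrow> real" where
  "weight R x = max 0 (R - norm x)"

definition local_sum :: "real \<Rightarrow> ('h \<times> 'a \<Rightarrow> real) \<Rightarrow> 'a set \<Rightarrow> real" where
  "local_sum R f A = (\<Sum>x\<in>A \<inter> ball 0 R. weight R x * f (star A x, x))"

lemma delone_finite_ball: "delone A \<Longrightarrow> finite (A \<inter> cball x R)"
  for A :: "'a set"
proof -
  assume "delone A"
  then have "uniform_discrete (A \<inter> cball x R)"
    unfolding delone_def by (elim conjE) (rule uniform_discrete_subset, assumption, simp)
  moreover have "bounded (A \<inter> cball x R)" by (rule bounded_subset[OF bounded_cball[of x R]]) blast
  ultimately show ?thesis using uniform_discrete_finite_iff by blast
qed

lemma local_sum_tendsto: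
  assumes A: "A \<in> window_hull \<Gamma> W" and B: "\<And>k::nat. B k \<in> window_hull \<Gamma> W"
    and conv: "(\<lambda>k. delone_dist A (B k)) \<longlonglongrightarrow> 0" and f: "continuous_on UNIV f"
  shows "(\<lambda>k. local_sum R f (B k)) \<longlonglongrightarrow> local_sum R f A"
proof -
  have dA: "delone A" and dB: "\<And>k. delone (B k)" using window_hull_rel(1) A B by blast+
  have rB: "\<And>k. \<exists>z. rel z (B k)" and rA: "\<exists>z. rel z A" using window_hull_rel(2) A B by blast+
  define AR where "AR = A \<inter> cball 0 R"
  have finAR: "finite AR" unfolding AR_def by (rule delone_finite_ball[OF dA])
  define b where "b k a = closest_point (B k) a" for k a
  have clB: "closed (B k)" "B k \<noteq> {}" for k using delone_closed[OF dB] delone_nonempty[OF dB] by blast+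
  have bB: "b k a \<in> B k" for k a unfolding b_def by (rule closest_point_in_set[OF clB])
  have b_le: "dist a (b k a) \<le> dist a c" if "c \<in> B k" for k a c
    unfolding b_def by (rule closest_point_le[OF clB(1) that])
  have b_lim: "(\<lambda>k. b k a) \<longlonglongrightarrow> a" if a: "a \<in> A" for a
  proof (rule tendstoI)
    fix e :: real assume "e > 0"
    from close_points_eventually[OF conv this, of "norm a"]
    show "\<forall>\<^sub>F k in sequentially. dist (b k a) a < e"
    proof (rule eventually_mono)
      fix k assume "(\<forall>b\<in>B k. norm b \<le> norm a \<longrightarrow> (\<exists>c\<in>A. norm (c - b) < e)) \<and>
        (\<forall>c\<in>A. norm c \<le> norm a \<longrightarrow> (\<exists>b\<in>B k. norm (b - c) < e))"
      then obtain c where "c \<in> B k" "norm (c - a) < e" using a by blast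
      then show "dist (b k a) a < e" using b_le[of c k a] by (simp add: dist_norm norm_minus_commute)
    qed
  qed
  have term_lim: "(\<lambda>k. weight R (b k a) * f (star (B k) (b k a), b k a)) \<longlonglongrightarrow> weight R a * f (star A a, a)"
    if a: "a \<in> A" for a
  proof -
    have s: "(\<lambda>k. star (B k) (b k a)) \<longlonglongrightarrow> star A a"
      by (rule star_tendsto[OF conv dA rB bB b_lim[OF a]])
    have "isCont f (star A a, a)" using f continuous_on_eq_continuous_at open_UNIV by blast
    then have "(\<lambda>k. f (star (B k) (b k a), b k a)) \<longlonglongrightarrow> f (star A a, a)"
      using tendsto_Pair[OF s b_lim[OF a]] by (rule isCont_tendsto_compose)
    moreover have "(\<lambda>k. weight R (b k a)) \<longlonglongrightarrow> weight R a"
      unfolding weight_def by (intro tendsto_max tendsto_intros b_lim[OF a])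
    ultimately show ?thesis by (rule tendsto_mult[rotated])
  qed
  have lim: "(\<lambda>k. \<Sum>a\<in>AR. weight R (b k a) * f (star (B k) (b k a), b k a)) \<longlonglongrightarrow>
      (\<Sum>a\<in>AR. weight R a * f (star A a, a))"
    by (intro tendsto_sum term_lim) (simp add: AR_def)
  have limA: "(\<Sum>a\<in>AR. weight R a * f (star A a, a)) = local_sum R f A"
    unfolding local_sum_def
  proof (rule sum.mono_neutral_right[OF finAR])
    show "A \<inter> ball 0 R \<subseteq> AR" by (auto simp: AR_def)
    show "\<forall>a\<in>AR - A \<inter> ball 0 R. weight R a * f (star A a, a) = 0"
      by (auto simp: AR_def weight_def)
  qed
  obtain P where P: "finite P"
    "\<forall>z M x y. rel z M \<longrightarrow> x \<in> M \<longrightarrow> y \<in> M \<longrightarrow> norm (y - x) \<le> 1 \<longrightarrow> y - x \<in> P"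
    by (rule differences_finite[of 1])
  obtain d0 where d0: "d0 > 0" "\<forall>x\<in>P. x \<noteq> 0 \<longrightarrow> d0 \<le> dist 0 x"
    using finite_set_avoid[OF P(1), of 0] by auto
  define d where "d = min d0 1"
  have d: "d > 0" using d0 by (simp add: d_def)
  have sep: "x = y" if "rel z M" "x \<in> M" "y \<in> M" "norm (y - x) < d" for z M x y
  proof -
    have "norm (y - x) \<le> 1" using that(4) by (simp add: d_def)
    then have "y - x \<in> P" by (rule P(2)[rule_format, OF that(1-3)])
    moreover have "dist 0 (y - x) < d0" using that(4) by (simp add: d_def dist_norm norm_minus_commute)
    ultimately have "y - x = 0" using d0(2) by (meson not_le)
    then show ?thesis by simp
  qed
  \<comment> \<open>No point of \<open>A\<close> lies just outside the closed ball of radius \<open>R\<close>.\<close>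
  obtain e0 where e0: "e0 > 0" "\<And>a. a \<in> A \<Longrightarrow> norm a < R + e0 \<Longrightarrow> norm a \<le> R"
  proof -
    have "finite (norm ` (A \<inter> cball 0 (R + 1)))" using delone_finite_ball[OF dA] by blast
    then obtain e where e: "e > 0" "\<forall>t\<in>norm ` (A \<inter> cball 0 (R + 1)). t \<noteq> R \<longrightarrow> e \<le> dist R t"
      using finite_set_avoid by blast
    have "norm a \<le> R" if "a \<in> A" "norm a < R + min e 1" for a
    proof (rule ccontr)
      assume c: "\<not> ?thesis"
      have "norm a \<in> norm ` (A \<inter> cball 0 (R + 1))" using that by auto
      then have "e \<le> dist R (norm a)" using e(2) c by force
      then show False using that(2) c by (simp add: dist_real_def)
    qed
    then show ?thesis using that[of "min e 1"] e(1) by simp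
  qed
  define e where "e = min (d / 2) e0"
  have e: "e > 0" using d e0(1) by (simp add: e_def)
  have ev: "\<forall>\<^sub>F k in sequentially. (\<Sum>a\<in>AR. weight R (b k a) * f (star (B k) (b k a), b k a)) = local_sum R f (B k)"
    using close_points_eventually[OF conv e, of R]
  proof (rule eventually_mono)
    fix k assume k: "(\<forall>b\<in>B k. norm b \<le> R \<longrightarrow> (\<exists>a\<in>A. norm (a - b) < e)) \<and>
        (\<forall>a\<in>A. norm a \<le> R \<longrightarrow> (\<exists>b\<in>B k. norm (b - a) < e))"
    obtain zA where zA: "rel zA A" using rA by blast
    obtain zB where zB: "rel zB (B k)" using rB by blast
    have near: "dist a (b k a) < e" if aAR: "a \<in> AR" for a
    proof -
      have "a \<in> A" "norm a \<le> R" using aAR by (auto simp: AR_def)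
      then obtain c where "c \<in> B k" "norm (c - a) < e" using k by blast
      then show ?thesis using b_le[of c k a] by (simp add: dist_norm norm_minus_commute)
    qed
    have "inj_on (b k) AR"
    proof (rule inj_onI)
      fix x y assume xy: "x \<in> AR" "y \<in> AR" "b k x = b k y"
      have "dist y x < d" using dist_triangle2[of y x "b k x"] near[OF xy(1)] near[OF xy(2)] xy(3) by (simp add: e_def)
      then show "x = y" using sep[OF zA, of x y] xy(1,2) by (simp add: AR_def dist_norm)
    qed
    then have "(\<Sum>a\<in>AR. weight R (b k a) * f (star (B k) (b k a), b k a)) =
        (\<Sum>c\<in>b k ` AR. weight R c * f (star (B k) c, c))" by (simp add: sum.reindex)
    also have "\<dots> = local_sum R f (B k)" unfolding local_sum_def
    proof (rule sum.mono_neutral_right)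
      show "finite (b k ` AR)" using finAR by simp
      show "B k \<inter> ball 0 R \<subseteq> b k ` AR"
      proof
        fix c assume c: "c \<in> B k \<inter> ball 0 R"
        then obtain a where a: "a \<in> A" "norm (a - c) < e" using k by auto
        have "norm a < R + e0" using norm_triangle_ineq[of "a - c" c] a(2) c by (simp add: e_def)
        then have aR: "a \<in> AR" using e0(2) a(1) by (simp add: AR_def)
        have "dist c (b k a) < d"
          using dist_triangle2[of c "b k a" a] near[OF aR] a(2) by (simp add: e_def dist_norm norm_minus_commute)
        then have "c = b k a" using sep[OF zB _ bB[of k a], of c] c by (simp add: dist_norm norm_minus_commute)
        then show "c \<in> b k ` AR" using aR by blast
      qed
      show "\<forall>c\<in>b k ` AR - B k \<inter> ball 0 R. weight R c * f (star (B k) c, c) = 0"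
        using bB by (auto simp: weight_def)
    qed
    finally show "(\<Sum>a\<in>AR. weight R (b k a) * f (star (B k) (b k a), b k a)) = local_sum R f (B k)" .
  qed
  show ?thesis using lim unfolding limA tendsto_cong[OF ev] .
qed

lemma shift_tendsto:
  fixes M :: "'a set"
  assumes "x \<longlonglongrightarrow> l"
  shows "(\<lambda>k. delone_dist (shift M l) (shift M (x k))) \<longlonglongrightarrow> 0"
proof (rule LIMSEQ_I)
  fix r :: real assume "r > 0"
  then have r2: "r / 2 > 0" by simp
  obtain N where N: "\<forall>k\<ge>N. norm (x k - l) < r / 2" using LIMSEQ_D[OF assms r2] by blast
  have "norm (delone_dist (shift M l) (shift M (x k)) - 0) < r" if "k \<ge> N" for k
  proof -
    have "shift (shift M l) (x k - l) = shift (shift M (x k)) 0" by (simp add: shift_shift)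
    then have "close_sets (r / 2) (shift M l) (shift M (x k))"
      unfolding close_sets_def using N that r2
      by (intro exI[of _ "x k - l"] exI[of _ 0]) (simp add: agree_def)
    from delone_dist_le[OF r2 this] show ?thesis
      using \<open>r > 0\<close> delone_dist_nonneg[of "shift M l" "shift M (x k)"] by simp
  qed
  then show "\<exists>N. \<forall>k\<ge>N. norm (delone_dist (shift M l) (shift M (x k)) - 0) < r" by blast
qed

text \<open>
  Pulled back to the hull, the character \<open>cis (2 * pi * (a \<bullet> z))\<close> takes at \<open>M - x\<close> the value
  \<open>cis (2 * pi * (c - a \<bullet> (0, x)))\<close>, which the pattern around \<open>x\<close> does not determine. A homotopy
  subtracts from the phase the weighted average of \<open>a \<bullet> (star A y, y)\<close> over the points \<open>y\<close> of \<open>A\<close> near the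
  origin. The new phase is an average of the values of \<open>a\<close> at differences \<open>(star A x, x) - (star A y, y)\<close>.
  These are lattice vectors, and the pattern determines them.
\<close>

lemma character_lift:
  assumes M: "M \<in> window_hull \<Gamma> W" and a: "\<And>\<gamma>. \<gamma> \<in> \<Gamma> \<Longrightarrow> a \<bullet> \<gamma> \<in> \<int>"
  shows "\<exists>g \<tau> G c. continuous_map (torus_topology \<Gamma>) circle g \<and>
    bruschlinsky_lift M (g \<circ> pi_max \<Gamma> W) \<tau> \<and> spe M M G \<and>
    (\<forall>y\<in>M. \<tau> y = c - a \<bullet> (star M y, y) + G y)"
proof -
  have dM: "delone M" by (rule window_hull_rel(1)[OF M])
  obtain zM where zM: "rel zM M" using window_hull_rel(2)[OF M] by blast
  have cis_int: "cis (2 * pi * u) = cis (2 * pi * v)" if "u - v \<in> \<int>" for u v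
  proof -
    have "cis (2 * pi * u) = cis (2 * pi * v) * cis (2 * pi * (u - v))"
      by (simp add: cis_mult algebra_simps)
    then show ?thesis using cis_multiple_2pi[OF that] by simp
  qed
  define g where "g \<xi> = cis (2 * pi * (a \<bullet> (SOME z. coset \<Gamma> z = \<xi>)))" for \<xi>
  have g: "g (coset \<Gamma> z) = cis (2 * pi * (a \<bullet> z))" for z
  proof -
    have "coset \<Gamma> (SOME z'. coset \<Gamma> z' = coset \<Gamma> z) = coset \<Gamma> z"
      by (rule someI[of "\<lambda>z'. coset \<Gamma> z' = coset \<Gamma> z" z]) simp
    then have "(SOME z'. coset \<Gamma> z' = coset \<Gamma> z) - z \<in> \<Gamma>" using coset_eq_iff[OF lat] by blast
    then have "a \<bullet> (SOME z'. coset \<Gamma> z' = coset \<Gamma> z) - a \<bullet> z \<in> \<int>" using a by (metis inner_diff_right)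
    then show ?thesis unfolding g_def by (rule cis_int)
  qed
  have g_cont: "continuous_map (torus_topology \<Gamma>) circle g"
  proof (rule continuous_compose_quotient_map[OF quotient_map_coset])
    have "continuous_on UNIV (\<lambda>z. cis (2 * pi * (a \<bullet> z)))" by (intro continuous_intros)
    then show "continuous_map euclidean circle (g \<circ> coset \<Gamma>)"
      unfolding o_def g continuous_map_in_subtopology by (simp add: image_subset_iff)
  qed
  \<comment> \<open>On the hull the map is \<open>cis (2 * pi * (a \<bullet> (star A x, x)))\<close>, for any point \<open>x\<close> of \<open>A\<close>.\<close>
  have g_hull: "g (pi_max \<Gamma> W A) = cis (2 * pi * (a \<bullet> (star A x, x)))"
    if A: "A \<in> window_hull \<Gamma> W" "x \<in> A" for A x
  proof -
    obtain z where "rel z A" using window_hull_rel(2)[OF A(1)] by blast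
    then have "rel (star A x, x) A" using star_rel(1) A(2) by blast
    then show ?thesis using pi_max_eq[OF A(1)] g by simp
  qed
  obtain \<rho> where rho: "\<rho> > 0" "\<forall>z. M \<inter> ball z \<rho> \<noteq> {}"
    using conjunct2[OF dM[unfolded delone_def]] by blast
  define R where "R = 2 * \<rho>"
  define X where "X = translation_hull M"
  have XW: "A \<in> window_hull \<Gamma> W" if "A \<in> X" for A
    using translation_hull_window_hull[OF M] that unfolding X_def by blast
  have shX: "shift M x \<in> X" for x unfolding X_def by (rule shift_in_translation_hull[OF dM])
  have near0: "\<exists>x\<in>A. norm x < R" if A: "A \<in> X" for A
  proof -
    obtain B where B: "delone A" "\<forall>k. B k \<in> range (shift M)" "\<forall>k. delone (B k)"
      "(\<lambda>k::nat. delone_dist A (B k)) \<longlonglongrightarrow> 0"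
      using A unfolding X_def translation_hull_def by (rule delone_closure_seq)
    obtain k where k: "\<forall>b\<in>B k. norm b \<le> \<rho> \<longrightarrow> (\<exists>a\<in>A. norm (a - b) < \<rho>)"
      using close_points_eventually[OF B(4) rho(1), of \<rho>] eventually_happens'[OF sequentially_bot] by blast
    obtain x where x: "B k = shift M x" using B(2) by blast
    have "M \<inter> ball x \<rho> \<noteq> {}" using rho(2) by blast
    then obtain m where m: "m \<in> M" "dist x m < \<rho>" by auto
    have "m - x \<in> B k" "norm (m - x) \<le> \<rho>" using m unfolding x by (auto simp: dist_norm norm_minus_commute)
    then obtain y where "y \<in> A" "norm (y - (m - x)) < \<rho>" using k by blast
    moreover have "norm y \<le> norm (y - (m - x)) + norm (m - x)"
      using norm_triangle_ineq[of "y - (m - x)" "m - x"] by simp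
    ultimately show ?thesis using \<open>norm (m - x) \<le> \<rho>\<close> by (intro bexI[of _ y]) (simp_all add: R_def)
  qed
  define N where "N = local_sum R (\<lambda>_. 1)"
  have N_pos: "N A > 0" if A: "A \<in> X" for A
  proof -
    obtain x where x: "x \<in> A" "norm x < R" using near0[OF A] by blast
    have fin: "finite (A \<inter> ball 0 R)"
      using delone_finite_ball[OF window_hull_rel(1)[OF XW[OF A]], of 0 R] by (rule rev_finite_subset) auto
    have "0 < weight R x" using x(2) by (simp add: weight_def)
    also have "\<dots> \<le> (\<Sum>x\<in>A \<inter> ball 0 R. weight R x)"
      using x fin by (intro member_le_sum) (auto simp: weight_def)
    finally show ?thesis by (simp add: N_def local_sum_def)
  qed
  define \<psi> where "\<psi> A = - local_sum R (\<lambda>p. a \<bullet> p) A / N A" for A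
  have \<psi>_lim: "(\<lambda>k. \<psi> (B k)) \<longlonglongrightarrow> \<psi> A"
    if A: "A \<in> X" and B: "\<And>k::nat. B k \<in> X" and conv: "(\<lambda>k. delone_dist A (B k)) \<longlonglongrightarrow> 0" for A B
  proof -
    have 1: "(\<lambda>k. local_sum R (\<lambda>p. a \<bullet> p) (B k)) \<longlonglongrightarrow> local_sum R (\<lambda>p. a \<bullet> p) A"
      by (rule local_sum_tendsto[OF XW[OF A] XW[OF B] conv]) (intro continuous_intros)
    have 2: "(\<lambda>k. N (B k)) \<longlonglongrightarrow> N A" unfolding N_def
      by (rule local_sum_tendsto[OF XW[OF A] XW[OF B] conv]) (intro continuous_intros)
    have "N A \<noteq> 0" using N_pos[OF A] by simp
    from tendsto_divide[OF tendsto_minus[OF 1] 2 this] show ?thesis unfolding \<psi>_def .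
  qed
  \<comment> \<open>The sum of the phase and of \<open>\<psi>\<close> is an average of values of \<open>a\<close> at lattice vectors, which
      the pattern determines.\<close>
  define avg where "avg A x0 = - (\<Sum>x\<in>A \<inter> ball 0 R. weight R x * (a \<bullet> ((star A x, x) - (star A x0, x0)))) / N A" for A x0
  have avg: "a \<bullet> (star A x0, x0) + \<psi> A = avg A x0" if A: "A \<in> X" for A x0
  proof -
    have S: "(\<Sum>x\<in>A \<inter> ball 0 R. weight R x * (a \<bullet> ((star A x, x) - (star A x0, x0)))) =
        local_sum R (\<lambda>p. a \<bullet> p) A - (a \<bullet> (star A x0, x0)) * N A"
      unfolding inner_diff_right right_diff_distrib sum_subtractf sum_distrib_right[symmetric]
        local_sum_def N_def by simp
    show ?thesis unfolding avg_def \<psi>_def S using N_pos[OF A] by (simp add: diff_divide_distrib)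
  qed
  have avg_local: "avg A x0 = avg B x0"
    if AB: "A \<in> X" "B \<in> X" "agree R A B" "x0 \<in> A" "x0 \<in> B" for A B x0
  proof -
    have eq: "A \<inter> ball 0 R = B \<inter> ball 0 R" using AB(3) unfolding agree_def .
    obtain zA zB where z: "rel zA A" "rel zB B" using window_hull_rel(2) XW AB(1,2) by meson
    have "(star A x, x) - (star A x0, x0) = (star B x, x) - (star B x0, x0)" if x: "x \<in> A \<inter> ball 0 R" for x
    proof -
      have xA: "x \<in> A" and xB: "x \<in> B" using x eq by blast+
      have "(star A x - star A x0, x - x0) \<in> \<Gamma>" "(star B x - star B x0, x - x0) \<in> \<Gamma>"
        using star_diff[OF z(1) AB(4) xA] star_diff[OF z(2) AB(5) xB] by auto
      then have "(star A x - star A x0, x - x0) = (star B x - star B x0, x - x0)"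
        using inj_onD[OF inj] by (metis snd_conv)
      then show ?thesis by simp
    qed
    then have "(\<Sum>x\<in>A \<inter> ball 0 R. weight R x * (a \<bullet> ((star A x, x) - (star A x0, x0)))) =
        (\<Sum>x\<in>B \<inter> ball 0 R. weight R x * (a \<bullet> ((star B x, x) - (star B x0, x0))))"
      unfolding eq[symmetric] by (intro sum.cong) simp_all
    moreover have "N A = N B" unfolding N_def local_sum_def eq by simp
    ultimately show ?thesis unfolding avg_def by simp
  qed
  define f where "f = g \<circ> pi_max \<Gamma> W"
  define f' where "f' A = f A * cis (2 * pi * \<psi> A)" for A
  have f'_avg: "f' A = cis (2 * pi * avg A x)" if "A \<in> X" "x \<in> A" for A x
    unfolding f'_def f_def o_def g_hull[OF XW[OF that(1)] that(2)] cis_mult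
    by (simp add: avg[OF that(1), symmetric] distrib_left)
  obtain y0 where y0: "y0 \<in> M" using delone_nonempty[OF dM] by blast
  define c where "c = a \<bullet> (star M y0, y0)"
  define \<tau> where "\<tau> x = c - a \<bullet> (0, x) + \<psi> (shift M x)" for x
  define G where "G y = avg (shift M y) 0" for y
  have f_shift: "f (shift M x) = cis (2 * pi * (c - a \<bullet> (0, x)))" for x
  proof -
    have m: "y0 - x \<in> shift M x" using y0 by simp
    have "star (shift M x) (y0 - x) = star M y0" by (rule star_shift[OF zM y0])
    then have "f (shift M x) = cis (2 * pi * (a \<bullet> (star M y0, y0 - x)))"
      unfolding f_def o_def g_hull[OF XW[OF shX] m] by simp
    moreover have "(star M y0, y0 - x) = (star M y0, y0) - (0, x)" by simp
    ultimately show ?thesis unfolding c_def by (simp only: inner_diff_right)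
  qed
  have f'_tau: "f' (shift M x) = cis (2 * pi * \<tau> x)" for x
    unfolding f'_def f_shift cis_mult \<tau>_def by (simp add: distrib_left)
  have G: "spe M M G"
    unfolding spe_def
  proof (intro exI[of _ R] conjI ballI impI)
    show "R > 0" using rho(1) by (simp add: R_def)
    fix x1 x2 assume "x1 \<in> M" "x2 \<in> M" "agree R (shift M x1) (shift M x2)"
    then show "G x1 = G x2" unfolding G_def using avg_local[OF shX shX] by simp
  qed
  have \<tau>_M: "\<tau> y = c - a \<bullet> (star M y, y) + G y" if y: "y \<in> M" for y
  proof -
    have "star (shift M y) 0 = star M y" using star_shift[OF zM y, of y] by simp
    then have "G y = a \<bullet> (star M y, 0) + \<psi> (shift M y)"
      unfolding G_def avg[OF shX, symmetric] by simp
    moreover have "a \<bullet> (star M y, y) = a \<bullet> (star M y, 0) + a \<bullet> (0, y)"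
      unfolding inner_add_right[symmetric] by simp
    ultimately show ?thesis unfolding \<tau>_def by linarith
  qed
  have \<tau>_cont: "continuous_on UNIV \<tau>"
    unfolding continuous_on_sequentially
  proof (intro allI ballI impI)
    fix x :: "nat \<Rightarrow> 'a" and l assume "(\<forall>n. x n \<in> UNIV) \<and> x \<longlonglongrightarrow> l"
    then have x: "x \<longlonglongrightarrow> l" by blast
    have "(\<lambda>n. \<psi> (shift M (x n))) \<longlonglongrightarrow> \<psi> (shift M l)"
      by (rule \<psi>_lim[OF shX shX shift_tendsto[OF x]])
    then have "(\<lambda>n. \<tau> (x n)) \<longlonglongrightarrow> \<tau> l" unfolding \<tau>_def by (intro tendsto_intros x)
    then show "(\<tau> \<circ> x) \<longlonglongrightarrow> \<tau> l" by (simp add: o_def)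
  qed
  have top: "topspace (hull_topology M) = X"
    using window_hull_rel(1) XW
    by (auto simp: hull_topology_def delone_topology_def X_def Metric_space.topspace_mtopology[OF Metric_space_delone])
  have f_cont: "continuous_map (hull_topology M) euclidean f"
  proof -
    have "continuous_map (hull_topology M) (torus_topology \<Gamma>) (pi_max \<Gamma> W)"
      unfolding hull_topology_def
      by (rule continuous_map_from_subtopology_mono[OF conjunct1[OF conjunct2[OF pi_max_props]]
            translation_hull_window_hull[OF M]])
    then have "continuous_map (hull_topology M) circle f" unfolding f_def using g_cont by (rule continuous_map_compose)
    then show ?thesis by (simp add: continuous_map_in_subtopology)
  qed
  have \<psi>_cont: "continuous_map (hull_topology M) euclidean \<psi>"
    unfolding hull_topology_def X_def[symmetric]
  proof (rule delone_continuous_mapI)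
    fix U A B assume U: "openin euclidean U" and A: "A \<in> X" "\<psi> A \<in> U"
      and B: "\<forall>k::nat. B k \<in> X" and conv: "(\<lambda>k. delone_dist A (B k)) \<longlonglongrightarrow> 0"
    have "(\<lambda>k. \<psi> (B k)) \<longlonglongrightarrow> \<psi> A" by (rule \<psi>_lim[OF A(1) _ conv]) (use B in blast)
    then have "\<forall>\<^sub>F k in sequentially. \<psi> (B k) \<in> U"
      using topological_tendstoD U A(2) by (metis open_openin)
    then show "\<exists>k. \<psi> (B k) \<in> U" using eventually_happens'[OF sequentially_bot] by blast
  qed (use window_hull_rel(1) XW in auto)
  have norm_f: "norm (f A) = 1" if A: "A \<in> X" for A
  proof -
    obtain x where "x \<in> A" using near0[OF A] by blast
    then show ?thesis unfolding f_def o_def using g_hull[OF XW[OF A]] by simp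
  qed
  have hom: "homotopic_with (\<lambda>_. True) (hull_topology M) circle f f'"
  proof -
    define h where "h p = f (snd p) * cis (2 * pi * (fst p * \<psi> (snd p)))" for p
    let ?T = "prod_topology (top_of_set {0..1::real}) (hull_topology M)"
    have "continuous_map ?T euclidean (\<lambda>p. (f (snd p), (fst p, \<psi> (snd p))))"
      unfolding prod_topology_euclidean[symmetric]
    proof (intro continuous_map_pairedI)
      show "continuous_map ?T euclidean (\<lambda>p. f (snd p))"
        using continuous_map_compose[OF continuous_map_snd f_cont] by (simp add: o_def)
      show "continuous_map ?T euclidean (\<lambda>p. \<psi> (snd p))"
        using continuous_map_compose[OF continuous_map_snd \<psi>_cont] by (simp add: o_def)
      show "continuous_map ?T euclidean fst"
        using continuous_map_fst[of "top_of_set {0..1}" "hull_topology M"]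
        unfolding continuous_map_in_subtopology by blast
    qed
    moreover have "continuous_map euclidean euclidean
        (\<lambda>q :: complex \<times> real \<times> real. fst q * cis (2 * pi * (fst (snd q) * snd (snd q))))"
      unfolding continuous_map_iff_continuous2 by (intro continuous_intros)
    ultimately have "continuous_map ?T euclidean
        ((\<lambda>q :: complex \<times> real \<times> real. fst q * cis (2 * pi * (fst (snd q) * snd (snd q)))) \<circ>
         (\<lambda>p. (f (snd p), (fst p, \<psi> (snd p)))))" by (rule continuous_map_compose)
    moreover have "(\<lambda>q :: complex \<times> real \<times> real. fst q * cis (2 * pi * (fst (snd q) * snd (snd q)))) \<circ>
         (\<lambda>p. (f (snd p), (fst p, \<psi> (snd p)))) = h" by (rule ext) (simp add: h_def)
    ultimately have "continuous_map ?T euclidean h" by simp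
    moreover have "h \<in> topspace ?T \<rightarrow> sphere 0 1"
      using norm_f by (auto simp: h_def top norm_mult)
    ultimately have "continuous_map ?T circle h" by (simp add: continuous_map_in_subtopology image_subset_iff_funcset)
    moreover have "h (0, A) = f A" "h (1, A) = f' A" for A by (simp_all add: h_def f'_def)
    ultimately show ?thesis unfolding homotopic_with_def by blast
  qed
  have spe': "spe M UNIV (\<lambda>x. f' (shift M x))"
    unfolding spe_def
  proof (intro exI[of _ R] conjI ballI impI)
    show "R > 0" using rho(1) by (simp add: R_def)
    fix x1 x2 assume ag: "agree R (shift M x1) (shift M x2)"
    obtain x0 where x0: "x0 \<in> shift M x1" "norm x0 < R" using near0[OF shX] by blast
    then have x0': "x0 \<in> shift M x2" using agreeD[OF ag] by blast
    show "f' (shift M x1) = f' (shift M x2)"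
      unfolding f'_avg[OF shX x0(1)] f'_avg[OF shX x0'] using avg_local[OF shX shX ag x0(1) x0'] by simp
  qed
  have "bruschlinsky_lift M (g \<circ> pi_max \<Gamma> W) \<tau>"
    unfolding bruschlinsky_lift_def f_def[symmetric]
  proof (intro conjI \<tau>_cont exI[of _ f'] hom spe' allI)
    show "f' (shift M x) = exp (2 * of_real pi * \<i> * of_real (\<tau> x))" for x
      unfolding f'_tau cis_conv_exp by (simp add: mult_ac)
  qed
  then show ?thesis using g_cont G \<tau>_M by blast
qed

end

section \<open>Walls and cells\<close>

definition side :: "'h::euclidean_space \<times> real \<Rightarrow> 'h \<Rightarrow> real" where
  "side P h = sgn (fst P \<bullet> h - snd P)"

lemma side_zero_iff: "side P h = 0 \<longleftrightarrow> fst P \<bullet> h = snd P"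
  by (simp add: side_def sgn_real_def)

lemma convex_side: "\<sigma> \<noteq> 0 \<Longrightarrow> convex {h. side P h = \<sigma>}"
proof -
  assume "\<sigma> \<noteq> 0"
  consider "\<sigma> = 1" | "\<sigma> = -1" | "\<sigma> \<noteq> 1" "\<sigma> \<noteq> -1" by blast
  then show ?thesis
  proof cases
    case 1
    then have "{h. side P h = \<sigma>} = {h. fst P \<bullet> h > snd P}"
      by (auto simp: side_def sgn_if split: if_splits)
    then show ?thesis by (simp add: convex_halfspace_gt)
  next
    case 2
    then have "{h. side P h = \<sigma>} = {h. fst P \<bullet> h < snd P}"
      by (auto simp: side_def sgn_if split: if_splits)
    then show ?thesis by (simp add: convex_halfspace_lt)
  next
    case 3
    then have "{h. side P h = \<sigma>} = {}"
      using \<open>\<sigma> \<noteq> 0\<close> by (auto simp: side_def sgn_if split: if_splits)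
    then show ?thesis by simp
  qed
qed

lemma open_side: "\<sigma> \<noteq> 0 \<Longrightarrow> open {h. side P h = \<sigma>}"
proof -
  assume "\<sigma> \<noteq> 0"
  consider "\<sigma> = 1" | "\<sigma> = -1" | "\<sigma> \<noteq> 1" "\<sigma> \<noteq> -1" by blast
  then show ?thesis
  proof cases
    case 1
    then have "{h. side P h = \<sigma>} = {h. fst P \<bullet> h > snd P}"
      by (auto simp: side_def sgn_if split: if_splits)
    then show ?thesis by (simp add: open_halfspace_gt)
  next
    case 2
    then have "{h. side P h = \<sigma>} = {h. fst P \<bullet> h < snd P}"
      by (auto simp: side_def sgn_if split: if_splits)
    then show ?thesis by (simp add: open_halfspace_lt)
  next
    case 3
    then have "{h. side P h = \<sigma>} = {}"
      using \<open>\<sigma> \<noteq> 0\<close> by (auto simp: side_def sgn_if split: if_splits)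
    then show ?thesis by simp
  qed
qed

lemma ball_avoids_hyperplanes:
  fixes S :: "('h::euclidean_space \<times> real) set"
  assumes "countable S" "\<forall>i\<in>S. fst i \<noteq> 0" "\<delta> > 0"
  obtains k where "norm (k - h) < \<delta>" "\<forall>i\<in>S. fst i \<bullet> k \<noteq> snd i"
proof -
  define \<N> where "\<N> = (\<lambda>i. {k. fst i \<bullet> k = snd i}) ` S"
  have "negligible (\<Union>\<N>)"
  proof (rule negligible_countable_Union)
    show "countable \<N>" unfolding \<N>_def by (intro countable_image assms(1))
    fix N assume "N \<in> \<N>"
    then obtain i where "i \<in> S" "N = {k. fst i \<bullet> k = snd i}" unfolding \<N>_def by blast
    then show "negligible N" using assms(2) negligible_hyperplane by blast
  qed
  then have "\<not> ball h \<delta> \<subseteq> \<Union>\<N>"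
    using assms(3) open_not_negligible[of "ball h \<delta>"] negligible_subset[of "\<Union>\<N>" "ball h \<delta>"]
    by (metis ball_eq_empty linorder_not_le open_ball)
  then obtain k where k: "k \<in> ball h \<delta>" "k \<notin> \<Union>\<N>" by blast
  have "norm (k - h) < \<delta>" using k(1) by (simp add: dist_norm norm_minus_commute)
  moreover have "\<forall>i\<in>S. fst i \<bullet> k \<noteq> snd i" using k(2) unfolding \<N>_def by blast
  ultimately show ?thesis by (rule that)
qed

text \<open>
  What the proof of rigidity uses of a polyhedral model set: \<open>s\<close> is the star map, the pairs \<open>(a, b)\<close> in
  \<open>HP\<close> stand for hyperplanes \<open>{h. a \<bullet> h = b}\<close>, called walls, that contain the boundary of the window,
  and \<open>C0\<close> bounds the diameter of the window.
\<close>

locale star_model =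
  fixes \<Gamma> :: "('h::euclidean_space \<times> 'a::euclidean_space) set"
    and W :: "'h set" and M :: "'a set" and s :: "'a \<Rightarrow> 'h"
    and HP :: "('h \<times> real) set" and C0 :: real
  assumes zero: "0 \<in> \<Gamma>"
    and diff: "\<And>x y. x \<in> \<Gamma> \<Longrightarrow> y \<in> \<Gamma> \<Longrightarrow> x - y \<in> \<Gamma>"
    and fin: "\<And>C L. finite {\<gamma>\<in>\<Gamma>. norm (fst \<gamma>) \<le> C \<and> norm (snd \<gamma>) \<le> L}"
    and dense: "closure (fst ` \<Gamma>) = UNIV"
    and sW: "\<And>x. x \<in> M \<Longrightarrow> s x \<in> W"
    and s_diff: "\<And>x y. x \<in> M \<Longrightarrow> y \<in> M \<Longrightarrow> (s y - s x, y - x) \<in> \<Gamma>"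
    and s_int: "\<And>x \<gamma>. x \<in> M \<Longrightarrow> \<gamma> \<in> \<Gamma> \<Longrightarrow> s x + fst \<gamma> \<in> interior W \<Longrightarrow>
                  x + snd \<gamma> \<in> M \<and> s (x + snd \<gamma>) = s x + fst \<gamma>"
    and M_ne: "M \<noteq> {}"
    and W_diam: "\<And>h h'. h \<in> W \<Longrightarrow> h' \<in> W \<Longrightarrow> norm (h - h') \<le> C0"
    and W_int: "interior W \<noteq> {}"
    and HP_fin: "finite HP"
    and HP_nz: "\<And>P. P \<in> HP \<Longrightarrow> fst P \<noteq> 0"
    and HP_front: "\<And>h. h \<in> frontier W \<Longrightarrow> \<exists>P\<in>HP. fst P \<bullet> h = snd P"
begin

lemma minus: "x \<in> \<Gamma> \<Longrightarrow> - x \<in> \<Gamma>"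
  using diff[OF zero, of x] by simp

lemma add: "x \<in> \<Gamma> \<Longrightarrow> y \<in> \<Gamma> \<Longrightarrow> x + y \<in> \<Gamma>"
  using diff[of x "- y"] minus[of y] by simp

lemma C0_nonneg: "C0 \<ge> 0"
proof -
  obtain h where "h \<in> W" using W_int interior_subset by blast
  then show ?thesis using W_diam[of h h] by simp
qed

definition U :: "real \<Rightarrow> real \<Rightarrow> ('h \<times> 'a) set" where
  "U C L = {\<gamma>\<in>\<Gamma>. norm (fst \<gamma>) \<le> C \<and> norm (snd \<gamma>) \<le> L}"

lemma U_finite: "finite (U C L)" unfolding U_def by (rule fin)

lemma countable_Gamma: "countable \<Gamma>"
proof -
  have "\<Gamma> = (\<Union>n::nat. U (real n) (real n))"
  proof
    show "\<Gamma> \<subseteq> (\<Union>n::nat. U (real n) (real n))"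
    proof
      fix \<gamma> assume g: "\<gamma> \<in> \<Gamma>"
      obtain n where n: "max (norm (fst \<gamma>)) (norm (snd \<gamma>)) \<le> real n"
        using real_arch_simple by blast
      show "\<gamma> \<in> (\<Union>n::nat. U (real n) (real n))"
        using g n unfolding U_def by auto
    qed
  qed (auto simp: U_def)
  moreover have "countable (\<Union>n::nat. U (real n) (real n))"
    by (intro countable_UN) (auto intro: U_finite countable_finite)
  ultimately show ?thesis by simp
qed

text \<open>
  The translates of the walls by the finite set \<open>U C L\<close> cut the internal space into cells: \<open>same C L\<close> means
  to lie in the same cell, and \<open>clear C L h\<close> that \<open>h\<close> is on none of these walls. If
  \<open>clear C0 L (s x)\<close>, then the cell of \<open>s x\<close> determines the pattern of \<open>M\<close> of radius \<open>L\<close> around \<open>x\<close>.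
\<close>

definition generic :: "'h \<Rightarrow> bool" where
  "generic h \<longleftrightarrow> (\<forall>\<gamma>\<in>\<Gamma>. \<forall>P\<in>HP. side P (h + fst \<gamma>) \<noteq> 0)"

definition clear :: "real \<Rightarrow> real \<Rightarrow> 'h \<Rightarrow> bool" where
  "clear C L h \<longleftrightarrow> (\<forall>\<gamma>\<in>U C L. \<forall>P\<in>HP. side P (h + fst \<gamma>) \<noteq> 0)"

definition same :: "real \<Rightarrow> real \<Rightarrow> 'h \<Rightarrow> 'h \<Rightarrow> bool" where
  "same C L h k \<longleftrightarrow> (\<forall>\<gamma>\<in>U C L. \<forall>P\<in>HP. side P (h + fst \<gamma>) = side P (k + fst \<gamma>))"

lemma generic_clear: "generic h \<Longrightarrow> clear C L h"
  unfolding generic_def clear_def U_def by blast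

lemma generic_shift: "generic h \<Longrightarrow> \<gamma> \<in> \<Gamma> \<Longrightarrow> generic (h + fst \<gamma>)"
  unfolding generic_def
proof (intro ballI)
  fix \<gamma>' P assume h: "\<forall>\<gamma>\<in>\<Gamma>. \<forall>P\<in>HP. side P (h + fst \<gamma>) \<noteq> 0" and "\<gamma> \<in> \<Gamma>" "\<gamma>' \<in> \<Gamma>" "P \<in> HP"
  then have "side P (h + fst (\<gamma> + \<gamma>')) \<noteq> 0" using add by blast
  then show "side P (h + fst \<gamma> + fst \<gamma>') \<noteq> 0" by (simp add: add.assoc)
qed

lemma same_sym: "same C L h k \<Longrightarrow> same C L k h"
  unfolding same_def by simp

lemma same_trans: "same C L h k \<Longrightarrow> same C L k l \<Longrightarrow> same C L h l"
  unfolding same_def by simp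

lemma clear_same: "clear C L h \<Longrightarrow> same C L h k \<Longrightarrow> clear C L k"
  unfolding same_def clear_def by metis

lemma cell_eq:
  "{k. same C L h k} = (\<Inter>\<gamma>\<in>U C L. \<Inter>P\<in>HP. (\<lambda>k. k + fst \<gamma>) -` {k. side P k = side P (h + fst \<gamma>)})"
  unfolding same_def by fastforce

lemma open_cell: "clear C L h \<Longrightarrow> open {k. same C L h k}"
  unfolding cell_eq
  by (intro open_INT U_finite HP_fin ballI open_vimage open_side continuous_intros)
     (auto simp: clear_def)

lemma convex_cell: "clear C L h \<Longrightarrow> convex {k. same C L h k}"
proof -
  assume c: "clear C L h"
  have "convex ((\<lambda>k. k + v) -` S)" if "convex S" for v and S :: "'h set"
  proof -
    have "(\<lambda>k. k + v) -` S = (\<lambda>k. - v + k) ` S"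
      by (auto simp: image_iff) (metis add.commute diff_add_cancel uminus_add_conv_diff)
    then show ?thesis using that convex_translation by metis
  qed
  moreover have "convex {k. side P k = side P (h + fst \<gamma>)}" if "\<gamma> \<in> U C L" "P \<in> HP" for \<gamma> P
    using c that by (intro convex_side) (simp add: clear_def)
  ultimately show ?thesis
    unfolding cell_eq by (intro convex_INT) blast
qed

lemma cell_ball:
  assumes "clear C L h"
  obtains \<delta> where "\<delta> > 0" "\<And>k. norm (k - h) < \<delta> \<Longrightarrow> same C L h k"
proof -
  have "h \<in> {k. same C L h k}" by (simp add: same_def)
  then obtain \<delta> where "\<delta> > 0" "ball h \<delta> \<subseteq> {k. same C L h k}"
    using open_cell[OF assms] openE by blast
  moreover have "same C L h k" if "norm (k - h) < \<delta>" for k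
  proof -
    have "k \<in> ball h \<delta>" using that by (simp add: dist_norm norm_minus_commute)
    then show ?thesis using \<open>ball h \<delta> \<subseteq> _\<close> by blast
  qed
  ultimately show ?thesis using that by blast
qed

text \<open>
  The segment from \<open>h\<close> to \<open>k\<close> meets no wall, so it cannot leave the window.
\<close>

lemma side_eq_interior:
  assumes "\<And>P. P \<in> HP \<Longrightarrow> side P h = side P k" "\<And>P. P \<in> HP \<Longrightarrow> side P h \<noteq> 0" "h \<in> W"
  shows "k \<in> interior W"
proof -
  have nf: "z \<notin> frontier W" if "z \<in> closed_segment h k" for z
  proof
    assume "z \<in> frontier W"
    then obtain P where P: "P \<in> HP" "fst P \<bullet> z = snd P" using HP_front by blast
    have "closed_segment h k \<subseteq> {z. side P z = side P h}"
      using assms(1,2)[OF P(1)] by (intro closed_segment_subset convex_side) auto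
    then have "side P z = side P h" using that by blast
    then show False using P assms(2)[OF P(1)] by (simp add: side_def)
  qed
  have "closed_segment h k - W = {}"
    using connected_Int_frontier[of "closed_segment h k" W] nf assms(3) by auto
  then have "k \<in> W" by auto
  moreover have "k \<notin> frontier W" using nf by auto
  ultimately show ?thesis by (simp add: frontier_def) (use closure_subset in blast)
qed

lemma U_zero: "C \<ge> 0 \<Longrightarrow> L \<ge> 0 \<Longrightarrow> 0 \<in> U C L"
  using zero unfolding U_def by simp

lemma same_interior:
  assumes "same C L h k" "clear C L h" "h \<in> W" "C \<ge> 0" "L \<ge> 0"
  shows "k \<in> interior W"
  using assms U_zero[OF assms(4,5)] unfolding same_def clear_def
  by (intro side_eq_interior[of h k]) force+

lemma point_transfer:
  assumes "x \<in> M" "x' \<in> M" "x + w \<in> M"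
    and "\<And>\<gamma> P. \<gamma> \<in> \<Gamma> \<Longrightarrow> norm (fst \<gamma>) \<le> C0 \<Longrightarrow> snd \<gamma> = w \<Longrightarrow> P \<in> HP \<Longrightarrow>
      side P (s x + fst \<gamma>) = side P (s x' + fst \<gamma>) \<and> side P (s x + fst \<gamma>) \<noteq> 0"
  shows "x' + w \<in> M"
proof -
  define \<gamma> where "\<gamma> = (s (x + w) - s x, w)"
  have g: "\<gamma> \<in> \<Gamma>" using s_diff[OF assms(1,3)] by (simp add: \<gamma>_def)
  have n: "norm (fst \<gamma>) \<le> C0" using W_diam sW assms by (simp add: \<gamma>_def)
  have "s x + fst \<gamma> \<in> W" using sW[OF assms(3)] by (simp add: \<gamma>_def)
  moreover have "snd \<gamma> = w" by (simp add: \<gamma>_def)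
  ultimately have "s x' + fst \<gamma> \<in> interior W"
    using side_eq_interior[of "s x + fst \<gamma>" "s x' + fst \<gamma>"] assms(4)[OF g n] by blast
  then show ?thesis using s_int[OF assms(2) g] by (simp add: \<gamma>_def)
qed

text \<open>
  For \<open>x\<close> and \<open>x + w\<close> in \<open>M\<close>, the lattice vector over \<open>w\<close> leads from \<open>s x\<close> into the window. By the assumptions
  it leads from \<open>s x'\<close> to a point on the same sides of all walls, which lies in the window too.
\<close>

lemma same_agree:
  assumes "x \<in> M" "x' \<in> M" "same C0 L (s x) (s x')" "clear C0 L (s x)"
  shows "agree L (shift M x) (shift M x')"
proof -
  have cl: "clear C0 L (s x')" using clear_same assms by blast
  have transfer: "y' + w \<in> M"
    if "y + w \<in> M" "y \<in> M" "y' \<in> M" "same C0 L (s y) (s y')" "clear C0 L (s y)" "norm w < L" for y y' w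
  proof (rule point_transfer[of y y' w])
    fix \<gamma> P assume g: "\<gamma> \<in> \<Gamma>" "norm (fst \<gamma>) \<le> C0" "snd \<gamma> = w" "P \<in> HP"
    then have "\<gamma> \<in> U C0 L" using that(6) by (simp add: U_def)
    then show "side P (s y + fst \<gamma>) = side P (s y' + fst \<gamma>) \<and> side P (s y + fst \<gamma>) \<noteq> 0"
      using that(4,5) g(4) unfolding same_def clear_def by blast
  qed (use that in auto)
  have "w + x \<in> M \<longleftrightarrow> w + x' \<in> M" if "norm w < L" for w
    using transfer[of x w x'] transfer[of x' w x] that assms cl same_sym[OF assms(3)]
    by (metis add.commute)
  then show ?thesis unfolding agree_def by auto
qed

lemma star_dense:
  assumes "h \<in> interior W" "\<delta> > 0"
  obtains x where "x \<in> M" "norm (s x - h) < \<delta>" "s x \<in> interior W"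
proof -
  obtain x0 where x0: "x0 \<in> M" using M_ne by blast
  obtain e where e: "e > 0" "ball h e \<subseteq> interior W"
    using assms(1) open_interior openE by blast
  have "h - s x0 \<in> closure (fst ` \<Gamma>)" using dense by simp
  then obtain v where "v \<in> fst ` \<Gamma>" "dist v (h - s x0) < min \<delta> e"
    using closure_approachable assms(2) e(1) by (metis min_less_iff_conj)
  then obtain \<gamma> where g: "\<gamma> \<in> \<Gamma>" "norm (fst \<gamma> - (h - s x0)) < min \<delta> e"
    by (auto simp: dist_norm)
  have n: "norm (s x0 + fst \<gamma> - h) < min \<delta> e" using g(2) by (simp add: algebra_simps)
  then have i: "s x0 + fst \<gamma> \<in> interior W"
    using e(2) by (auto simp: dist_norm norm_minus_commute)
  show ?thesis
    using that[of "x0 + snd \<gamma>"] s_int[OF x0 g(1) i] n i by auto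
qed

end

section \<open>Lattice points along a wall\<close>

text \<open>
  The subspace \<open>D\<close> consists of the physical vectors in the span of the lattice vectors \<open>\<sigma>\<close> with
  \<open>a \<bullet> fst \<sigma> = 0\<close>. Lattice vectors with bounded internal part that join finitely many parallel walls with
  normal \<open>a\<close> stay close to \<open>D\<close>, and those along one wall come close to each point of \<open>D\<close>.
\<close>

lemma wall_subspace:
  fixes \<Gamma> :: "('h::euclidean_space \<times> 'a::euclidean_space) set" and a :: 'h
  assumes zero: "0 \<in> \<Gamma>" and diff: "\<And>x y. x \<in> \<Gamma> \<Longrightarrow> y \<in> \<Gamma> \<Longrightarrow> x - y \<in> \<Gamma>"
    and Bs: "finite Bs"
  shows "\<exists>D \<kappa> r. subspace D \<and> \<kappa> \<ge> 0 \<and> r \<ge> 0 \<and>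
     (\<forall>\<gamma>\<in>\<Gamma>. a \<bullet> fst \<gamma> \<in> Bs \<longrightarrow> norm (fst \<gamma>) \<le> C \<longrightarrow> (\<exists>d\<in>D. norm (snd \<gamma> - d) \<le> r)) \<and>
     (\<forall>d\<in>D. \<exists>\<sigma>\<in>\<Gamma>. a \<bullet> fst \<sigma> = 0 \<and> norm (fst \<sigma>) \<le> \<kappa> \<and> norm (snd \<sigma> - d) \<le> \<kappa>)"
proof -
  define N where "N = {\<gamma>\<in>\<Gamma>. a \<bullet> fst \<gamma> = 0}"
  have N: "0 \<in> N" "\<And>x y. x \<in> N \<Longrightarrow> y \<in> N \<Longrightarrow> x - y \<in> N"
    using zero diff by (auto simp: N_def inner_diff_right)
  define S where "S = span N"
  define D :: "'a set" where "D = {e. (0, e) \<in> S}"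
  have subS: "subspace S" by (simp add: S_def)
  have subD: "subspace D"
  proof (rule subspaceI)
    show "0 \<in> D" using subspace_0[OF subS] by (simp add: D_def zero_prod_def)
    show "x + y \<in> D" if "x \<in> D" "y \<in> D" for x y
      using subspace_add[OF subS, of "(0, x)" "(0, y)"] that by (simp add: D_def)
    show "c *\<^sub>R x \<in> D" if "x \<in> D" for c x
      using subspace_scale[OF subS, of "(0, x)" c] that by (simp add: D_def)
  qed
  obtain \<kappa> where k: "\<kappa> \<ge> 0" "\<And>v. v \<in> span N \<Longrightarrow> \<exists>\<sigma>\<in>N. norm (v - \<sigma>) \<le> \<kappa>"
    using subgroup_span_cobounded[OF N] by blast
  have near: "\<exists>\<sigma>\<in>\<Gamma>. a \<bullet> fst \<sigma> = 0 \<and> norm (fst \<sigma>) \<le> \<kappa> \<and> norm (snd \<sigma> - d) \<le> \<kappa>" if d: "d \<in> D" for d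
  proof -
    obtain \<sigma> where s: "\<sigma> \<in> N" "norm ((0, d) - \<sigma>) \<le> \<kappa>" using k(2) d unfolding D_def S_def by blast
    have "norm (fst ((0, d) - \<sigma>)) \<le> \<kappa>" "norm (snd ((0, d) - \<sigma>)) \<le> \<kappa>"
      using s(2) norm_fst_le norm_snd_le by (metis order_trans prod.collapse)+
    then show ?thesis using s(1) by (auto simp: N_def norm_minus_commute)
  qed
  have "linear (fst :: 'h \<times> 'a \<Rightarrow> 'h)" by (simp add: linear_fst)
  then obtain g where g: "g ` UNIV \<subseteq> S" "linear g" "\<forall>v\<in>fst ` S. fst (g v) = v"
    using linear_exists_right_inverse_on[OF _ subS] by blast
  obtain K where K: "K > 0" "\<And>x. norm (g x) \<le> norm x * K"
    using g(2) linear_linear bounded_linear.pos_bounded by blast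
  have inS: "\<exists>d\<in>D. norm (snd \<gamma> - d) \<le> C * K" if "\<gamma> \<in> S" "norm (fst \<gamma>) \<le> C" for \<gamma> C
  proof -
    have gS: "\<gamma> - g (fst \<gamma>) \<in> S" using that(1) g(1) subspace_diff[OF subS] by blast
    have "fst (\<gamma> - g (fst \<gamma>)) = 0" using g(3) that(1) by simp
    then have "snd (\<gamma> - g (fst \<gamma>)) \<in> D" using gS unfolding D_def by (metis mem_Collect_eq prod.collapse)
    moreover have "norm (snd \<gamma> - snd (\<gamma> - g (fst \<gamma>))) \<le> C * K"
    proof -
      have "norm (snd (g (fst \<gamma>))) \<le> norm (g (fst \<gamma>))" by (metis norm_snd_le prod.collapse)
      also have "\<dots> \<le> norm (fst \<gamma>) * K" by (rule K(2))
      also have "\<dots> \<le> C * K" using that(2) K(1) by (simp add: mult_right_mono)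
      finally show ?thesis by simp
    qed
    ultimately show ?thesis by blast
  qed
  define G where "G c = (SOME \<gamma>. \<gamma> \<in> \<Gamma> \<and> a \<bullet> fst \<gamma> = c)" for c
  define rc where "rc c = (\<bar>C\<bar> + norm (fst (G c))) * K + norm (snd (G c))" for c
  have rc0: "rc c \<ge> 0" for c unfolding rc_def using K(1) by simp
  define r where "r = (\<Sum>c\<in>Bs. rc c)"
  have "\<exists>d\<in>D. norm (snd \<gamma> - d) \<le> r" if h: "\<gamma> \<in> \<Gamma>" "a \<bullet> fst \<gamma> \<in> Bs" "norm (fst \<gamma>) \<le> C" for \<gamma>
  proof -
    define c where "c = a \<bullet> fst \<gamma>"
    have Gc: "G c \<in> \<Gamma>" "a \<bullet> fst (G c) = c"
      using someI_ex[of "\<lambda>\<gamma>. \<gamma> \<in> \<Gamma> \<and> a \<bullet> fst \<gamma> = c"] h(1) unfolding G_def c_def by blast+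
    have "\<gamma> - G c \<in> N" using h(1) Gc diff by (simp add: N_def inner_diff_right c_def)
    then have inSc: "\<gamma> - G c \<in> S" unfolding S_def by (rule span_base)
    have "norm (fst (\<gamma> - G c)) \<le> \<bar>C\<bar> + norm (fst (G c))"
      using norm_triangle_ineq4[of "fst \<gamma>" "fst (G c)"] h(3) by simp
    then obtain d where d: "d \<in> D" "norm (snd (\<gamma> - G c) - d) \<le> (\<bar>C\<bar> + norm (fst (G c))) * K"
      using inS[OF inSc] by blast
    have "norm (snd \<gamma> - d) \<le> norm (snd (\<gamma> - G c) - d) + norm (snd (G c))"
      using norm_triangle_ineq[of "snd (\<gamma> - G c) - d" "snd (G c)"] by (simp add: algebra_simps)
    also have "\<dots> \<le> rc c" using d(2) by (simp add: rc_def)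
    also have "\<dots> \<le> r"
      unfolding r_def using member_le_sum[of c Bs rc] h(2) Bs rc0 by (simp add: c_def)
    finally show ?thesis using d(1) by blast
  qed
  moreover have "r \<ge> 0" unfolding r_def using rc0 by (simp add: sum_nonneg)
  ultimately show ?thesis using subD k(1) near by blast
qed

section \<open>Pattern equivariant functions near generic points\<close>

text \<open>
  The function \<open>F\<close> is uniformly pattern equivariant, and patterns of radius \<open>R\<close> determine its
  increments over steps of length at most \<open>R0\<close>. The assumption \<open>patches\<close> says that each patch of \<open>M\<close>
  occurs at all points whose stars lie in a certain ball; it serves for the points whose star
  lies on a wall.
\<close>

locale rigid_function = star_model \<Gamma> W M s HP C0
  for \<Gamma> :: "('h::euclidean_space \<times> 'a::euclidean_space) set"
    and W :: "'h set" and M :: "'a set" and s :: "'a \<Rightarrow> 'h"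
    and HP :: "('h \<times> real) set" and C0 :: real +
  fixes F :: "'a \<Rightarrow> real" and R0 R :: real
  assumes unif: "\<And>e. e > 0 \<Longrightarrow> \<exists>L. \<forall>x\<in>M. \<forall>y\<in>M. agree L (shift M x) (shift M y) \<longrightarrow> \<bar>F x - F y\<bar> < e"
    and R_pos: "R > 0"
    and R0_dense: "\<And>z. M \<inter> ball z (R0 / 3) \<noteq> {}"
    and step: "\<And>x1 y1 x2 y2. x1 \<in> M \<Longrightarrow> y1 \<in> M \<Longrightarrow> x2 \<in> M \<Longrightarrow> y2 \<in> M \<Longrightarrow>
      norm (y1 - x1) \<le> R0 \<Longrightarrow> y1 - x1 = y2 - x2 \<Longrightarrow> agree R (shift M x1) (shift M x2) \<Longrightarrow>
      F y1 - F x1 = F y2 - F x2"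
    and patches: "\<And>x L e. x \<in> M \<Longrightarrow> e > 0 \<Longrightarrow> \<exists>h \<delta>. h \<in> interior W \<and> \<delta> > 0 \<and>
      (\<forall>y\<in>M. norm (s y - h) < \<delta> \<longrightarrow> agree L (shift M x) (shift M y) \<and> norm (s y - s x) < e)"
begin

lemma R0_pos: "R0 > 0"
proof -
  obtain z where "z \<in> ball (0::'a) (R0 / 3)" using R0_dense by blast
  then have "norm z < R0 / 3" by simp
  then show ?thesis using norm_ge_zero[of z] by linarith
qed

lemma unif_nonneg:
  assumes "e > 0"
  obtains L where "L \<ge> 0" "\<And>x y. x \<in> M \<Longrightarrow> y \<in> M \<Longrightarrow> agree L (shift M x) (shift M y) \<Longrightarrow> \<bar>F x - F y\<bar> < e"
proof -
  obtain L where L: "\<forall>x\<in>M. \<forall>y\<in>M. agree L (shift M x) (shift M y) \<longrightarrow> \<bar>F x - F y\<bar> < e"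
    using unif[OF assms] by blast
  have "\<bar>F x - F y\<bar> < e" if "x \<in> M" "y \<in> M" "agree (max L 0) (shift M x) (shift M y)" for x y
    using L that agree_mono[OF that(3), of L] by simp
  then show ?thesis using that[of "max L 0"] by simp
qed

lemma phi_exists:
  assumes "generic h" "h \<in> interior W"
  shows "\<exists>v. \<forall>e>0. \<exists>\<delta>>0. \<forall>x\<in>M. norm (s x - h) < \<delta> \<longrightarrow> \<bar>F x - v\<bar> < e"
proof -
  have cauchy: "\<exists>\<delta>>0. \<forall>x\<in>M. \<forall>y\<in>M. norm (s x - h) < \<delta> \<longrightarrow> norm (s y - h) < \<delta> \<longrightarrow> \<bar>F x - F y\<bar> < e"
    if "e > 0" for e
  proof -
    obtain L where L: "L \<ge> 0"
      "\<And>x y. x \<in> M \<Longrightarrow> y \<in> M \<Longrightarrow> agree L (shift M x) (shift M y) \<Longrightarrow> \<bar>F x - F y\<bar> < e"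
      using unif_nonneg[OF \<open>e > 0\<close>] by blast
    obtain \<delta> where d: "\<delta> > 0" "\<And>k. norm (k - h) < \<delta> \<Longrightarrow> same C0 L h k"
      using cell_ball[OF generic_clear[OF assms(1)]] by blast
    have "\<bar>F x - F y\<bar> < e" if "x \<in> M" "y \<in> M" "norm (s x - h) < \<delta>" "norm (s y - h) < \<delta>" for x y
    proof -
      have "same C0 L (s x) (s y)"
        using d(2)[OF that(3)] d(2)[OF that(4)] same_sym same_trans by blast
      moreover have "clear C0 L (s x)"
        using d(2)[OF that(3)] generic_clear[OF assms(1)] clear_same by blast
      ultimately show ?thesis using L(2) same_agree that by blast
    qed
    then show ?thesis using d(1) by blast
  qed
  define X where "X n = (SOME x. x \<in> M \<and> norm (s x - h) < 1 / real (Suc n))" for n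
  have X: "X n \<in> M" "norm (s (X n) - h) < 1 / real (Suc n)" for n
  proof -
    have "\<exists>x. x \<in> M \<and> norm (s x - h) < 1 / real (Suc n)"
      using star_dense[OF assms(2), of "1 / real (Suc n)"]
      by (metis of_nat_0_less_iff zero_less_Suc zero_less_divide_1_iff)
    from someI_ex[OF this] show "X n \<in> M" "norm (s (X n) - h) < 1 / real (Suc n)"
      unfolding X_def by auto
  qed
  have small: "\<exists>N. \<forall>n\<ge>N. norm (s (X n) - h) < \<delta>" if d: "\<delta> > 0" for \<delta>
  proof -
    obtain N where N: "1 / real (Suc N) < \<delta>" using nat_approx_posE[OF d] by blast
    have "norm (s (X n) - h) < \<delta>" if "n \<ge> N" for n
    proof -
      have "1 / real (Suc n) \<le> 1 / real (Suc N)" using that by (intro divide_left_mono) auto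
      then show ?thesis using X(2)[of n] N by linarith
    qed
    then show ?thesis by blast
  qed
  have "Cauchy (\<lambda>n. F (X n))"
  proof (rule metric_CauchyI)
    fix e :: real assume "e > 0"
    then obtain \<delta> where d: "\<delta> > 0"
      "\<forall>x\<in>M. \<forall>y\<in>M. norm (s x - h) < \<delta> \<longrightarrow> norm (s y - h) < \<delta> \<longrightarrow> \<bar>F x - F y\<bar> < e"
      using cauchy by blast
    obtain N where "\<forall>n\<ge>N. norm (s (X n) - h) < \<delta>" using small[OF d(1)] by blast
    then show "\<exists>N. \<forall>m\<ge>N. \<forall>n\<ge>N. dist (F (X m)) (F (X n)) < e"
      using d(2) X(1) unfolding dist_real_def by blast
  qed
  then obtain v where v: "(\<lambda>n. F (X n)) \<longlonglongrightarrow> v"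
    using real_Cauchy_convergent convergent_def by blast
  have "\<exists>\<delta>>0. \<forall>x\<in>M. norm (s x - h) < \<delta> \<longrightarrow> \<bar>F x - v\<bar> < e" if "e > 0" for e
  proof -
    have e2: "e / 2 > 0" using that by simp
    obtain \<delta> where d: "\<delta> > 0"
      "\<forall>x\<in>M. \<forall>y\<in>M. norm (s x - h) < \<delta> \<longrightarrow> norm (s y - h) < \<delta> \<longrightarrow> \<bar>F x - F y\<bar> < e / 2"
      using cauchy[OF e2] by blast
    obtain N1 where N1: "\<forall>n\<ge>N1. norm (s (X n) - h) < \<delta>" using small[OF d(1)] by blast
    obtain N2 where N2: "\<forall>n\<ge>N2. \<bar>F (X n) - v\<bar> < e / 2"
      using v e2 unfolding LIMSEQ_iff real_norm_def by blast
    define n where "n = max N1 N2"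
    have "\<bar>F x - v\<bar> < e" if x: "x \<in> M" "norm (s x - h) < \<delta>" for x
    proof -
      have "\<bar>F x - F (X n)\<bar> < e / 2" using d(2) x X(1)[of n] N1 by (simp add: n_def)
      moreover have "\<bar>F (X n) - v\<bar> < e / 2" using N2 by (simp add: n_def)
      ultimately show ?thesis by linarith
    qed
    then show ?thesis using d(1) by blast
  qed
  then show ?thesis by blast
qed

text \<open>
  The limit of the values of \<open>F\<close> at points whose stars tend to \<open>h\<close>; it exists at generic points \<open>h\<close> in the
  interior of the window.
\<close>

definition phi :: "'h \<Rightarrow> real" where
  "phi h = (SOME v. \<forall>e>0. \<exists>\<delta>>0. \<forall>x\<in>M. norm (s x - h) < \<delta> \<longrightarrow> \<bar>F x - v\<bar> < e)"

lemma phi: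
  assumes "generic h" "h \<in> interior W" "e > 0"
  obtains \<delta> where "\<delta> > 0" "\<And>x. x \<in> M \<Longrightarrow> norm (s x - h) < \<delta> \<Longrightarrow> \<bar>F x - phi h\<bar> < e"
  using someI_ex[OF phi_exists[OF assms(1,2)]] assms(3) unfolding phi_def by blast

lemma phi_point:
  assumes "generic h" "h \<in> interior W" "e > 0" "d > 0"
  obtains x where "x \<in> M" "same C L h (s x)" "\<bar>F x - phi h\<bar> < e" "norm (s x - h) < d"
proof -
  obtain \<delta>1 where d1: "\<delta>1 > 0" "\<And>x. x \<in> M \<Longrightarrow> norm (s x - h) < \<delta>1 \<Longrightarrow> \<bar>F x - phi h\<bar> < e"
    using phi[OF assms(1-3)] by blast
  obtain \<delta>2 where d2: "\<delta>2 > 0" "\<And>k. norm (k - h) < \<delta>2 \<Longrightarrow> same C L h k"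
    using cell_ball[OF generic_clear[OF assms(1)]] by blast
  have "min d (min \<delta>1 \<delta>2) > 0" using d1(1) d2(1) assms(4) by simp
  then obtain x where "x \<in> M" "norm (s x - h) < min d (min \<delta>1 \<delta>2)"
    using star_dense[OF assms(2)] by blast
  then show ?thesis using that d1(2) d2(2) by simp
qed

lemma phi_same:
  assumes "e > 0"
  obtains L where "L \<ge> 0" "\<And>h k. generic h \<Longrightarrow> generic k \<Longrightarrow> h \<in> interior W \<Longrightarrow> k \<in> interior W \<Longrightarrow>
    same C0 L h k \<Longrightarrow> \<bar>phi h - phi k\<bar> < e"
proof -
  have e3: "e / 3 > 0" using assms by simp
  obtain L where L: "L \<ge> 0"
      "\<And>x y. x \<in> M \<Longrightarrow> y \<in> M \<Longrightarrow> agree L (shift M x) (shift M y) \<Longrightarrow> \<bar>F x - F y\<bar> < e / 3"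
    using unif_nonneg[OF e3] by blast
  have "\<bar>phi h - phi k\<bar> < e"
    if hk: "generic h" "generic k" "h \<in> interior W" "k \<in> interior W" "same C0 L h k" for h k
  proof -
    obtain x where x: "x \<in> M" "same C0 L h (s x)" "\<bar>F x - phi h\<bar> < e / 3"
      using phi_point[OF hk(1,3) e3 e3] by blast
    obtain y where y: "y \<in> M" "same C0 L k (s y)" "\<bar>F y - phi k\<bar> < e / 3"
      using phi_point[OF hk(2,4) e3 e3] by blast
    have "same C0 L (s x) (s y)" using x(2) y(2) hk(5) same_sym same_trans by blast
    moreover have "clear C0 L (s x)" using x(2) generic_clear[OF hk(1)] clear_same by blast
    ultimately have "\<bar>F x - F y\<bar> < e / 3" using L(2) same_agree x(1) y(1) by blast
    then show ?thesis using x(3) y(3) by linarith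
  qed
  then show ?thesis using that L(1) by blast
qed

text \<open>
  Increments of \<open>F\<close> are transported along a straight walk in steps of length at most \<open>R0\<close>: where the
  translates of \<open>M\<close> by \<open>x\<close> and \<open>x'\<close> agree near a segment, corresponding steps see the same patterns.
\<close>

lemma transport:
  assumes x: "x \<in> M" "x' \<in> M"
    and seg: "\<forall>t w. 0 \<le> t \<longrightarrow> t \<le> 1 \<longrightarrow> norm (w - t *\<^sub>R e) < R + R0 \<longrightarrow> (x + w \<in> M \<longleftrightarrow> x' + w \<in> M)"
    and y: "y \<in> M" "norm (y - x - e) < R0 / 3"
  shows "x' + (y - x) \<in> M \<and> F (x' + (y - x)) - F x' = F y - F x"
proof -
  obtain N0 :: nat where "norm e / (R0 / 3) < real N0" using reals_Archimedean2 by blast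
  define N where "N = Suc N0"
  have N: "norm e / (R0 / 3) < real N"
    using \<open>norm e / (R0 / 3) < real N0\<close> by (simp add: N_def)
  have N0: "real N > 0" by (simp add: N_def)
  define p where "p k = (real k / real N) *\<^sub>R e" for k
  have pstep: "norm (p (Suc k) - p k) < R0 / 3" for k
  proof -
    have "p (Suc k) - p k = (1 / real N) *\<^sub>R e"
      unfolding p_def by (simp add: add_divide_distrib scaleR_add_left)
    then show ?thesis using N N0 R0_pos by (simp add: field_simps)
  qed
  have ag: "agree R (shift M z) (shift M (x' + (z - x)))" if z: "norm (z - x - p k) < R0 / 3" "k \<le> N" for z k
  proof -
    have "w + z \<in> M \<longleftrightarrow> w + (x' + (z - x)) \<in> M" if w: "norm w < R" for w
    proof -
      have "norm ((w + (z - x)) - p k) < R + R0"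
        using norm_triangle_ineq[of w "z - x - p k"] w z(1) R0_pos by (simp add: algebra_simps)
      then have "x + (w + (z - x)) \<in> M \<longleftrightarrow> x' + (w + (z - x)) \<in> M"
        using seg[rule_format, of "real k / real N" "w + (z - x)"] z(2) N0 unfolding p_def by simp
      then show ?thesis by (simp add: algebra_simps)
    qed
    then show ?thesis unfolding agree_def by auto
  qed
  have inM: "x' + (z - x) \<in> M" if z: "z \<in> M" "norm (z - x - p k) < R0 / 3" "k \<le> N" for z k
    using agreeD[OF ag[OF z(2,3)], of 0] R_pos z(1) by simp
  have main: "F (x' + (z - x)) - F x' = F z - F x"
    if "k \<le> N" "z \<in> M" "norm (z - x - p k) < R0 / 3" for k z
    using that
  proof (induction k arbitrary: z)
    case 0
    have z0: "norm (z - x) \<le> R0" using 0(3) R0_pos by (simp add: p_def)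
    have ag0: "agree R (shift M x) (shift M x')"
      using ag[of x 0] R0_pos by (simp add: p_def)
    have "F z - F x = F (x' + (z - x)) - F x'"
      by (rule step[OF x(1) 0(2) x(2) inM[OF 0(2,3,1)] z0 _ ag0]) simp
    then show ?case by simp
  next
    case (Suc k)
    obtain u where u: "u \<in> M" "norm (u - x - p k) < R0 / 3"
      using R0_dense[of "x + p k"] by (auto simp: dist_norm norm_minus_commute algebra_simps)
    have k: "k \<le> N" using Suc.prems(1) by simp
    have IH: "F (x' + (u - x)) - F x' = F u - F x" using Suc.IH[OF k u] .
    have zu: "norm (z - u) \<le> R0"
    proof -
      have "z - u = (z - x - p (Suc k)) + ((p (Suc k) - p k) + (- (u - x - p k)))" by simp
      then have "norm (z - u) \<le> norm (z - x - p (Suc k)) + (norm (p (Suc k) - p k) + norm (- (u - x - p k)))"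
        by (metis (no_types, lifting) norm_add_rule_thm order_refl)
      then show ?thesis using Suc.prems(3) pstep[of k] u(2) by (simp only: norm_minus_cancel)
    qed
    have "F z - F u = F (x' + (z - x)) - F (x' + (u - x))"
      by (rule step[OF u(1) Suc.prems(2) inM[OF u k] inM[OF Suc.prems(2,3,1)] zu _ ag[OF u(2) k]]) simp
    then show ?case using IH by linarith
  qed
  have pN: "p N = e" using N0 by (simp add: p_def)
  show ?thesis using inM[of y N] main[of N y] y pN by simp
qed

text \<open>
  A walk from \<open>x\<close> to \<open>x + snd \<gamma>\<close> stays in a region of bounded size, where the cell of \<open>s x\<close> in a finite
  arrangement of walls determines \<open>M\<close>.
\<close>

lemma phi_increment:
  assumes g: "\<gamma> \<in> \<Gamma>"
  obtains L where "L \<ge> 0" "\<And>h k. generic h \<Longrightarrow> generic k \<Longrightarrow> h \<in> interior W \<Longrightarrow> k \<in> interior W \<Longrightarrow>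
    h + fst \<gamma> \<in> interior W \<Longrightarrow> k + fst \<gamma> \<in> interior W \<Longrightarrow> same C0 L h k \<Longrightarrow>
    phi (h + fst \<gamma>) - phi h = phi (k + fst \<gamma>) - phi k"
proof -
  define L where "L = norm (snd \<gamma>) + R + R0"
  have L0: "L \<ge> 0" using R_pos R0_pos by (simp add: L_def)
  have "phi (h + fst \<gamma>) - phi h = phi (k + fst \<gamma>) - phi k"
    if hk: "generic h" "generic k" "h \<in> interior W" "k \<in> interior W"
      "h + fst \<gamma> \<in> interior W" "k + fst \<gamma> \<in> interior W" "same C0 L h k" for h k
  proof -
    have "\<bar>(phi (h + fst \<gamma>) - phi h) - (phi (k + fst \<gamma>) - phi k)\<bar> \<le> e" if e: "e > 0" for e
    proof -
      have e4: "e / 4 > 0" using e by simp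
      have approx: "\<exists>x. x \<in> M \<and> x + snd \<gamma> \<in> M \<and> same C0 L h (s x) \<and> \<bar>F x - phi h\<bar> < e / 4 \<and>
          \<bar>F (x + snd \<gamma>) - phi (h + fst \<gamma>)\<bar> < e / 4"
        if h: "generic h" "h \<in> interior W" "h + fst \<gamma> \<in> interior W" for h
      proof -
        obtain \<delta>1 where d1: "\<delta>1 > 0"
          "\<And>x. x \<in> M \<Longrightarrow> norm (s x - (h + fst \<gamma>)) < \<delta>1 \<Longrightarrow> \<bar>F x - phi (h + fst \<gamma>)\<bar> < e / 4"
          using phi[OF generic_shift[OF h(1) g] h(3) e4] by blast
        obtain \<delta>2 where d2: "\<delta>2 > 0" "ball (h + fst \<gamma>) \<delta>2 \<subseteq> interior W"
          using h(3) open_interior openE by blast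
        have "min \<delta>1 \<delta>2 > 0" using d1(1) d2(1) by simp
        then obtain x where x: "x \<in> M" "same C0 L h (s x)" "\<bar>F x - phi h\<bar> < e / 4"
          "norm (s x - h) < min \<delta>1 \<delta>2"
          using phi_point[OF h(1,2) e4] by blast
        have "s x + fst \<gamma> \<in> ball (h + fst \<gamma>) \<delta>2"
          using x(4) by (simp add: dist_norm norm_minus_commute)
        then have "s x + fst \<gamma> \<in> interior W" using d2(2) by blast
        then have "x + snd \<gamma> \<in> M" "s (x + snd \<gamma>) = s x + fst \<gamma>" using s_int[OF x(1) g] by auto
        then show ?thesis using d1(2)[of "x + snd \<gamma>"] x by auto
      qed
      obtain x where x: "x \<in> M" "x + snd \<gamma> \<in> M" "same C0 L h (s x)" "\<bar>F x - phi h\<bar> < e / 4"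
          "\<bar>F (x + snd \<gamma>) - phi (h + fst \<gamma>)\<bar> < e / 4" using approx[OF hk(1,3,5)] by blast
      obtain y where y: "y \<in> M" "y + snd \<gamma> \<in> M" "same C0 L k (s y)" "\<bar>F y - phi k\<bar> < e / 4"
          "\<bar>F (y + snd \<gamma>) - phi (k + fst \<gamma>)\<bar> < e / 4" using approx[OF hk(2,4,6)] by blast
      have "same C0 L (s x) (s y)" using x(3) y(3) hk(7) same_sym same_trans by blast
      moreover have "clear C0 L (s x)" using x(3) generic_clear[OF hk(1)] clear_same by blast
      ultimately have ag: "agree L (shift M x) (shift M y)" using same_agree x(1) y(1) by blast
      have tr: "x + w \<in> M \<longleftrightarrow> y + w \<in> M" if t: "0 \<le> t" "t \<le> 1" "norm (w - t *\<^sub>R snd \<gamma>) < R + R0" for t w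
      proof -
        have "norm (t *\<^sub>R snd \<gamma>) \<le> norm (snd \<gamma>)" using t by (simp add: mult_left_le_one_le)
        then have "norm w < L"
          using norm_triangle_ineq[of "w - t *\<^sub>R snd \<gamma>" "t *\<^sub>R snd \<gamma>"] t(3) by (simp add: L_def)
        then show ?thesis using agreeD[OF ag] by (simp add: add.commute)
      qed
      have "norm (x + snd \<gamma> - x - snd \<gamma>) < R0 / 3" using R0_pos by simp
      moreover have "\<forall>t w. 0 \<le> t \<longrightarrow> t \<le> 1 \<longrightarrow> norm (w - t *\<^sub>R snd \<gamma>) < R + R0 \<longrightarrow> (x + w \<in> M \<longleftrightarrow> y + w \<in> M)"
        using tr by blast
      ultimately have "F (y + (x + snd \<gamma> - x)) - F y = F (x + snd \<gamma>) - F x"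
        using transport[OF x(1) y(1) _ x(2)] by blast
      then have "F (y + snd \<gamma>) - F y = F (x + snd \<gamma>) - F x" by simp
      then show ?thesis using x(4,5) y(4,5) by linarith
    qed
    then have "(phi (h + fst \<gamma>) - phi h) - (phi (k + fst \<gamma>) - phi k) = 0"
      by (metis abs_le_zero_iff dense_ge)
    then show ?thesis by simp
  qed
  then show ?thesis using that L0 by blast
qed

end

context star_model
begin

lemma near_sides:
  obtains \<delta> where "\<delta> > 0" "\<And>k \<gamma> P. norm (k - p) < \<delta> \<Longrightarrow> \<gamma> \<in> U C L \<Longrightarrow> P \<in> HP \<Longrightarrow>
    side P (p + fst \<gamma>) \<noteq> 0 \<Longrightarrow> side P (k + fst \<gamma>) = side P (p + fst \<gamma>)"
proof -
  define I where "I = {i \<in> U C L \<times> HP. side (snd i) (p + fst (fst i)) \<noteq> 0}"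
  have finI: "finite I" unfolding I_def using U_finite HP_fin by simp
  define S where "S = (\<Inter>i\<in>I. (\<lambda>k. k + fst (fst i)) -` {k. side (snd i) k = side (snd i) (p + fst (fst i))})"
  have "open S" unfolding S_def
    by (intro open_INT finI ballI open_vimage open_side continuous_intros) (auto simp: I_def)
  moreover have "p \<in> S" by (simp add: S_def)
  ultimately obtain \<delta> where d: "\<delta> > 0" "ball p \<delta> \<subseteq> S" using openE by blast
  have "side P (k + fst \<gamma>) = side P (p + fst \<gamma>)"
    if "norm (k - p) < \<delta>" "\<gamma> \<in> U C L" "P \<in> HP" "side P (p + fst \<gamma>) \<noteq> 0" for k \<gamma> P
  proof -
    have "k \<in> S" using d(2) that(1) by (auto simp: dist_norm norm_minus_commute subset_iff)
    moreover have "(\<gamma>, P) \<in> I" using that by (simp add: I_def)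
    ultimately show ?thesis unfolding S_def by force
  qed
  then show ?thesis using that d(1) by blast
qed

end

context rigid_function
begin

text \<open>
  This considers points \<open>p\<close> that lie only on walls that are parallel to each other, none of them a
  translate by a lattice vector in \<open>U C L\<close>. At the other points nothing is claimed; a generic path avoids
  the intersections of walls that are not parallel, and it meets the walls with translations in \<open>U C L\<close>
  only when it changes the cell.
\<close>

definition no_jump :: "real \<Rightarrow> real \<Rightarrow> bool" where
  "no_jump C L \<longleftrightarrow> C \<ge> C0 \<and> L \<ge> 0 \<and>
     (\<forall>p e. p \<in> interior W \<longrightarrow> clear C L p \<longrightarrow> e > 0 \<longrightarrow>
        (\<forall>\<gamma>\<in>\<Gamma>. \<forall>\<gamma>'\<in>\<Gamma>. \<forall>P\<in>HP. \<forall>P'\<in>HP. side P (p + fst \<gamma>) = 0 \<longrightarrow> side P' (p + fst \<gamma>') = 0 \<longrightarrow>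
           (\<exists>l. fst P' = l *\<^sub>R fst P)) \<longrightarrow>
        (\<exists>\<delta>>0. \<forall>h k. generic h \<longrightarrow> generic k \<longrightarrow> norm (h - p) < \<delta> \<longrightarrow> norm (k - p) < \<delta> \<longrightarrow>
           \<bar>phi h - phi k\<bar> < e))"

text \<open>
  The patterns on two sides of the walls through \<open>p\<close> differ only at places \<open>snd \<gamma>\<close> with \<open>p + fst \<gamma>\<close> on
  a wall. As these walls are parallel, the places lie near a translate of a subspace. If this translate
  came close to the origin, then a lattice vector along the wall would move one of the places
  close to the origin, and \<open>p\<close> would lie on a translate excluded by \<open>clear\<close>. So one
  can walk straight away from the translate of the subspace. During the walk the increments of \<open>F\<close> on the
  two sides coincide, and at its end the patterns agree on a large ball, so the values of \<open>F\<close> there almost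
  coincide.
\<close>

lemma no_jump_exists: "\<exists>C L. no_jump C L"
proof -
  define Bv where "Bv a = (\<lambda>P. snd P * (a \<bullet> a) / (fst P \<bullet> a)) ` HP" for a :: 'h
  define Bs where "Bs a = (\<lambda>(c, c'). c - c') ` (Bv a \<times> Bv a)" for a :: 'h
  define Q where "Q a D \<kappa> r \<longleftrightarrow> subspace D \<and> \<kappa> \<ge> 0 \<and> r \<ge> 0 \<and>
     (\<forall>\<gamma>\<in>\<Gamma>. a \<bullet> fst \<gamma> \<in> Bs a \<longrightarrow> norm (fst \<gamma>) \<le> 2 * C0 \<longrightarrow> (\<exists>d\<in>D. norm (snd \<gamma> - d) \<le> r)) \<and>
     (\<forall>d\<in>D. \<exists>\<sigma>\<in>\<Gamma>. a \<bullet> fst \<sigma> = 0 \<and> norm (fst \<sigma>) \<le> \<kappa> \<and> norm (snd \<sigma> - d) \<le> \<kappa>)"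
    for a :: 'h and D :: "'a set" and \<kappa> r
  have "finite (Bs a)" for a unfolding Bs_def Bv_def using HP_fin by simp
  then have "\<exists>D \<kappa> r. Q a D \<kappa> r" for a
    unfolding Q_def using wall_subspace[OF zero diff] by blast
  then obtain D \<kappa> r where Q: "\<And>a. Q a (D a) (\<kappa> a) (r a)" by metis
  have pos: "\<kappa> a \<ge> 0" "r a \<ge> 0" for a using Q[of a] unfolding Q_def by auto
  define \<kappa>m where "\<kappa>m = (\<Sum>P\<in>HP. \<kappa> (fst P))"
  define rm where "rm = (\<Sum>P\<in>HP. r (fst P))"
  have \<kappa>m: "\<kappa> (fst P) \<le> \<kappa>m" and rm: "r (fst P) \<le> rm" if "P \<in> HP" for P
    unfolding \<kappa>m_def rm_def
    using member_le_sum[of P HP "\<lambda>P. \<kappa> (fst P)"] member_le_sum[of P HP "\<lambda>P. r (fst P)"] that HP_fin pos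
    by auto
  have m0: "\<kappa>m \<ge> 0" "rm \<ge> 0" unfolding \<kappa>m_def rm_def using pos by (simp_all add: sum_nonneg)
  define C1 where "C1 = C0 + \<kappa>m"
  define R1 where "R1 = \<kappa>m + rm + R + R0"
  have "\<exists>\<delta>>0. \<forall>h k. generic h \<longrightarrow> generic k \<longrightarrow> norm (h - p) < \<delta> \<longrightarrow> norm (k - p) < \<delta> \<longrightarrow> \<bar>phi h - phi k\<bar> < e"
    if p: "p \<in> interior W" and cl: "clear C1 R1 p" and e: "e > 0"
      and single: "\<forall>\<gamma>\<in>\<Gamma>. \<forall>\<gamma>'\<in>\<Gamma>. \<forall>P\<in>HP. \<forall>P'\<in>HP. side P (p + fst \<gamma>) = 0 \<longrightarrow> side P' (p + fst \<gamma>') = 0 \<longrightarrow>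
           (\<exists>l. fst P' = l *\<^sub>R fst P)" for p e
  proof -
    obtain \<delta>W where dW: "\<delta>W > 0" "ball p \<delta>W \<subseteq> interior W" using p open_interior openE by blast
    have inW: "k \<in> interior W" if "norm (k - p) < \<delta>W" for k
      using dW(2) that by (auto simp: dist_norm norm_minus_commute subset_iff)
    show ?thesis
    proof (cases "\<forall>L. clear C0 L p")
      case True
      obtain L where L: "L \<ge> 0" "\<And>h k. generic h \<Longrightarrow> generic k \<Longrightarrow> h \<in> interior W \<Longrightarrow> k \<in> interior W \<Longrightarrow>
          same C0 L h k \<Longrightarrow> \<bar>phi h - phi k\<bar> < e" using phi_same[OF e] by blast
      obtain \<delta> where d: "\<delta> > 0" "\<And>k. norm (k - p) < \<delta> \<Longrightarrow> same C0 L p k"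
        using cell_ball True by blast
      have "\<bar>phi h - phi k\<bar> < e" if "generic h" "generic k" "norm (h - p) < min \<delta> \<delta>W" "norm (k - p) < min \<delta> \<delta>W" for h k
        using L(2)[of h k] that d(2)[of h] d(2)[of k] inW same_sym same_trans by (meson min_less_iff_conj)
      then show ?thesis using d(1) dW(1) by (intro exI[of _ "min \<delta> \<delta>W"]) auto
    next
      case False
      then obtain \<gamma>1 P1 where g1: "\<gamma>1 \<in> \<Gamma>" "norm (fst \<gamma>1) \<le> C0" "P1 \<in> HP" "side P1 (p + fst \<gamma>1) = 0"
        unfolding clear_def U_def by blast
      define a where "a = fst P1"
      have a0: "a \<noteq> 0" using HP_nz g1(3) by (simp add: a_def)
      have aa: "a \<bullet> a > 0" using a0 by simp
      have wall1: "a \<bullet> (p + fst \<gamma>1) = snd P1" using g1(4) by (simp add: side_zero_iff a_def)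
      have subD: "subspace (D a)" using Q[of a] unfolding Q_def by blast
      \<comment> \<open>The vector \<open>z\<close> leads from the origin to the nearest point of \<open>snd \<gamma>1 + D a\<close>.\<close>
      obtain y z where yz: "y \<in> D a" "\<And>w. w \<in> D a \<Longrightarrow> orthogonal z w" "snd \<gamma>1 = y + z"
        using orthogonal_subspace_decomp_exists[of "D a" "snd \<gamma>1"] subD by (metis span_eq_iff)
      have "- y \<in> D a" using yz(1) subD by (rule subspace_neg[rotated])
      then obtain \<sigma> where s: "\<sigma> \<in> \<Gamma>" "a \<bullet> fst \<sigma> = 0" "norm (fst \<sigma>) \<le> \<kappa> a" "norm (snd \<sigma> + y) \<le> \<kappa> a"
        using Q[of a] unfolding Q_def by force
      have ka: "\<kappa> a \<le> \<kappa>m" "r a \<le> rm" using \<kappa>m rm g1(3) by (auto simp: a_def)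
      have z_far: "norm z > rm + R + R0"
      proof (rule ccontr)
        assume "\<not> ?thesis"
        then have nz: "norm z \<le> rm + R + R0" by simp
        have "norm (fst (\<gamma>1 + \<sigma>)) \<le> C1"
          using norm_triangle_ineq[of "fst \<gamma>1" "fst \<sigma>"] g1(2) s(3) ka by (simp add: C1_def)
        moreover have "norm (snd (\<gamma>1 + \<sigma>)) \<le> R1"
          using norm_triangle_ineq[of z "snd \<sigma> + y"] nz s(4) ka by (simp add: R1_def yz(3) algebra_simps)
        ultimately have "\<gamma>1 + \<sigma> \<in> U C1 R1" using add[OF g1(1) s(1)] by (simp add: U_def)
        then have "side P1 (p + fst (\<gamma>1 + \<sigma>)) \<noteq> 0" using cl g1(3) unfolding clear_def by blast
        moreover have "a \<bullet> (p + fst (\<gamma>1 + \<sigma>)) = snd P1" using wall1 s(2) by (simp add: inner_add_right)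
        ultimately show False by (simp add: side_zero_iff a_def)
      qed
      have z0: "norm z > 0" using z_far m0 R_pos R0_pos by linarith
      define u where "u = z /\<^sub>R norm z"
      have nu: "norm u = 1" using z0 by (simp add: u_def)
      have uu: "u \<bullet> u = 1" using nu by (simp add: norm_eq_1)
      have uD: "u \<bullet> d = 0" if "d \<in> D a" for d using yz(2)[OF that] by (simp add: u_def orthogonal_def)
      have uz: "u \<bullet> z = norm z" using z0 by (simp add: u_def dot_square_norm power2_eq_square)
      have le_norm: "u \<bullet> w \<le> norm w" for w using norm_cauchy_schwarz[of u w] nu by simp
      \<comment> \<open>The places where the patterns can differ lie near \<open>z + D a\<close>, hence far out in direction \<open>u\<close>,
          the direction of \<open>z\<close>. The walk goes in direction \<open>- u\<close>.\<close>
      have far: "u \<bullet> snd \<gamma> > R + R0"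
        if g: "\<gamma> \<in> \<Gamma>" "norm (fst \<gamma>) \<le> C0" "P \<in> HP" "side P (p + fst \<gamma>) = 0" for \<gamma> P
      proof -
        obtain l where l: "fst P = l *\<^sub>R a" using single g1 g unfolding a_def by blast
        have l0: "l \<noteq> 0" using HP_nz[OF g(3)] l by auto
        have "fst P \<bullet> (p + fst \<gamma>) = snd P" using g(4) by (simp add: side_zero_iff)
        then have lw: "l * (a \<bullet> (p + fst \<gamma>)) = snd P" by (simp add: l)
        have "a \<bullet> (p + fst \<gamma>) = snd P * (a \<bullet> a) / (fst P \<bullet> a)"
          unfolding l lw[symmetric] using l0 aa by simp
        then have b1: "a \<bullet> (p + fst \<gamma>) \<in> Bv a" unfolding Bv_def using g(3) by blast
        have "a \<bullet> (p + fst \<gamma>1) = snd P1 * (a \<bullet> a) / (fst P1 \<bullet> a)"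
          unfolding wall1 using aa by (simp add: a_def)
        then have b2: "a \<bullet> (p + fst \<gamma>1) \<in> Bv a" unfolding Bv_def using g1(3) by blast
        have "a \<bullet> fst (\<gamma> - \<gamma>1) = a \<bullet> (p + fst \<gamma>) - a \<bullet> (p + fst \<gamma>1)"
          by (simp add: inner_add_right inner_diff_right)
        then have "a \<bullet> fst (\<gamma> - \<gamma>1) \<in> Bs a" unfolding Bs_def using b1 b2 by force
        moreover have "norm (fst (\<gamma> - \<gamma>1)) \<le> 2 * C0"
          using norm_triangle_ineq4[of "fst \<gamma>" "fst \<gamma>1"] g(2) g1(2) by simp
        ultimately obtain d where d: "d \<in> D a" "norm (snd (\<gamma> - \<gamma>1) - d) \<le> r a"
          using Q[of a] diff[OF g(1) g1(1)] unfolding Q_def by blast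
        have "snd \<gamma> = y + z + d + (snd (\<gamma> - \<gamma>1) - d)" using yz(3) by simp
        then have "u \<bullet> snd \<gamma> = norm z + u \<bullet> (snd (\<gamma> - \<gamma>1) - d)"
          using uD[OF yz(1)] uD[OF d(1)] uz by (metis (no_types, lifting) add.commute add_0 inner_add_right)
        moreover have "\<bar>u \<bullet> (snd (\<gamma> - \<gamma>1) - d)\<bar> \<le> r a"
          using Cauchy_Schwarz_ineq2[of u "snd (\<gamma> - \<gamma>1) - d"] nu d(2) by simp
        ultimately show ?thesis using z_far ka by linarith
      qed
      have e3: "e / 3 > 0" using e by simp
      obtain L where L: "L \<ge> 0"
          "\<And>x y. x \<in> M \<Longrightarrow> y \<in> M \<Longrightarrow> agree L (shift M x) (shift M y) \<Longrightarrow> \<bar>F x - F y\<bar> < e / 3"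
        using unif_nonneg[OF e3] by blast
      define t where "t = L + R0"
      have t0: "t \<ge> 0" using L(1) R0_pos by (simp add: t_def)
      define v where "v = - (t *\<^sub>R u)"
      define Lt where "Lt = t + R + R0 + L"
      obtain \<delta> where d: "\<delta> > 0" "\<And>k \<gamma> P. norm (k - p) < \<delta> \<Longrightarrow> \<gamma> \<in> U C0 Lt \<Longrightarrow> P \<in> HP \<Longrightarrow>
          side P (p + fst \<gamma>) \<noteq> 0 \<Longrightarrow> side P (k + fst \<gamma>) = side P (p + fst \<gamma>)"
        using near_sides by blast
      have "\<bar>phi h - phi k\<bar> < e"
        if hk: "generic h" "generic k" "norm (h - p) < min \<delta> \<delta>W" "norm (k - p) < min \<delta> \<delta>W" for h k
      proof -
        have hW: "h \<in> interior W" "k \<in> interior W" using inW hk by auto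
        obtain x where x: "x \<in> M" "same C0 Lt h (s x)" "\<bar>F x - phi h\<bar> < e / 3"
          using phi_point[OF hk(1) hW(1) e3 e3] by blast
        obtain x' where x': "x' \<in> M" "same C0 Lt k (s x')" "\<bar>F x' - phi k\<bar> < e / 3"
          using phi_point[OF hk(2) hW(2) e3 e3] by blast
        have good: "side P (s x1 + fst \<gamma>) = side P (p + fst \<gamma>) \<and> side P (p + fst \<gamma>) \<noteq> 0"
          if g: "\<gamma> \<in> \<Gamma>" "norm (fst \<gamma>) \<le> C0" "norm (snd \<gamma>) \<le> Lt" "u \<bullet> snd \<gamma> < R + R0" "P \<in> HP"
            and x1: "same C0 Lt h1 (s x1)" "norm (h1 - p) < \<delta>" for \<gamma> P h1 x1
        proof -
          have gU: "\<gamma> \<in> U C0 Lt" using g by (simp add: U_def)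
          have nz: "side P (p + fst \<gamma>) \<noteq> 0" using far[OF g(1,2,5)] g(4) by linarith
          have "side P (h1 + fst \<gamma>) = side P (p + fst \<gamma>)" using d(2)[OF x1(2) gU g(5) nz] .
          moreover have "side P (h1 + fst \<gamma>) = side P (s x1 + fst \<gamma>)"
            using x1(1) gU g(5) unfolding same_def by blast
          ultimately show ?thesis using nz by simp
        qed
        have hd: "norm (h - p) < \<delta>" "norm (k - p) < \<delta>" using hk by auto
        have eqM: "x + w \<in> M \<longleftrightarrow> x' + w \<in> M" if w: "norm w \<le> Lt" "u \<bullet> w < R + R0" for w
        proof
          assume "x + w \<in> M"
          then show "x' + w \<in> M"
            using good[OF _ _ _ _ _ x(2) hd(1)] good[OF _ _ _ _ _ x'(2) hd(2)] w
            by (intro point_transfer[OF x(1) x'(1)]) metis+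
        next
          assume "x' + w \<in> M"
          then show "x + w \<in> M"
            using good[OF _ _ _ _ _ x(2) hd(1)] good[OF _ _ _ _ _ x'(2) hd(2)] w
            by (intro point_transfer[OF x'(1) x(1)]) metis+
        qed
        have seg: "\<forall>\<tau> w. 0 \<le> \<tau> \<longrightarrow> \<tau> \<le> 1 \<longrightarrow> norm (w - \<tau> *\<^sub>R v) < R + R0 \<longrightarrow> (x + w \<in> M \<longleftrightarrow> x' + w \<in> M)"
        proof (intro allI impI)
          fix \<tau> w assume tau: "0 \<le> \<tau>" "\<tau> \<le> 1" "norm (w - \<tau> *\<^sub>R v) < R + R0"
          have "norm (\<tau> *\<^sub>R v) \<le> t" using tau t0 nu by (simp add: v_def mult_left_le_one_le)
          then have "norm w \<le> Lt"
            using norm_triangle_ineq[of "w - \<tau> *\<^sub>R v" "\<tau> *\<^sub>R v"] tau(3) L(1) by (simp add: Lt_def)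
          moreover have "u \<bullet> w < R + R0"
          proof -
            have "u \<bullet> w = u \<bullet> (w - \<tau> *\<^sub>R v) - \<tau> * t"
              by (simp add: v_def inner_diff_right inner_add_right uu)
            then show ?thesis using le_norm[of "w - \<tau> *\<^sub>R v"] tau(3) mult_nonneg_nonneg[OF tau(1) t0] by linarith
          qed
          ultimately show "x + w \<in> M \<longleftrightarrow> x' + w \<in> M" by (rule eqM)
        qed
        obtain q where q: "q \<in> M" "norm (q - x - v) < R0 / 3"
          using R0_dense[of "x + v"] by (auto simp: dist_norm norm_minus_commute algebra_simps)
        define q' where "q' = x' + (q - x)"
        have tr: "q' \<in> M" "F q' - F x' = F q - F x"
          using transport[OF x(1) x'(1) seg q] unfolding q'_def by auto
        have "w + q \<in> M \<longleftrightarrow> w + q' \<in> M" if w: "norm w < L" for w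
        proof -
          define w' where "w' = w + (q - x - v) + v"
          have nv: "norm v = t" using nu t0 by (simp add: v_def)
          have "norm w' \<le> norm w + norm (q - x - v) + norm v"
            unfolding w'_def by (intro norm_triangle_le add_mono order_refl norm_triangle_ineq)
          then have 1: "norm w' \<le> Lt" using w q(2) nv R_pos R0_pos by (simp add: Lt_def)
          have "u \<bullet> w' = u \<bullet> w + u \<bullet> (q - x - v) - t"
            by (simp add: w'_def v_def inner_add_right inner_diff_right uu)
          then have 2: "u \<bullet> w' < R + R0"
            using le_norm[of w] le_norm[of "q - x - v"] w q(2) R_pos R0_pos by (simp add: t_def)
          show ?thesis using eqM[OF 1 2] by (simp add: w'_def q'_def algebra_simps)
        qed
        then have "agree L (shift M q) (shift M q')" unfolding agree_iff by simp
        then have "\<bar>F q - F q'\<bar> < e / 3" using L(2) q(1) tr(1) by blast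
        then show ?thesis using tr(2) x(3) x'(3) by linarith
      qed
      then show ?thesis using d(1) dW(1) by (intro exI[of _ "min \<delta> \<delta>W"]) auto
    qed
  qed
  moreover have "C1 \<ge> C0" "R1 \<ge> 0" using m0 R_pos R0_pos by (auto simp: C1_def R1_def)
  ultimately have "no_jump C1 R1" unfolding no_jump_def by blast
  then show ?thesis by blast
qed

end

section \<open>Rigidity\<close>

context rigid_function
begin

text \<open>
  Join \<open>h\<close> to a point near \<open>h'\<close> by a segment that meets only walls of one direction at a time. Between
  the walls that are relevant for \<open>\<gamma>\<close> the increment is constant by \<open>phi_increment\<close>. At a crossing, neither
  \<open>phi\<close> at the points of the segment nor \<open>phi\<close> at their translates by \<open>fst \<gamma>\<close> jumps, because the segment and
  its translate stay in one cell each.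
\<close>

lemma increment_constant:
  assumes nj: "no_jump C L" and gen: "generic h" "generic h'"
    and W: "h \<in> interior W" "h + fst \<gamma> \<in> interior W"
    and g: "\<gamma> \<in> \<Gamma>" and same: "same C L h h'" "same C L (h + fst \<gamma>) (h' + fst \<gamma>)"
  shows "phi (h + fst \<gamma>) - phi h = phi (h' + fst \<gamma>) - phi h'"
proof -
  define v where "v = fst \<gamma>"
  have CL: "C \<ge> C0" "L \<ge> 0" using nj unfolding no_jump_def by auto
  have C: "C \<ge> 0" using CL(1) C0_nonneg by linarith
  define O1 where "O1 = {k. same C L h k} \<inter> (\<lambda>k. v + k) -` {k. same C L (h + v) k}"
  have gv: "generic (h + v)" unfolding v_def using generic_shift[OF gen(1) g] .
  have cell1: "open {k. same C L h k}" "convex {k. same C L h k}"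
    by (rule open_cell[OF generic_clear[OF gen(1)]], rule convex_cell[OF generic_clear[OF gen(1)]])
  have cell2: "open {k. same C L (h + v) k}" "convex {k. same C L (h + v) k}"
    by (rule open_cell[OF generic_clear[OF gv]], rule convex_cell[OF generic_clear[OF gv]])
  have openO: "open O1" unfolding O1_def
    by (intro open_Int cell1 open_vimage cell2 continuous_on_add continuous_on_const continuous_on_id)
  have translate: "(\<lambda>k. v + k) -` S = (\<lambda>k. - v + k) ` S" for S :: "'h set"
  proof (intro set_eqI iffI)
    fix k assume "k \<in> (\<lambda>k. v + k) -` S"
    then have "v + k \<in> S" by simp
    moreover have "k = - v + (v + k)" by simp
    ultimately show "k \<in> (\<lambda>k. - v + k) ` S" by (rule rev_image_eqI)
  qed auto
  have convO: "convex O1" unfolding O1_def translate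
    by (intro convex_Int cell1 convex_translation cell2)
  have O1: "h \<in> O1" "h' \<in> O1" using same unfolding O1_def v_def by (auto simp: same_def add.commute)
  have OW: "k \<in> interior W" "k + v \<in> interior W" if "k \<in> O1" for k
    using that same_interior[OF _ generic_clear[OF gen(1)], of C L k]
      same_interior[OF _ generic_clear[OF gv], of C L "v + k"] W interior_subset C CL(2)
    unfolding O1_def v_def by (auto simp: add.commute subset_iff)
  define g where "g k = phi (k + v) - phi k" for k
  obtain L' where L': "L' \<ge> 0" "\<And>k l. generic k \<Longrightarrow> generic l \<Longrightarrow> k \<in> interior W \<Longrightarrow> l \<in> interior W \<Longrightarrow>
    k + fst \<gamma> \<in> interior W \<Longrightarrow> l + fst \<gamma> \<in> interior W \<Longrightarrow> same C0 L' k l \<Longrightarrow>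
    phi (k + fst \<gamma>) - phi k = phi (l + fst \<gamma>) - phi l" using phi_increment[OF g] by blast
  have g_same: "g k = g l" if "generic k" "generic l" "k \<in> O1" "l \<in> O1" "same C0 L' k l" for k l
    using L'(2)[OF that(1,2)] OW[OF that(3)] OW[OF that(4)] that(5) by (simp add: g_def v_def)
  \<comment> \<open>A generic segment, which crosses at most one hyperplane at a time.\<close>
  define I where "I = \<Gamma> \<times> HP"
  have I: "countable I" unfolding I_def using countable_Gamma HP_fin by (simp add: countable_finite)
  define \<beta> where "\<beta> i = snd (snd i) - fst (snd i) \<bullet> (h + fst (fst i))" for i :: "('h \<times> 'a) \<times> 'h \<times> real"
  have \<beta>0: "\<beta> i \<noteq> 0" if "i \<in> I" for i
  proof -
    have "fst i \<in> \<Gamma>" "snd i \<in> HP" using that by (auto simp: I_def)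
    then have "fst (snd i) \<bullet> (h + fst (fst i)) \<noteq> snd (snd i)"
      using gen(1) unfolding generic_def side_zero_iff by blast
    then show ?thesis by (simp add: \<beta>_def)
  qed
  \<comment> \<open>A segment from \<open>h\<close> in direction \<open>\<theta>\<close> meets the wall \<open>i\<close> at time \<open>\<beta> i / (fst (snd i) \<bullet> \<theta>)\<close>. If it
      meets \<open>i\<close> and \<open>j\<close> at the same time, then \<open>V i j \<bullet> \<theta> = 0\<close>; and \<open>V i j = 0\<close> only for parallel walls. So it
      suffices that the end point avoids countably many hyperplanes.\<close>
  define V where "V i j = \<beta> i *\<^sub>R fst (snd j) - \<beta> j *\<^sub>R fst (snd i)" for i j :: "('h \<times> 'a) \<times> 'h \<times> real"
  define S where "S = (\<lambda>i. (fst (snd i), snd (snd i) - fst (snd i) \<bullet> fst (fst i))) ` I \<union>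
     (\<lambda>(i, j). (V i j, V i j \<bullet> h)) ` {(i, j) \<in> I \<times> I. V i j \<noteq> 0}"
  have cS: "countable S" unfolding S_def
    by (intro countable_Un countable_image countable_subset[of "{(i, j) \<in> I \<times> I. V i j \<noteq> 0}" "I \<times> I"]
          countable_SIGMA I) auto
  have nzS: "\<forall>i\<in>S. fst i \<noteq> 0"
    using HP_nz unfolding S_def I_def by auto
  obtain \<delta>1 where d1: "\<delta>1 > 0" "\<And>k. norm (k - h') < \<delta>1 \<Longrightarrow> same C0 L' h' k"
    using cell_ball[OF generic_clear[OF gen(2)]] by blast
  obtain \<delta>2 where d2: "\<delta>2 > 0" "ball h' \<delta>2 \<subseteq> O1" using openO O1(2) openE by blast
  have "min \<delta>1 \<delta>2 > 0" using d1 d2 by simp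
  then obtain h2 where h2: "norm (h2 - h') < min \<delta>1 \<delta>2" "\<forall>i\<in>S. fst i \<bullet> h2 \<noteq> snd i"
    by (rule ball_avoids_hyperplanes[OF cS nzS])
  have h2O: "h2 \<in> O1" using d2(2) h2(1) by (auto simp: dist_norm norm_minus_commute subset_iff)
  have gen2: "generic h2"
    unfolding generic_def side_zero_iff
  proof (intro ballI notI)
    fix \<gamma>' P assume i: "\<gamma>' \<in> \<Gamma>" "P \<in> HP" and eq: "fst P \<bullet> (h2 + fst \<gamma>') = snd P"
    have "(\<gamma>', P) \<in> I" using i by (simp add: I_def)
    then have "(fst P, snd P - fst P \<bullet> fst \<gamma>') \<in> S" unfolding S_def by force
    then have "fst P \<bullet> h2 \<noteq> snd P - fst P \<bullet> fst \<gamma>'" using h2(2) by force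
    then show False using eq by (simp add: inner_add_right algebra_simps)
  qed
  define \<theta> where "\<theta> = h2 - h"
  have V\<theta>: "V i j = 0" if "i \<in> I" "j \<in> I" "V i j \<bullet> \<theta> = 0" for i j
  proof (rule ccontr)
    assume "V i j \<noteq> 0"
    then have "(V i j, V i j \<bullet> h) \<in> S" unfolding S_def using that by force
    then have "V i j \<bullet> h2 \<noteq> V i j \<bullet> h" using h2(2) by force
    then show False using that(3) by (simp add: \<theta>_def inner_diff_right)
  qed
  define q where "q t = h + t *\<^sub>R \<theta>" for t :: real
  have qO: "q t \<in> O1" if "0 \<le> t" "t \<le> 1" for t
  proof -
    have "q t = (1 - t) *\<^sub>R h + t *\<^sub>R h2" by (simp add: q_def \<theta>_def algebra_simps)
    then show ?thesis using convexD[OF convO O1(1) h2O, of "1 - t" t] that by simp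
  qed
  have q_diff: "norm (q s - q t) = \<bar>s - t\<bar> * norm \<theta>" for s t
    unfolding q_def by (simp flip: scaleR_diff_left)
  have hit: "\<beta> i = t * (fst (snd i) \<bullet> \<theta>)" if "fst (snd i) \<bullet> (q t + fst (fst i)) = snd (snd i)" for i t
    using that unfolding \<beta>_def q_def by (simp add: inner_add_right algebra_simps)
  have nongeneric: "{t. \<not> generic (q t)} \<subseteq> (\<lambda>i. \<beta> i / (fst (snd i) \<bullet> \<theta>)) ` I"
  proof
    fix t assume "t \<in> {t. \<not> generic (q t)}"
    then obtain i where i: "i \<in> I" "fst (snd i) \<bullet> (q t + fst (fst i)) = snd (snd i)"
      unfolding generic_def side_zero_iff I_def by auto
    have "\<beta> i = t * (fst (snd i) \<bullet> \<theta>)" using hit[OF i(2)] .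
    moreover from this have "fst (snd i) \<bullet> \<theta> \<noteq> 0" using \<beta>0[OF i(1)] by auto
    ultimately have "t = \<beta> i / (fst (snd i) \<bullet> \<theta>)" by simp
    then show "t \<in> (\<lambda>i. \<beta> i / (fst (snd i) \<bullet> \<theta>)) ` I" using i(1) by blast
  qed
  have pick: "\<exists>t. l < t \<and> t < u \<and> generic (q t)" if "l < u" for l u
  proof (rule ccontr)
    assume "\<not> ?thesis"
    then have "{l<..<u} \<subseteq> {t. \<not> generic (q t)}" by auto
    then have "countable {l<..<u}"
      using countable_subset[OF nongeneric countable_image[OF I]] by (rule countable_subset)
    then show False using uncountable_open_interval[of l u] that by blast
  qed
  have local: "\<exists>\<delta>>0. \<forall>x y. 0 \<le> x \<longrightarrow> x \<le> 1 \<longrightarrow> 0 \<le> y \<longrightarrow> y \<le> 1 \<longrightarrow> \<bar>x - a\<bar> < \<delta> \<longrightarrow> \<bar>y - a\<bar> < \<delta> \<longrightarrow>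
      generic (q x) \<longrightarrow> generic (q y) \<longrightarrow> g (q x) = g (q y)" if a: "0 \<le> a" "a \<le> 1" for a
  proof -
    have n1: "norm \<theta> + 1 > 0" using norm_ge_zero[of \<theta>] by linarith
    have close: "norm (q x - q a) < \<delta>" if "\<bar>x - a\<bar> < \<delta> / (norm \<theta> + 1)" for x \<delta>
    proof -
      have "\<bar>x - a\<bar> * norm \<theta> \<le> \<bar>x - a\<bar> * (norm \<theta> + 1)" by (intro mult_left_mono) auto
      also have "\<dots> < \<delta>" using that n1 by (simp add: pos_less_divide_eq)
      finally show ?thesis by (simp add: q_diff)
    qed
    obtain \<delta> where d: "\<delta> > 0" "\<And>k \<gamma> P. norm (k - q a) < \<delta> \<Longrightarrow> \<gamma> \<in> U C0 L' \<Longrightarrow> P \<in> HP \<Longrightarrow>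
          side P (q a + fst \<gamma>) \<noteq> 0 \<Longrightarrow> side P (k + fst \<gamma>) = side P (q a + fst \<gamma>)"
      using near_sides by blast
    define \<delta>' where "\<delta>' = \<delta> / (norm \<theta> + 1)"
    have d': "\<delta>' > 0" using d(1) n1 by (simp add: \<delta>'_def)
    have same_side: "g (q x) = g (q y)"
      if xy: "0 \<le> x" "x \<le> 1" "0 \<le> y" "y \<le> 1" "\<bar>x - a\<bar> < \<delta>'" "\<bar>y - a\<bar> < \<delta>'"
        "generic (q x)" "generic (q y)" "sgn (x - a) = sgn (y - a)" for x y
    proof -
      have "side P (q x + fst \<gamma>') = side P (q y + fst \<gamma>')" if i: "\<gamma>' \<in> U C0 L'" "P \<in> HP" for \<gamma>' P
      proof (cases "side P (q a + fst \<gamma>') = 0")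
        case False
        then show ?thesis using d(2)[OF close i] xy(5,6) unfolding \<delta>'_def by metis
      next
        case True
        have "fst P \<bullet> (q z + fst \<gamma>') - snd P = (z - a) * (fst P \<bullet> \<theta>)" for z
          using True unfolding side_zero_iff q_def by (simp add: inner_add_right algebra_simps)
        then show ?thesis unfolding side_def using xy(9) by (simp add: sgn_mult)
      qed
      then have "same C0 L' (q x) (q y)" unfolding same_def by blast
      then show ?thesis using g_same xy qO by blast
    qed
    show ?thesis
    proof (cases "generic (q a)")
      case True
      have "g (q x) = g (q a)" if x: "0 \<le> x" "x \<le> 1" "\<bar>x - a\<bar> < \<delta>'" "generic (q x)" for x
      proof -
        have "side P (q x + fst \<gamma>') = side P (q a + fst \<gamma>')" if i: "\<gamma>' \<in> U C0 L'" "P \<in> HP" for \<gamma>' P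
          using d(2)[OF close i] x(3) True i unfolding \<delta>'_def generic_def U_def by blast
        then have "same C0 L' (q x) (q a)" unfolding same_def by blast
        then show ?thesis using g_same x qO a True by blast
      qed
      then show ?thesis using d' by metis
    next
      case False
      then obtain i0 where i0: "i0 \<in> I" "fst (snd i0) \<bullet> (q a + fst (fst i0)) = snd (snd i0)"
        unfolding generic_def side_zero_iff I_def by auto
      have single: "\<forall>\<gamma>1\<in>\<Gamma>. \<forall>\<gamma>2\<in>\<Gamma>. \<forall>P\<in>HP. \<forall>P'\<in>HP. side P (q a + fst \<gamma>1) = 0 \<longrightarrow>
          side P' (q a + fst \<gamma>2) = 0 \<longrightarrow> (\<exists>l. fst P' = l *\<^sub>R fst P)"
      proof (intro ballI impI)
        fix \<gamma>1 \<gamma>2 P P'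
        assume A: "\<gamma>1 \<in> \<Gamma>" "\<gamma>2 \<in> \<Gamma>" "P \<in> HP" "P' \<in> HP" "side P (q a + fst \<gamma>1) = 0" "side P' (q a + fst \<gamma>2) = 0"
        define i j where "i = (\<gamma>1, P)" and "j = (\<gamma>2, P')"
        have ij: "i \<in> I" "j \<in> I" using A by (auto simp: I_def i_def j_def)
        have "\<beta> i = a * (fst P \<bullet> \<theta>)" "\<beta> j = a * (fst P' \<bullet> \<theta>)"
          using hit[of i a] hit[of j a] A(5,6) by (auto simp: side_zero_iff i_def j_def)
        then have "V i j \<bullet> \<theta> = 0" by (simp add: V_def inner_diff_left i_def j_def)
        then have "V i j = 0" using V\<theta> ij by blast
        then have "\<beta> i *\<^sub>R fst P' = \<beta> j *\<^sub>R fst P" by (simp add: V_def i_def j_def)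
        then have "fst P' = (\<beta> j / \<beta> i) *\<^sub>R fst P"
          using \<beta>0[OF ij(1)] by (metis divide_inverse_commute right_inverse scaleR_one scaleR_scaleR mult.commute)
        then show "\<exists>l. fst P' = l *\<^sub>R fst P" by blast
      qed
      have single': "\<forall>\<gamma>1\<in>\<Gamma>. \<forall>\<gamma>2\<in>\<Gamma>. \<forall>P\<in>HP. \<forall>P'\<in>HP. side P (q a + v + fst \<gamma>1) = 0 \<longrightarrow>
          side P' (q a + v + fst \<gamma>2) = 0 \<longrightarrow> (\<exists>l. fst P' = l *\<^sub>R fst P)"
      proof (intro ballI impI)
        fix \<gamma>1 \<gamma>2 P P'
        assume A: "\<gamma>1 \<in> \<Gamma>" "\<gamma>2 \<in> \<Gamma>" "P \<in> HP" "P' \<in> HP" "side P (q a + v + fst \<gamma>1) = 0"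
          "side P' (q a + v + fst \<gamma>2) = 0"
        have "side P (q a + fst (\<gamma> + \<gamma>1)) = 0" "side P' (q a + fst (\<gamma> + \<gamma>2)) = 0"
          using A(5,6) by (auto simp: v_def add.assoc)
        then show "\<exists>l. fst P' = l *\<^sub>R fst P" using single A(1-4) add[OF g A(1)] add[OF g A(2)] by blast
      qed
      have qa: "q a \<in> O1" using qO a by blast
      have cl: "clear C L (q a)" "clear C L (q a + v)"
        using qa clear_same[OF generic_clear[OF gen(1)]] clear_same[OF generic_clear[OF gv]]
        unfolding O1_def by (auto simp: add.commute)
      have approach: "\<exists>x'. 0 \<le> x' \<and> x' \<le> 1 \<and> \<bar>x' - a\<bar> < \<delta>' \<and> norm (q x' - q a) < \<epsilon> \<and> generic (q x') \<and> g (q x') = g (q x)"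
        if x: "0 \<le> x" "x \<le> 1" "\<bar>x - a\<bar> < \<delta>'" "generic (q x)" and e: "\<epsilon> > 0" for x \<epsilon>
      proof -
        have xa: "x \<noteq> a" using x(4) False by auto
        define \<eta> where "\<eta> = min \<delta>' (\<epsilon> / (norm \<theta> + 1))"
        have eta: "\<eta> > 0" using d' e n1 by (simp add: \<eta>_def)
        obtain x' where x': "generic (q x')" "sgn (x' - a) = sgn (x - a)" "\<bar>x' - a\<bar> < \<eta>" "0 \<le> x'" "x' \<le> 1"
        proof (cases "x < a")
          case True
          obtain x' where x': "max x (a - \<eta>) < x'" "x' < a" "generic (q x')"
            using pick[of "max x (a - \<eta>)" a] True eta by auto
          show ?thesis using that[of x'] x' True x a by (auto simp: sgn_real_def)
        next
          case False
          then have "x > a" using xa by simp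
          obtain x' where x': "a < x'" "x' < min x (a + \<eta>)" "generic (q x')"
            using pick[of a "min x (a + \<eta>)"] \<open>x > a\<close> eta by auto
          show ?thesis using that[of x'] x' \<open>x > a\<close> x a by (auto simp: sgn_real_def)
        qed
        have "g (q x') = g (q x)"
          by (rule same_side) (use x x' in \<open>auto simp: \<eta>_def\<close>)
        moreover have "norm (q x' - q a) < \<epsilon>" using close[of x' \<epsilon>] x'(3) by (simp add: \<eta>_def)
        ultimately show ?thesis using x' by (auto simp: \<eta>_def)
      qed
      have "g (q x) = g (q y)"
        if xy: "0 \<le> x" "x \<le> 1" "0 \<le> y" "y \<le> 1" "\<bar>x - a\<bar> < \<delta>'" "\<bar>y - a\<bar> < \<delta>'"
          "generic (q x)" "generic (q y)" for x y
      proof -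
        have bound: "\<bar>g (q x) - g (q y)\<bar> \<le> e" if e: "e > 0" for e
        proof -
          have e2: "e / 2 > 0" using e by simp
          obtain \<epsilon>1 where e1: "\<epsilon>1 > 0" "\<forall>h k. generic h \<longrightarrow> generic k \<longrightarrow> norm (h - q a) < \<epsilon>1 \<longrightarrow>
              norm (k - q a) < \<epsilon>1 \<longrightarrow> \<bar>phi h - phi k\<bar> < e / 2"
            using nj OW(1)[OF qa] cl(1) e2 single unfolding no_jump_def by blast
          obtain \<epsilon>2 where e2: "\<epsilon>2 > 0" "\<forall>h k. generic h \<longrightarrow> generic k \<longrightarrow> norm (h - (q a + v)) < \<epsilon>2 \<longrightarrow>
              norm (k - (q a + v)) < \<epsilon>2 \<longrightarrow> \<bar>phi h - phi k\<bar> < e / 2"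
            using nj OW(2)[OF qa] cl(2) e2 single' unfolding no_jump_def by blast
          have m: "min \<epsilon>1 \<epsilon>2 > 0" using e1(1) e2(1) by simp
          obtain x' where x': "norm (q x' - q a) < min \<epsilon>1 \<epsilon>2" "generic (q x')" "g (q x') = g (q x)"
            using approach[OF xy(1,2,5,7) m] by blast
          obtain y' where y': "norm (q y' - q a) < min \<epsilon>1 \<epsilon>2" "generic (q y')" "g (q y') = g (q y)"
            using approach[OF xy(3,4,6,8) m] by blast
          have "\<bar>phi (q x') - phi (q y')\<bar> < e / 2" using e1(2) x' y' by simp
          moreover have "generic (q x' + v)" "generic (q y' + v)"
            using generic_shift[OF x'(2) g] generic_shift[OF y'(2) g] by (simp_all add: v_def)
          then have "\<bar>phi (q x' + v) - phi (q y' + v)\<bar> < e / 2" using e2(2) x'(1) y'(1) by simp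
          ultimately have "\<bar>g (q x') - g (q y')\<bar> < e" unfolding g_def by linarith
          then show ?thesis using x' y' by simp
        qed
        then have "g (q x) - g (q y) = 0" by (metis abs_le_zero_iff dense_ge)
        then show ?thesis by simp
      qed
      then show ?thesis using d' by blast
    qed
  qed
  have "g (q 1) = g h"
  proof (rule connected_induction[where S = "{0..1}" and P = "\<lambda>t. generic (q t)" and Q = "\<lambda>t. g (q t) = g h" and a = 0 and b = 1])
    show "connected {0..1::real}" by simp
    show "\<exists>t. t \<in> T \<and> generic (q t)" if T: "openin (top_of_set {0..1}) T" and z: "z \<in> T" for T z
    proof -
      have z01: "0 \<le> z" "z \<le> 1" using openin_imp_subset[OF T(1)] z by auto
      obtain e where e: "e > 0" "ball z e \<inter> {0..1} \<subseteq> T"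
        using T(1) z unfolding openin_contains_ball by blast
      have "max 0 (z - e) < min 1 (z + e)" using e(1) z01 by auto
      then obtain t where t: "max 0 (z - e) < t" "t < min 1 (z + e)" "generic (q t)" using pick by blast
      then have "t \<in> T" using e(2) by (auto simp: dist_real_def subset_iff)
      then show ?thesis using t(3) by blast
    qed
    show "\<exists>T. openin (top_of_set {0..1}) T \<and> a \<in> T \<and>
        (\<forall>x\<in>T. \<forall>y\<in>T. generic (q x) \<and> generic (q y) \<and> g (q x) = g h \<longrightarrow> g (q y) = g h)"
      if a: "a \<in> {0..1}" for a
    proof -
      obtain \<delta> where d: "\<delta> > 0" "\<forall>x y. 0 \<le> x \<longrightarrow> x \<le> 1 \<longrightarrow> 0 \<le> y \<longrightarrow> y \<le> 1 \<longrightarrow> \<bar>x - a\<bar> < \<delta> \<longrightarrow>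
          \<bar>y - a\<bar> < \<delta> \<longrightarrow> generic (q x) \<longrightarrow> generic (q y) \<longrightarrow> g (q x) = g (q y)"
        using local a by (metis atLeastAtMost_iff)
      have "openin (top_of_set {0..1}) ({0..1} \<inter> ball a \<delta>)" by (intro openin_open_Int open_ball)
      moreover have "g (q y) = g h"
        if "x \<in> {0..1} \<inter> ball a \<delta>" "y \<in> {0..1} \<inter> ball a \<delta>" "generic (q x)" "generic (q y)" "g (q x) = g h" for x y
      proof -
        have "\<bar>x - a\<bar> < \<delta>" "\<bar>y - a\<bar> < \<delta>" "0 \<le> x" "x \<le> 1" "0 \<le> y" "y \<le> 1"
          using that(1,2) by (simp_all add: dist_real_def abs_minus_commute)
        then have "g (q x) = g (q y)" using d(2) that(3,4) by blast
        then show ?thesis using that(5) by simp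
      qed
      ultimately show ?thesis using a d(1) by (intro exI[of _ "{0..1} \<inter> ball a \<delta>"]) auto
    qed
  qed (use gen gen2 in \<open>auto simp: q_def \<theta>_def\<close>)
  moreover have "g h' = g h2"
  proof (rule g_same)
    show "same C0 L' h' h2" using d1(2) h2(1) by simp
  qed (use gen gen2 O1 h2O in auto)
  ultimately show ?thesis by (simp add: g_def v_def q_def \<theta>_def)
qed

lemma generic_near:
  assumes "\<delta> > 0"
  obtains k where "norm (k - h) < \<delta>" "generic k"
proof -
  define S where "S = (\<lambda>(\<gamma>, P). (fst P, snd P - fst P \<bullet> fst \<gamma>)) ` (\<Gamma> \<times> HP)"
  have cS: "countable S" unfolding S_def
    using countable_Gamma HP_fin by (simp add: countable_finite)
  have nzS: "\<forall>i\<in>S. fst i \<noteq> 0" using HP_nz unfolding S_def by auto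
  obtain k where k: "norm (k - h) < \<delta>" "\<forall>i\<in>S. fst i \<bullet> k \<noteq> snd i"
    by (rule ball_avoids_hyperplanes[OF cS nzS assms])
  have "generic k" unfolding generic_def side_zero_iff
  proof (intro ballI notI)
    fix \<gamma> P assume i: "\<gamma> \<in> \<Gamma>" "P \<in> HP" and eq: "fst P \<bullet> (k + fst \<gamma>) = snd P"
    have "(fst P, snd P - fst P \<bullet> fst \<gamma>) \<in> S" unfolding S_def using i by force
    then have "fst P \<bullet> k \<noteq> snd P - fst P \<bullet> fst \<gamma>" using k(2) by force
    then show False using eq by (simp add: inner_add_right algebra_simps)
  qed
  then show ?thesis using that k(1) by blast
qed

lemma finite_cells:
  "finite ((\<lambda>h. \<lambda>i\<in>U C L \<times> HP. side (snd i) (h + fst (fst i))) ` A)"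
proof -
  have side: "side P h \<in> {-1, 0, 1}" for P and h :: 'h
    by (auto simp: side_def sgn_real_def)
  have "(\<lambda>h. \<lambda>i\<in>U C L \<times> HP. side (snd i) (h + fst (fst i))) ` A
      \<subseteq> (U C L \<times> HP) \<rightarrow>\<^sub>E {-1, 0, 1}"
  proof (intro image_subsetI PiE_I)
    fix h and i :: "('h \<times> 'a) \<times> 'h \<times> real" assume "i \<in> U C L \<times> HP"
    then show "(\<lambda>i\<in>U C L \<times> HP. side (snd i) (h + fst (fst i))) i \<in> {-1, 0, 1}"
      using side[of "snd i" "h + fst (fst i)"] by (simp only: restrict_apply if_True simp_thms)
  next
    fix h and i :: "('h \<times> 'a) \<times> 'h \<times> real" assume "i \<notin> U C L \<times> HP"
    then show "(\<lambda>i\<in>U C L \<times> HP. side (snd i) (h + fst (fst i))) i = undefined"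
      by (simp only: restrict_apply if_False simp_thms)
  qed
  moreover have "finite ((U C L \<times> HP) \<rightarrow>\<^sub>E {-1, 0, 1 :: real})"
    by (intro finite_PiE finite_cartesian_product U_finite HP_fin) simp
  ultimately show ?thesis by (rule finite_subset)
qed

text \<open>
  Constancy of the increments on cells makes the increments of \<open>phi\<close> at a generic point \<open>h0\<close> additive for
  small lattice translations, hence given by a vector \<open>l\<close>, and translates this to all generic points of the
  form \<open>h0 + fst \<gamma>\<close>: there \<open>phi h - l \<bullet> h\<close> does not change under small steps that stay in a cell. Cells are
  convex, so any two such points of one cell are joined by steps of this kind.
\<close>

theorem finite_values_minus_linear:
  "\<exists>l. finite ((\<lambda>x. F x - l \<bullet> s x) ` M)"
proof -
  obtain C L where nj: "no_jump C L" using no_jump_exists by blast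
  have CL: "C \<ge> 0" "L \<ge> 0" using nj C0_nonneg unfolding no_jump_def by auto
  obtain w0 where w0: "w0 \<in> interior W" using W_int by blast
  obtain e0 where e0: "e0 > 0" "ball w0 e0 \<subseteq> interior W" using w0 open_interior openE by blast
  obtain h0 where h0: "norm (h0 - w0) < e0" "generic h0" using generic_near[OF e0(1)] by blast
  have h0W: "h0 \<in> interior W" using h0(1) e0(2) by (auto simp: dist_norm norm_minus_commute subset_iff)
  define G where "G = fst ` \<Gamma>"
  have G: "\<And>u v. u \<in> G \<Longrightarrow> v \<in> G \<Longrightarrow> u + v \<in> G" "\<And>u. u \<in> G \<Longrightarrow> - u \<in> G" "0 \<in> G"
    unfolding G_def using add minus zero by (force simp flip: fst_add fst_uminus)+
  define Lam where "Lam = {h0 + u |u. u \<in> G \<and> h0 + u \<in> interior W}"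
  have gen: "generic k" if "k \<in> Lam" for k
    using that generic_shift[OF h0(2)] unfolding Lam_def G_def by auto
  have Lam_add: "k + u \<in> Lam" if "k \<in> Lam" "u \<in> G" "k + u \<in> interior W" for k u
    using that G(1) unfolding Lam_def by (auto simp: add.assoc)
  have Lam_diff: "k - k' \<in> G" if kk: "k \<in> Lam" "k' \<in> Lam" for k k'
  proof -
    obtain u where u: "k = h0 + u" "u \<in> G" using kk(1) unfolding Lam_def by auto
    obtain u' where u': "k' = h0 + u'" "u' \<in> G" using kk(2) unfolding Lam_def by auto
    have "u + - u' \<in> G" using G(1)[OF u(2) G(2)[OF u'(2)]] .
    then show ?thesis using u u' by simp
  qed
  have LamW: "k \<in> interior W" if "k \<in> Lam" for k using that unfolding Lam_def by blast
  have h0L: "h0 \<in> Lam" using h0W G(3) unfolding Lam_def by force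
  have incr: "phi (k + u) - phi k = phi (k' + u) - phi k'"
    if "k \<in> Lam" "k' \<in> Lam" "u \<in> G" "k + u \<in> interior W" "same C L k k'" "same C L (k + u) (k' + u)" for k k' u
  proof -
    obtain \<gamma> where "\<gamma> \<in> \<Gamma>" "u = fst \<gamma>" using \<open>u \<in> G\<close> unfolding G_def by blast
    then show ?thesis using increment_constant[OF nj gen gen LamW] that by blast
  qed
  obtain r where r: "r > 0" "\<And>k. norm (k - h0) < r \<Longrightarrow> same C L h0 k"
    using cell_ball[OF generic_clear[OF h0(2)]] by blast
  have rW: "k \<in> interior W" if "norm (k - h0) < r" for k
    using same_interior[OF r(2)[OF that] generic_clear[OF h0(2)] _ CL] h0W interior_subset by blast
  define c where "c u = phi (h0 + u) - phi h0" for u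
  have c_add: "c (u + v) = c u + c v"
    if "u \<in> G" "v \<in> G" "norm u < r" "norm v < r" "norm (u + v) < r" for u v
  proof -
    have in_Lam: "h0 + x \<in> Lam" if "x \<in> G" "norm x < r" for x
      using Lam_add[OF h0L that(1)] rW[of "h0 + x"] that(2) by simp
    have s: "same C L h0 (h0 + x)" if "norm x < r" for x using r(2)[of "h0 + x"] that by simp
    have "phi (h0 + u) - phi h0 = phi (h0 + v + u) - phi (h0 + v)"
    proof (rule incr)
      show "same C L (h0 + u) (h0 + v + u)"
        using s[OF that(3)] s[OF that(5)] same_sym same_trans by (metis add.assoc add.commute)
    qed (use h0L in_Lam that s LamW in auto)
    then show ?thesis unfolding c_def by (simp add: algebra_simps)
  qed
  obtain K1 where K1: "K1 \<ge> 0" "\<And>h k. generic h \<Longrightarrow> generic k \<Longrightarrow> h \<in> interior W \<Longrightarrow> k \<in> interior W \<Longrightarrow>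
    same C0 K1 h k \<Longrightarrow> \<bar>phi h - phi k\<bar> < 1" using phi_same[of 1] by auto
  obtain r1 where r1: "r1 > 0" "\<And>k. norm (k - h0) < r1 \<Longrightarrow> same C0 K1 h0 k"
    using cell_ball[OF generic_clear[OF h0(2)]] by blast
  define r2 where "r2 = min r r1"
  have c_bound: "\<bar>c u\<bar> \<le> 1" if "u \<in> G" "norm u < r2" for u
  proof -
    have "h0 + u \<in> interior W" using rW[of "h0 + u"] that(2) by (simp add: r2_def)
    moreover from this have "generic (h0 + u)" using gen Lam_add[OF h0L that(1)] by blast
    moreover have "same C0 K1 h0 (h0 + u)" using r1(2)[of "h0 + u"] that(2) by (simp add: r2_def)
    ultimately have "\<bar>phi h0 - phi (h0 + u)\<bar> < 1" using K1(2)[OF h0(2) _ h0W] by blast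
    then show ?thesis by (simp add: c_def)
  qed
  have "r2 > 0" using r(1) r1(1) by (simp add: r2_def)
  then obtain l r' where l: "r' > 0" "\<forall>v\<in>G. norm v < r' \<longrightarrow> c v = l \<bullet> v"
    using locally_additive_imp_linear[of G r2 c 1, OF G _ _ _ c_bound] dense c_add
    unfolding G_def r2_def by auto
  define r3 where "r3 = min r r'"
  have r3: "r3 > 0" using r(1) l(1) by (simp add: r3_def)
  define \<psi> where "\<psi> k = phi k - l \<bullet> k" for k
  have small: "\<psi> (k + v) = \<psi> k"
    if k: "k \<in> Lam" "k + v \<in> Lam" "v \<in> G" "norm v < r3" "same C L k (k + v)" for k v
  proof -
    have hv: "norm ((h0 + v) - h0) < r" using k(4) by (simp add: r3_def)
    have hvL: "h0 + v \<in> Lam" using Lam_add[OF h0L k(3) rW[OF hv]] .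
    \<comment> \<open>Translate the increment along \<open>v\<close> from \<open>h0\<close> to \<open>k\<close>.\<close>
    have "phi (h0 + (k - h0)) - phi h0 = phi (h0 + v + (k - h0)) - phi (h0 + v)"
    proof (rule incr)
      show "k - h0 \<in> G" using Lam_diff k(1) h0L by blast
      show "same C L (h0 + (k - h0)) (h0 + v + (k - h0))" using k(5) by (simp add: algebra_simps)
    qed (use h0L hvL r(2)[OF hv] LamW k(1) in auto)
    then have "phi (k + v) - phi k = c v" unfolding c_def by (simp add: algebra_simps)
    also have "\<dots> = l \<bullet> v" using l(2) k(3,4) by (simp add: r3_def)
    finally show ?thesis by (simp add: \<psi>_def inner_add_right)
  qed
  have cell: "\<psi> k = \<psi> k'" if k: "k \<in> Lam" "k' \<in> Lam" "same C L k k'" for k k'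
  proof -
    define Q where "Q = {z. same C L k z}"
    have Q: "open Q" "convex Q" unfolding Q_def
      using open_cell convex_cell generic_clear gen[OF k(1)] by blast+
    have kQ: "k \<in> Q" "k' \<in> Q" using k(3) unfolding Q_def by (auto simp: same_def)
    have "closed_segment k k' \<subseteq> Q" using kQ Q(2) by (simp add: closed_segment_subset)
    then obtain \<epsilon> where eps: "\<epsilon> > 0" "(\<Union>z\<in>closed_segment k k'. ball z \<epsilon>) \<subseteq> Q"
      using compact_subset_open_imp_ball_epsilon_subset[OF compact_segment Q(1)] by blast
    have QW: "z \<in> interior W" if "z \<in> Q" for z
      using same_interior[OF _ generic_clear[OF gen[OF k(1)]] _ CL] that LamW[OF k(1)] interior_subset
      unfolding Q_def by blast
    obtain N0 :: nat where N0: "norm (k' - k) / (r3 / 2) < real N0" using reals_Archimedean2 by blast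
    define N where "N = Suc N0"
    have N: "real N > 0" "norm (k' - k) / real N < r3 / 2"
    proof -
      show "real N > 0" by (simp add: N_def)
      have "norm (k' - k) / (r3 / 2) < real N" using N0 by (simp add: N_def)
      then show "norm (k' - k) / real N < r3 / 2" using r3 \<open>real N > 0\<close> by (simp add: field_simps)
    qed
    \<comment> \<open>The step \<open>v\<close> has to approximate \<open>(k' - k) / N\<close> so well that \<open>N\<close> steps stay close to the segment and
        end at a point whose distance from \<open>k'\<close> is again a short step.\<close>
    define \<eta> where "\<eta> = min (\<epsilon> / real N) (r3 / (2 * real N))"
    have eta: "\<eta> > 0" using eps(1) r3 N(1) by (simp add: \<eta>_def)
    have "(1 / real N) *\<^sub>R (k' - k) \<in> closure G" using dense by (simp add: G_def)
    then obtain v where v: "v \<in> G" "dist v ((1 / real N) *\<^sub>R (k' - k)) < \<eta>"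
      using closure_approachable eta by blast
    define w where "w = v - (1 / real N) *\<^sub>R (k' - k)"
    have nw: "norm w < \<eta>" using v(2) by (simp add: w_def dist_norm)
    have jQ: "k + real j *\<^sub>R v \<in> Q" if "j \<le> N" for j
    proof -
      have t: "real j / real N \<in> {0..1}" using that N(1) by simp
      have seg: "k + (real j / real N) *\<^sub>R (k' - k) \<in> closed_segment k k'"
        unfolding in_segment using t by (intro exI[of _ "real j / real N"]) (auto simp: algebra_simps)
      have eq: "k + real j *\<^sub>R v = k + (real j / real N) *\<^sub>R (k' - k) + real j *\<^sub>R w"
        by (simp add: w_def scaleR_diff_right)
      have "norm (real j *\<^sub>R w) < \<epsilon>"
      proof -
        have "norm (real j *\<^sub>R w) = real j * norm w" by simp
        also have "\<dots> \<le> real N * norm w" using that by (intro mult_right_mono) auto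
        also have "\<dots> < real N * \<eta>" using nw N(1) by simp
        also have "\<dots> \<le> real N * (\<epsilon> / real N)" using N(1) by (intro mult_left_mono) (auto simp: \<eta>_def)
        finally show ?thesis using N(1) by simp
      qed
      then have "k + real j *\<^sub>R v \<in> ball (k + (real j / real N) *\<^sub>R (k' - k)) \<epsilon>"
        unfolding eq by (simp add: dist_norm)
      then show ?thesis using eps(2) seg by blast
    qed
    have GN: "real j *\<^sub>R v \<in> G" for j
      by (rule subgroup_of_nat_scale) (use G v(1) in \<open>auto, metis diff_conv_add_uminus\<close>)
    have jL: "k + real j *\<^sub>R v \<in> Lam" if "j \<le> N" for j
      using Lam_add[OF k(1) GN] QW[OF jQ[OF that]] by blast
    have nv: "norm v < r3"
    proof -
      have "real N \<ge> 1" by (simp add: N_def)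
      then have "r3 / (2 * real N) \<le> r3 / 2" using r3 by (simp add: field_simps)
      moreover have "norm v \<le> norm w + norm ((1 / real N) *\<^sub>R (k' - k))"
        using norm_triangle_ineq[of w "(1 / real N) *\<^sub>R (k' - k)"] by (simp add: w_def)
      moreover have "norm ((1 / real N) *\<^sub>R (k' - k)) < r3 / 2" using N by simp
      moreover have "norm w < r3 / (2 * real N)" using nw by (simp add: \<eta>_def)
      ultimately show ?thesis by linarith
    qed
    have chain: "\<psi> (k + real j *\<^sub>R v) = \<psi> k" if "j \<le> N" for j
      using that
    proof (induction j)
      case (Suc j)
      have e: "k + real (Suc j) *\<^sub>R v = (k + real j *\<^sub>R v) + v" by (simp add: algebra_simps)
      have "\<psi> ((k + real j *\<^sub>R v) + v) = \<psi> (k + real j *\<^sub>R v)"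
      proof (rule small)
        show "same C L (k + real j *\<^sub>R v) (k + real j *\<^sub>R v + v)"
          using jQ[of j] jQ[of "Suc j"] Suc.prems same_sym same_trans unfolding Q_def e
          by (metis Suc_leD mem_Collect_eq)
        show "k + real j *\<^sub>R v \<in> Lam" "k + real j *\<^sub>R v + v \<in> Lam"
          using jL[of j] jL[of "Suc j"] Suc.prems unfolding e by auto
      qed (use v(1) nv in auto)
      then show ?case using Suc unfolding e by simp
    qed simp
    define k2 where "k2 = k + real N *\<^sub>R v"
    have k2: "k2 \<in> Lam" "\<psi> k2 = \<psi> k" "same C L k k2"
      using jL[of N] chain[of N] jQ[of N] by (auto simp: k2_def Q_def)
    have "norm (k' - k2) < r3"
    proof -
      have "k2 - k' = real N *\<^sub>R w"
        using N(1) by (simp add: k2_def w_def scaleR_diff_right algebra_simps)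
      then have "norm (k' - k2) = real N * norm w" using N(1) by (metis norm_minus_commute norm_scaleR abs_of_pos)
      also have "\<dots> < real N * \<eta>" using nw N(1) by simp
      also have "\<dots> \<le> real N * (r3 / (2 * real N))" using N(1) by (intro mult_left_mono) (auto simp: \<eta>_def)
      also have "\<dots> < r3" using N(1) r3 by simp
      finally show ?thesis .
    qed
    then have "\<psi> (k2 + (k' - k2)) = \<psi> k2"
      using small[of k2 "k' - k2"] k2 k Lam_diff same_sym same_trans by (metis add.commute diff_add_cancel)
    then show ?thesis using k2(2) by simp
  qed
  define code where "code h = (\<lambda>i\<in>U C L \<times> HP. side (snd i) (h + fst (fst i)))" for h
  have code: "same C L h k" if "code h = code k" for h k
    unfolding same_def
  proof (intro ballI)
    fix \<gamma> P assume "\<gamma> \<in> U C L" "P \<in> HP"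
    then show "side P (h + fst \<gamma>) = side P (k + fst \<gamma>)"
      using fun_cong[OF that, of "(\<gamma>, P)"] by (simp add: code_def)
  qed
  have "finite (code ` Lam)" unfolding code_def by (rule finite_cells)
  moreover have "\<psi> k = \<psi> (inv_into Lam code (code k))" if "k \<in> Lam" for k
    using cell[OF that inv_into_into[OF imageI[OF that]] code] f_inv_into_f[OF imageI[OF that]] by metis
  then have "\<psi> ` Lam \<subseteq> (\<lambda>z. \<psi> (inv_into Lam code z)) ` (code ` Lam)" by blast
  ultimately have fin\<psi>: "finite (\<psi> ` Lam)" by (meson finite_imageI finite_subset)
  have "F x - l \<bullet> s x \<in> \<psi> ` Lam" if x: "x \<in> M" for x
  proof -
    have "\<exists>y\<in>\<psi> ` Lam. dist y (F x - l \<bullet> s x) < e" if e: "e > 0" for e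
    proof -
      define e1 where "e1 = e / (3 + 2 * norm l)"
      have pos: "3 + 2 * norm l > 0" by (simp add: add_pos_nonneg)
      have e1: "e1 > 0" using e pos by (simp add: e1_def)
      obtain K where K: "K \<ge> 0"
          "\<And>x y. x \<in> M \<Longrightarrow> y \<in> M \<Longrightarrow> agree K (shift M x) (shift M y) \<Longrightarrow> \<bar>F x - F y\<bar> < e1"
        using unif_nonneg[OF e1] by blast
      obtain h \<delta> where hd: "h \<in> interior W" "\<delta> > 0"
        "\<forall>y\<in>M. norm (s y - h) < \<delta> \<longrightarrow> agree K (shift M x) (shift M y) \<and> norm (s y - s x) < e1"
        using patches[OF x e1] by blast
      obtain d where d: "d > 0" "ball h d \<subseteq> interior W" using hd(1) open_interior openE by blast
      have "h - h0 \<in> closure G" using dense by (simp add: G_def)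
      moreover have "min d (\<delta> / 2) > 0" using d hd by simp
      ultimately obtain u where u: "u \<in> G" "dist u (h - h0) < min d (\<delta> / 2)"
        using closure_approachable by blast
      define k where "k = h0 + u"
      have kh: "norm (k - h) < min d (\<delta> / 2)" using u(2) by (simp add: k_def dist_norm algebra_simps)
      then have "k \<in> interior W" using d(2) by (auto simp: dist_norm norm_minus_commute subset_iff)
      then have kL: "k \<in> Lam" using u(1) unfolding Lam_def k_def by blast
      have m: "min (\<delta> / 2) e1 > 0" using hd(2) e1 by simp
      obtain y where y: "y \<in> M" "\<bar>F y - phi k\<bar> < e1" "norm (s y - k) < min (\<delta> / 2) e1"
        using phi_point[OF gen[OF kL] LamW[OF kL] e1 m] by blast
      have "norm (s y - h) < \<delta>" using norm_triangle_ineq[of "s y - k" "k - h"] y(3) kh by simp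
      then have ag: "agree K (shift M x) (shift M y)" "norm (s y - s x) < e1" using hd(3) y(1) by auto
      have "\<bar>F x - F y\<bar> < e1" using K(2) x y(1) ag(1) by blast
      moreover have "\<bar>l \<bullet> (k - s x)\<bar> \<le> norm l * (2 * e1)"
      proof -
        have "norm (k - s x) \<le> norm (s y - s x) + norm (s y - k)"
          using norm_triangle_ineq4[of "s y - s x" "s y - k"] by simp
        then have "norm (k - s x) \<le> 2 * e1" using ag(2) y(3) by simp
        then show ?thesis using Cauchy_Schwarz_ineq2[of l "k - s x"] mult_left_mono[of "norm (k - s x)" "2 * e1" "norm l"]
          by simp
      qed
      ultimately have "\<bar>\<psi> k - (F x - l \<bullet> s x)\<bar> < 2 * e1 + norm l * (2 * e1)"
        using y(2) unfolding \<psi>_def inner_diff_right by linarith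
      also have "\<dots> < (3 + 2 * norm l) * e1" using e1 by (simp add: algebra_simps)
      also have "\<dots> = e" using pos by (simp add: e1_def)
      finally show ?thesis using kL unfolding dist_real_def by blast
    qed
    then have "F x - l \<bullet> s x \<in> closure (\<psi> ` Lam)" unfolding closure_approachable by blast
    then show ?thesis using finite_imp_closed[OF fin\<psi>] by simp
  qed
  then have "(\<lambda>x. F x - l \<bullet> s x) ` M \<subseteq> \<psi> ` Lam" by blast
  then show ?thesis using fin\<psi> finite_subset by blast
qed

end

section \<open>Analytic classes of polyhedral model sets\<close>

text \<open>
  A point that satisfies the finitely many inequalities of a polytope strictly is an interior point.
\<close>

lemma polytope_walls:
  fixes C :: "'h::euclidean_space set"
  assumes "polytope C"
  shows "\<exists>HP. finite HP \<and> (\<forall>P\<in>HP. fst P \<noteq> 0) \<and> (\<forall>h\<in>frontier C. \<exists>P\<in>HP. fst P \<bullet> h = (snd P :: real))"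
proof -
  have cl: "closed C" using assms by (rule polytope_imp_closed)
  obtain \<H> where H: "finite \<H>" "C = \<Inter>\<H>" "\<forall>h\<in>\<H>. \<exists>a b. a \<noteq> 0 \<and> h = {x. a \<bullet> x \<le> b}"
    using polytope_imp_polyhedron[OF assms] unfolding polyhedron_def by blast
  have "\<forall>h\<in>\<H>. \<exists>P. fst P \<noteq> 0 \<and> h = {x. fst P \<bullet> x \<le> snd P}"
    using H(3) by (metis fst_conv snd_conv)
  from bchoice[OF this] obtain p where p: "\<forall>h\<in>\<H>. fst (p h) \<noteq> 0 \<and> h = {x. fst (p h) \<bullet> x \<le> snd (p h)}" ..
  have "\<exists>P\<in>p ` \<H>. fst P \<bullet> x = snd P" if x: "x \<in> frontier C" for x
  proof (rule ccontr)
    assume no: "\<not> ?thesis"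
    have xC: "x \<in> C" "x \<notin> interior C" using x cl by (auto simp: frontier_def closure_closed)
    have lt: "fst (p h) \<bullet> x < snd (p h)" if "h \<in> \<H>" for h
    proof -
      have "x \<in> {x. fst (p h) \<bullet> x \<le> snd (p h)}" using xC(1) H(2) that p by blast
      moreover have "fst (p h) \<bullet> x \<noteq> snd (p h)" using no that by blast
      ultimately show ?thesis by simp
    qed
    define S where "S = (\<Inter>h\<in>\<H>. {x. fst (p h) \<bullet> x < snd (p h)})"
    have "open S" unfolding S_def by (intro open_INT H(1) ballI open_halfspace_lt)
    moreover have "S \<subseteq> C"
    proof
      fix y assume y: "y \<in> S"
      have "y \<in> h" if h: "h \<in> \<H>" for h
      proof -
        have "fst (p h) \<bullet> y < snd (p h)" using y h unfolding S_def by blast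
        then have "y \<in> {x. fst (p h) \<bullet> x \<le> snd (p h)}" by simp
        then show ?thesis using p h by blast
      qed
      then show "y \<in> C" using H(2) by blast
    qed
    moreover have "x \<in> S" unfolding S_def using lt by blast
    ultimately have "x \<in> interior C" using interior_maximal by blast
    then show False using xC(2) by blast
  qed
  then show ?thesis using H(1) p by (intro exI[of _ "p ` \<H>"]) auto
qed

lemma union_walls:
  fixes \<C> :: "'h::euclidean_space set set"
  assumes "finite \<C>" "\<And>C. C \<in> \<C> \<Longrightarrow>
    \<exists>HP. finite HP \<and> (\<forall>P\<in>HP. fst P \<noteq> 0) \<and> (\<forall>h\<in>frontier C. \<exists>P\<in>HP. fst P \<bullet> h = (snd P :: real))"
  shows "\<exists>HP. finite HP \<and> (\<forall>P\<in>HP. fst P \<noteq> 0) \<and> (\<forall>h\<in>frontier (\<Union>\<C>). \<exists>P\<in>HP. fst P \<bullet> h = (snd P :: real))"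
proof -
  have "\<forall>C\<in>\<C>. \<exists>HP. finite HP \<and> (\<forall>P\<in>HP. fst P \<noteq> 0) \<and> (\<forall>h\<in>frontier C. \<exists>P\<in>HP. fst P \<bullet> h = (snd P :: real))"
    using assms(2) by blast
  from bchoice[OF this] obtain f where f: "\<forall>C\<in>\<C>. finite (f C) \<and> (\<forall>P\<in>f C. fst P \<noteq> 0) \<and>
    (\<forall>h\<in>frontier C. \<exists>P\<in>f C. fst P \<bullet> h = (snd P :: real))" ..
  have "frontier (\<Union>\<C>) \<subseteq> (\<Union>C\<in>\<C>. frontier C)" by (rule frontier_Union_subset[OF assms(1)])
  then show ?thesis using f assms(1) by (intro exI[of _ "\<Union>(f ` \<C>)"]) fastforce
qed

lemma polyhedral_window_walls:
  fixes W :: "'h::euclidean_space set"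
  assumes "polyhedral_window W"
  shows "\<exists>HP. finite HP \<and> (\<forall>P\<in>HP. fst P \<noteq> 0) \<and> (\<forall>h\<in>frontier W. \<exists>P\<in>HP. fst P \<bullet> h = (snd P :: real))"
proof -
  obtain \<P> where P: "finite \<P>" "\<forall>P\<in>\<P>. solid_polyhedron P" "W = \<Union>\<P>"
    using assms[unfolded polyhedral_window_def] by (elim exE conjE) (rule that)
  have "\<exists>HP. finite HP \<and> (\<forall>P\<in>HP. fst P \<noteq> 0) \<and> (\<forall>h\<in>frontier S. \<exists>P\<in>HP. fst P \<bullet> h = (snd P :: real))"
    if S: "S \<in> \<P>" for S
  proof -
    obtain \<C> where C: "finite \<C>" "\<forall>C\<in>\<C>. polytope C" "S = \<Union>\<C>"
      using bspec[OF P(2) S, unfolded solid_polyhedron_def] by (elim exE conjE) (rule that)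
    show ?thesis unfolding C(3)
      by (rule union_walls[OF C(1)], rule polytope_walls, rule bspec[OF C(2)])
  qed
  from union_walls[OF P(1) this] show ?thesis unfolding P(3) .
qed

lemma spe_scaled_sum:
  fixes G :: "nat \<Rightarrow> 'a::real_normed_vector \<Rightarrow> real"
  assumes "\<forall>k<m. spe M M (G k)"
  shows "spe M M (\<lambda>x. \<Sum>k<m. r k * G k x)"
  using assms
proof (induction m)
  case 0
  show ?case using spe_zero by simp
next
  case (Suc m)
  have "spe M M (\<lambda>x. r m * G m x)" using Suc.prems unfolding spe_def by (metis lessI)
  moreover have "spe M M (\<lambda>x. \<Sum>k<m. r k * G k x)" using Suc by simp
  ultimately show ?case using spe_add by fastforce
qed

context scheme
begin

lemma star_model:
  assumes M: "M \<in> window_hull \<Gamma> W" and poly: "polyhedral_window W"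
  shows "\<exists>HP C0. star_model \<Gamma> W M (star M) HP C0"
proof -
  obtain z where z: "rel z M" using window_hull_rel(2)[OF M] by blast
  obtain C where C: "C > 0" "\<And>w. w \<in> W \<Longrightarrow> norm w \<le> C" using W_bound by blast
  obtain HP :: "('h \<times> real) set" where HP: "finite HP" "\<forall>P\<in>HP. fst P \<noteq> 0"
    "\<forall>h\<in>frontier W. \<exists>P\<in>HP. fst P \<bullet> h = snd P"
    using polyhedral_window_walls[OF poly] by blast
  have "star_model \<Gamma> W M (star M) HP (2 * C)"
  proof
    show "finite {\<gamma> \<in> \<Gamma>. norm (fst \<gamma>) \<le> C' \<and> norm (snd \<gamma>) \<le> L}" for C' L
    proof -
      have "{\<gamma> \<in> \<Gamma>. norm (fst \<gamma>) \<le> C' \<and> norm (snd \<gamma>) \<le> L} = \<Gamma> \<inter> (cball 0 C' \<times> cball 0 L)"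
        by (auto simp: mem_Times_iff)
      then show ?thesis
        by (simp only: lattice_finite_bounded[OF lat bounded_Times[OF bounded_cball bounded_cball]])
    qed
    show "norm (h - h') \<le> 2 * C" if "h \<in> W" "h' \<in> W" for h h'
      using norm_triangle_ineq4[of h h'] C(2)[OF that(1)] C(2)[OF that(2)] by linarith
    show "M \<noteq> {}" using delone_nonempty[OF window_hull_rel(1)[OF M]] .
    show "x + snd \<gamma> \<in> M \<and> star M (x + snd \<gamma>) = star M x + fst \<gamma>"
      if "x \<in> M" "\<gamma> \<in> \<Gamma>" "star M x + fst \<gamma> \<in> interior W" for x \<gamma>
      using star_interior[OF z that] by blast
    show "\<exists>P\<in>HP. fst P \<bullet> h = snd P" if "h \<in> frontier W" for h using HP(3) that by blast
    show "fst P \<noteq> 0" if "P \<in> HP" for P using HP(2) that by blast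
    show "star M x \<in> W" if "x \<in> M" for x using star_rel(2)[OF z that] .
    show "(star M y - star M x, y - x) \<in> \<Gamma>" if "x \<in> M" "y \<in> M" for x y using star_diff[OF z that] .
    show "x - y \<in> \<Gamma>" if "x \<in> \<Gamma>" "y \<in> \<Gamma>" for x y using diff[OF that] .
  qed (rule zero dense W_interior HP(1))+
  then show ?thesis by blast
qed

text \<open>
  The difference \<open>y - x\<close> alone determines the lattice vector over it, and hence the increment.
\<close>

lemma linear_star_spe2:
  assumes M: "M \<in> window_hull \<Gamma> W"
  shows "spe2 M (coboundary (\<lambda>x. l \<bullet> star M x))"
proof -
  obtain z where z: "rel z M" using window_hull_rel(2)[OF M] by blast
  obtain \<rho> where rho: "\<forall>z. M \<inter> ball z \<rho> \<noteq> {}"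
    using conjunct2[OF window_hull_rel(1)[OF M, unfolded delone_def]] by blast
  have eq: "coboundary (\<lambda>x. l \<bullet> star M x) x1 y1 = coboundary (\<lambda>x. l \<bullet> star M x) x2 y2"
    if xy: "x1 \<in> M" "y1 \<in> M" "x2 \<in> M" "y2 \<in> M" "y1 - x1 = y2 - x2" for x1 y1 x2 y2
  proof -
    have "(star M y1 - star M x1, y1 - x1) = (star M y2 - star M x2, y2 - x2)"
      by (rule inj_onD[OF inj _ star_diff[OF z xy(1,2)] star_diff[OF z xy(3,4)]]) (simp add: xy(5))
    then have "star M y1 - star M x1 = star M y2 - star M x2" unfolding prod.inject by (rule conjunct1)
    then show ?thesis unfolding coboundary_def inner_diff_right[symmetric] by (rule arg_cong)
  qed
  have "\<forall>z. M \<inter> ball z (3 * \<rho> / 3) \<noteq> {}" using rho by simp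
  then show ?thesis unfolding spe2_def
    by (intro exI[of _ "3 * \<rho>"] conjI exI[of _ 1] ballI impI) (assumption, rule zero_less_one, elim conjE, rule eq)
qed

text \<open>
  The remainder left by rigidity is uniformly pattern equivariant and has finitely many values.
\<close>

lemma wpe_decomposition:
  assumes M: "M \<in> window_hull \<Gamma> W" and poly: "polyhedral_window W"
    and F: "wpe M F" "spe2 M (coboundary F)"
  obtains l G where "spe M M G" "F = (\<lambda>x. l \<bullet> star M x + G x)"
proof -
  have dM: "delone M" by (rule window_hull_rel(1)[OF M])
  obtain z where z: "rel z M" using window_hull_rel(2)[OF M] by blast
  obtain HP C0 where "star_model \<Gamma> W M (star M) HP C0" using star_model[OF M poly] by blast
  then interpret star_model \<Gamma> W M "star M" HP C0 .
  obtain R0 R where R0: "\<forall>z. M \<inter> ball z (R0 / 3) \<noteq> {}" and R: "R > 0"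
    "\<forall>x1\<in>M. \<forall>y1\<in>M. \<forall>x2\<in>M. \<forall>y2\<in>M. norm (y1 - x1) \<le> R0 \<and> norm (y2 - x2) \<le> R0 \<and> y1 - x1 = y2 - x2 \<and>
          agree R (shift M x1) (shift M x2) \<longrightarrow> coboundary F x1 y1 = coboundary F x2 y2"
    using F(2) unfolding spe2_def by blast
  interpret rigid_function \<Gamma> W M "star M" HP C0 F R0 R
  proof
    show "\<exists>L. \<forall>x\<in>M. \<forall>y\<in>M. agree L (shift M x) (shift M y) \<longrightarrow> \<bar>F x - F y\<bar> < e" if "e > 0" for e
      using wpe_uniform[OF dM z F(1) that] unfolding dist_real_def .
    show "F y1 - F x1 = F y2 - F x2"
      if "x1 \<in> M" "y1 \<in> M" "x2 \<in> M" "y2 \<in> M" "norm (y1 - x1) \<le> R0" "y1 - x1 = y2 - x2"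
        "agree R (shift M x1) (shift M x2)" for x1 y1 x2 y2
    proof -
      have "norm (y2 - x2) \<le> R0" using that(5,6) by simp
      then have "coboundary F x1 y1 = coboundary F x2 y2" using R(2) that by blast
      then show ?thesis by (simp add: coboundary_def)
    qed
    show "M \<inter> ball z (R0 / 3) \<noteq> {}" for z using R0 by blast
    show "\<exists>h \<delta>. h \<in> interior W \<and> \<delta> > 0 \<and> (\<forall>y\<in>M. norm (star M y - h) < \<delta> \<longrightarrow>
        agree L (shift M x) (shift M y) \<and> norm (star M y - star M x) < e)" if "x \<in> M" "e > 0" for x L e
      by (rule patch_region[OF M that])
  qed (rule R(1))
  obtain l where l: "finite ((\<lambda>x. F x - l \<bullet> star M x) ` M)" using finite_values_minus_linear by blast
  have "spe M M (\<lambda>x. F x - l \<bullet> star M x)"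
  proof (rule spe_of_finite_values[OF _ l])
    fix e :: real assume "e > 0"
    then have e2: "e / 2 > 0" by simp
    have "wpe M (\<lambda>x. l \<bullet> star M x)" by (rule star_wpe[OF M]) (intro continuous_intros)
    from wpe_uniform[OF dM z this e2] obtain L1 where
      L1: "\<forall>x\<in>M. \<forall>y\<in>M. agree L1 (shift M x) (shift M y) \<longrightarrow> dist (l \<bullet> star M x) (l \<bullet> star M y) < e / 2" by blast
    from wpe_uniform[OF dM z F(1) e2] obtain L2 where
      L2: "\<forall>x\<in>M. \<forall>y\<in>M. agree L2 (shift M x) (shift M y) \<longrightarrow> dist (F x) (F y) < e / 2" by blast
    have "dist (F x - l \<bullet> star M x) (F y - l \<bullet> star M y) < e"
      if xy: "x \<in> M" "y \<in> M" "agree (max L1 L2) (shift M x) (shift M y)" for x y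
    proof -
      have "agree L1 (shift M x) (shift M y)" "agree L2 (shift M x) (shift M y)"
        using agree_mono[OF xy(3)] by simp_all
      then have "dist (l \<bullet> star M x) (l \<bullet> star M y) < e / 2" "dist (F x) (F y) < e / 2"
        using L1 L2 xy(1,2) by blast+
      then show ?thesis unfolding dist_real_def by linarith
    qed
    then show "\<exists>L. \<forall>x\<in>M. \<forall>y\<in>M. agree L (shift M x) (shift M y) \<longrightarrow>
        dist (F x - l \<bullet> star M x) (F y - l \<bullet> star M y) < e" by blast
  qed
  from that[OF this, of l] show ?thesis by simp
qed

definition star_class :: "'a set \<Rightarrow> 'h \<Rightarrow> ('a \<Rightarrow> 'a \<Rightarrow> real) set" where
  "star_class M l = coh_class M (on_edges M (coboundary (\<lambda>x. l \<bullet> star M x)))"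

lemma H1_an_eq:
  assumes M: "M \<in> window_hull \<Gamma> W" and poly: "polyhedral_window W"
  shows "H1_an M = range (star_class M)"
proof
  show "range (star_class M) \<subseteq> H1_an M"
  proof
    fix c assume "c \<in> range (star_class M)"
    then obtain l where c: "c = star_class M l" by blast
    have s: "spe2 M (coboundary (\<lambda>x. l \<bullet> star M x))" by (rule linear_star_spe2[OF M])
    have w: "wpe M (\<lambda>x. l \<bullet> star M x)" by (rule star_wpe[OF M]) (intro continuous_intros)
    have "c \<in> H1 M" unfolding H1_def c star_class_def by (rule imageI[OF coboundary_cocycle[OF s]])
    then show "c \<in> H1_an M" unfolding H1_an_def using s w c[unfolded star_class_def] by blast
  qed
  show "H1_an M \<subseteq> range (star_class M)"
  proof
    fix c assume "c \<in> H1_an M"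
    then obtain F where F: "wpe M F" "spe2 M (coboundary F)" "c = coh_class M (on_edges M (coboundary F))"
      unfolding H1_an_def by blast
    obtain l G where G: "spe M M G" "F = (\<lambda>x. l \<bullet> star M x + G x)"
      by (rule wpe_decomposition[OF M poly F(1,2)])
    have "c = star_class M l" unfolding F(3) star_class_def
    proof (rule coh_class_eqI[OF G(1)])
      show "on_edges M (coboundary F) x y =
          on_edges M (coboundary (\<lambda>x. l \<bullet> star M x)) x y + on_edges M (coboundary G) x y" for x y
        unfolding G(2) on_edges_def coboundary_def by simp
    qed
    then show "c \<in> range (star_class M)" by blast
  qed
qed

text \<open>
  If the classes of \<open>l\<close> and \<open>l'\<close> coincide, then \<open>m \<bullet> star M\<close> for \<open>m = l - l'\<close> differs from a strongly pattern
  equivariant function by a constant, as the dual graph is connected. So it has finitely many values.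
  Since the stars are dense in the interior of the window, \<open>m\<close> has finitely many values on an open set.
\<close>

lemma star_class_inj:
  assumes M: "M \<in> window_hull \<Gamma> W" and poly: "polyhedral_window W"
  shows "inj (star_class M)"
proof (rule injI)
  fix l l' assume eq: "star_class M l = star_class M l'"
  have dM: "delone M" by (rule window_hull_rel(1)[OF M])
  obtain z where z: "rel z M" using window_hull_rel(2)[OF M] by blast
  obtain HP C0 where "star_model \<Gamma> W M (star M) HP C0" using star_model[OF M poly] by blast
  then interpret star_model \<Gamma> W M "star M" HP C0 .
  obtain G where G: "spe M M G" "on_edges M (coboundary (\<lambda>x. l \<bullet> star M x)) =
      (\<lambda>x y. on_edges M (coboundary (\<lambda>x. l' \<bullet> star M x)) x y + on_edges M (coboundary G) x y)"
    using eq unfolding star_class_def by (rule coh_class_eqD)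
  define m where "m = l - l'"
  have const: "m \<bullet> star M x - G x = m \<bullet> star M y - G y" if xy: "x \<in> M" "y \<in> M" for x y
  proof (rule constant_on_edges[OF dM _ xy])
    fix x y assume e: "dual_edge M x y"
    have "coboundary (\<lambda>x. l \<bullet> star M x) x y = coboundary (\<lambda>x. l' \<bullet> star M x) x y + coboundary G x y"
      using fun_cong[OF fun_cong[OF G(2), of x], of y] e by (simp add: on_edges_def)
    then show "m \<bullet> star M x - G x = m \<bullet> star M y - G y"
      unfolding coboundary_def m_def inner_diff_left by linarith
  qed
  obtain x0 where x0: "x0 \<in> M" using M_ne by blast
  have "(\<lambda>x. m \<bullet> star M x) ` M \<subseteq> (\<lambda>t. t + (m \<bullet> star M x0 - G x0)) ` (G ` M)"
  proof (rule image_subsetI)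
    fix x assume x: "x \<in> M"
    have "m \<bullet> star M x = G x + (m \<bullet> star M x0 - G x0)" using const[OF x x0] by linarith
    then show "m \<bullet> star M x \<in> (\<lambda>t. t + (m \<bullet> star M x0 - G x0)) ` (G ` M)" using x by blast
  qed
  then have fin: "finite ((\<lambda>x. m \<bullet> star M x) ` M)"
    using spe_finite_values[OF z G(1)] by (meson finite_imageI finite_subset)
  have inT: "m \<bullet> k \<in> (\<lambda>x. m \<bullet> star M x) ` M" if k: "k \<in> interior W" for k
  proof -
    have "\<exists>t\<in>(\<lambda>x. m \<bullet> star M x) ` M. dist t (m \<bullet> k) < e" if e: "e > 0" for e
    proof -
      have n: "norm m + 1 > 0" using norm_ge_zero[of m] by linarith
      then have "e / (norm m + 1) > 0" using e by simp
      then obtain x where x: "x \<in> M" "norm (star M x - k) < e / (norm m + 1)" by (rule star_dense[OF k])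
      have "dist (m \<bullet> star M x) (m \<bullet> k) = \<bar>m \<bullet> (star M x - k)\<bar>" by (simp add: dist_real_def inner_diff_right)
      also have "\<dots> \<le> norm m * norm (star M x - k)" by (rule Cauchy_Schwarz_ineq2)
      also have "\<dots> \<le> (norm m + 1) * norm (star M x - k)" by (intro mult_right_mono) auto
      also have "\<dots> < e" using x(2) n by (simp add: pos_less_divide_eq mult.commute)
      finally show ?thesis using x(1) by blast
    qed
    then have "m \<bullet> k \<in> closure ((\<lambda>x. m \<bullet> star M x) ` M)" unfolding closure_approachable by blast
    then show ?thesis using finite_imp_closed[OF fin] by simp
  qed
  show "l = l'"
  proof (rule ccontr)
    assume "l \<noteq> l'"
    then have m0: "m \<noteq> 0" by (simp add: m_def)
    obtain w where "w \<in> interior W" using W_int by blast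
    then obtain e where e: "e > 0" "ball w e \<subseteq> interior W" using open_interior openE by blast
    define u where "u t = w + t *\<^sub>R m" for t
    define d where "d = e / norm m"
    have d: "d > 0" using e m0 by (simp add: d_def)
    have "m \<bullet> u t \<in> (\<lambda>x. m \<bullet> star M x) ` M" if "t \<in> {0<..<d}" for t
    proof -
      have "t * norm m < e" using that m0 by (simp add: d_def pos_less_divide_eq)
      then have "u t \<in> ball w e" using that by (simp add: u_def dist_norm)
      then show ?thesis using inT e(2) by blast
    qed
    then have "(\<lambda>t. m \<bullet> u t) ` {0<..<d} \<subseteq> (\<lambda>x. m \<bullet> star M x) ` M" by blast
    then have "finite ((\<lambda>t. m \<bullet> u t) ` {0<..<d})" using fin finite_subset by blast
    moreover have "inj_on (\<lambda>t. m \<bullet> u t) {0<..<d}"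
      using m0 by (intro inj_onI) (simp add: u_def inner_add_right)
    ultimately have "finite {0<..<d}" by (rule finite_imageD)
    then show False using infinite_Ioo[OF d] by blast
  qed
qed

text \<open>
  The vectors with integral inner products with the lattice span, so some real combination of the
  classes of characters is the class of \<open>- ((- l, 0) \<bullet> (star M x, x))\<close>, which is \<open>l \<bullet> star M x\<close>.
\<close>

lemma star_class_max:
  assumes M: "M \<in> window_hull \<Gamma> W"
  shows "star_class M l \<in> H1_max \<Gamma> W M"
proof -
  obtain m :: nat and r a where ra: "\<forall>k<m. \<forall>\<gamma>\<in>\<Gamma>. a k \<bullet> \<gamma> \<in> \<int>" "(- l, 0) = (\<Sum>k<m. r k *\<^sub>R a k)"
    using lattice_dual_span[OF lat, of "(- l, 0)"] by blast
  have "\<forall>k\<in>{..<m}. \<exists>q. continuous_map (torus_topology \<Gamma>) circle (fst q) \<and>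
    bruschlinsky_lift M (fst q \<circ> pi_max \<Gamma> W) (fst (snd q)) \<and> spe M M (fst (snd (snd q))) \<and>
    (\<forall>y\<in>M. fst (snd q) y = snd (snd (snd q)) - a k \<bullet> (star M y, y) + fst (snd (snd q)) y)"
  proof
    fix k assume "k \<in> {..<m}"
    then have "\<And>\<gamma>. \<gamma> \<in> \<Gamma> \<Longrightarrow> a k \<bullet> \<gamma> \<in> \<int>" using ra(1) by blast
    from character_lift[OF M this] obtain g \<tau> G c where
      "continuous_map (torus_topology \<Gamma>) circle g \<and> bruschlinsky_lift M (g \<circ> pi_max \<Gamma> W) \<tau> \<and> spe M M G \<and>
       (\<forall>y\<in>M. \<tau> y = c - a k \<bullet> (star M y, y) + G y)" by blast
    then show "\<exists>q. continuous_map (torus_topology \<Gamma>) circle (fst q) \<and>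
      bruschlinsky_lift M (fst q \<circ> pi_max \<Gamma> W) (fst (snd q)) \<and> spe M M (fst (snd (snd q))) \<and>
      (\<forall>y\<in>M. fst (snd q) y = snd (snd (snd q)) - a k \<bullet> (star M y, y) + fst (snd (snd q)) y)"
      by (intro exI[of _ "(g, \<tau>, G, c)"]) simp
  qed
  from bchoice[OF this] obtain q where q: "\<forall>k\<in>{..<m}. continuous_map (torus_topology \<Gamma>) circle (fst (q k)) \<and>
    bruschlinsky_lift M (fst (q k) \<circ> pi_max \<Gamma> W) (fst (snd (q k))) \<and> spe M M (fst (snd (snd (q k)))) \<and>
    (\<forall>y\<in>M. fst (snd (q k)) y = snd (snd (snd (q k))) - a k \<bullet> (star M y, y) + fst (snd (snd (q k))) y)" ..
  define g where "g k = fst (q k)" for k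
  define \<tau> where "\<tau> k = fst (snd (q k))" for k
  define G where "G k = fst (snd (snd (q k)))" for k
  define c where "c k = snd (snd (snd (q k)))" for k
  have q': "\<forall>k<m. continuous_map (torus_topology \<Gamma>) circle (g k) \<and> bruschlinsky_lift M (g k \<circ> pi_max \<Gamma> W) (\<tau> k)"
    "\<forall>k<m. spe M M (G k)" "\<And>k y. k < m \<Longrightarrow> y \<in> M \<Longrightarrow> \<tau> k y = c k - a k \<bullet> (star M y, y) + G k y"
    using q unfolding g_def \<tau>_def G_def c_def by auto
  have spe: "spe M M (\<lambda>x. \<Sum>k<m. r k * G k x)" by (rule spe_scaled_sum[OF q'(2)])
  have "coh_class M (\<lambda>x y. \<Sum>k<m. r k * on_edges M (coboundary (\<tau> k)) x y) = star_class M l"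
    unfolding star_class_def
  proof (rule coh_class_eqI[OF spe])
    fix x y
    show "(\<Sum>k<m. r k * on_edges M (coboundary (\<tau> k)) x y) =
        on_edges M (coboundary (\<lambda>x. l \<bullet> star M x)) x y + on_edges M (coboundary (\<lambda>x. \<Sum>k<m. r k * G k x)) x y"
    proof (cases "dual_edge M x y")
      case True
      then have xy: "x \<in> M" "y \<in> M" using dual_edge_mem by blast+
      define v where "v = (star M y, y) - (star M x, x)"
      have "r k * (\<tau> k y - \<tau> k x) = - ((r k *\<^sub>R a k) \<bullet> v) + (r k * G k y - r k * G k x)" if "k < m" for k
        unfolding q'(3)[OF that xy(1)] q'(3)[OF that xy(2)] v_def
        by (simp only: inner_diff_right inner_scaleR_left) (simp add: algebra_simps)
      then have "(\<Sum>k<m. r k * (\<tau> k y - \<tau> k x)) =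
          (\<Sum>k<m. - ((r k *\<^sub>R a k) \<bullet> v) + (r k * G k y - r k * G k x))" by (intro sum.cong) auto
      also have "\<dots> = - ((\<Sum>k<m. r k *\<^sub>R a k) \<bullet> v) + ((\<Sum>k<m. r k * G k y) - (\<Sum>k<m. r k * G k x))"
        unfolding sum.distrib sum_subtractf sum_negf inner_sum_left by simp
      also have "- ((\<Sum>k<m. r k *\<^sub>R a k) \<bullet> v) = l \<bullet> (star M y - star M x)"
        unfolding ra(2)[symmetric] v_def by simp
      finally show ?thesis using True unfolding on_edges_def coboundary_def by (simp add: inner_diff_right)
    qed (simp add: on_edges_def)
  qed
  then show ?thesis unfolding H1_max_def using q'(1) by blast
qed

theorem analytic_cohomology:
  assumes M: "M \<in> window_hull \<Gamma> W" and poly: "polyhedral_window W"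
  shows "has_coh_dim M (H1_an M) DIM('h)" "H1_an M \<subseteq> H1_max \<Gamma> W M"
proof -
  show "H1_an M \<subseteq> H1_max \<Gamma> W M"
    unfolding H1_an_eq[OF M poly] using star_class_max[OF M] by blast
  obtain e where e: "bij_betw e {..<DIM('h)} (Basis :: 'h set)"
    using ex_bij_betw_nat_finite[OF finite_Basis] unfolding atLeast0LessThan by blast
  have eB: "e i \<in> Basis" if "i < DIM('h)" for i using e that by (auto simp: bij_betw_def)
  define b where "b i = on_edges M (coboundary (\<lambda>x. e i \<bullet> star M x))" for i
  define comb where "comb c = (\<Sum>i<DIM('h). c i *\<^sub>R e i)" for c :: "nat \<Rightarrow> real"
  have b: "\<forall>i<DIM('h). b i \<in> spe_cocycles1 M"
    unfolding b_def using coboundary_cocycle linear_star_spe2[OF M] by blast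
  have cls: "coh_class M (\<lambda>x y. \<Sum>i<DIM('h). c i * b i x y) = star_class M (comb c)" for c
  proof -
    have "(\<Sum>i<DIM('h). c i * b i x y) = on_edges M (coboundary (\<lambda>x. comb c \<bullet> star M x)) x y" for x y
      unfolding b_def comb_def on_edges_def coboundary_def
      by (simp add: inner_sum_left right_diff_distrib sum_subtractf)
    then show ?thesis unfolding star_class_def by presburger
  qed
  have comb_e: "comb c \<bullet> e j = c j" if j: "j < DIM('h)" for c j
  proof -
    have "e i \<bullet> e j = (if i = j then 1 else 0)" if "i < DIM('h)" for i
      using inner_Basis[OF eB[OF that] eB[OF j]] e that j by (auto simp: bij_betw_def inj_on_def)
    then have "(\<Sum>i<DIM('h). c i * (e i \<bullet> e j)) = (\<Sum>i<DIM('h). if i = j then c i else 0)"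
      by (intro sum.cong) auto
    then show ?thesis using j by (simp add: comb_def inner_sum_left)
  qed
  have "bij_betw comb ({..<DIM('h)} \<rightarrow>\<^sub>E UNIV) UNIV"
  proof (rule bij_betwI')
    fix c c' assume c: "c \<in> {..<DIM('h)} \<rightarrow>\<^sub>E (UNIV :: real set)" and c': "c' \<in> {..<DIM('h)} \<rightarrow>\<^sub>E (UNIV :: real set)"
    show "comb c = comb c' \<longleftrightarrow> c = c'"
    proof
      assume eq: "comb c = comb c'"
      show "c = c'"
      proof (rule PiE_ext[OF c c'])
        fix i assume "i \<in> {..<DIM('h)}"
        then show "c i = c' i" using comb_e[of i c] comb_e[of i c'] eq by simp
      qed
    qed simp
  next
    fix l :: 'h
    have "(\<Sum>i<DIM('h). (l \<bullet> e i) *\<^sub>R e i) = (\<Sum>u\<in>Basis. (l \<bullet> u) *\<^sub>R u)"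
      by (rule sum.reindex_bij_betw[OF e])
    then have "comb (\<lambda>i\<in>{..<DIM('h)}. l \<bullet> e i) = l"
      unfolding comb_def by (simp add: euclidean_representation)
    then show "\<exists>c\<in>{..<DIM('h)} \<rightarrow>\<^sub>E UNIV. l = comb c"
      by (intro bexI[of _ "\<lambda>i\<in>{..<DIM('h)}. l \<bullet> e i"]) auto
  qed simp
  moreover have "bij_betw (star_class M) UNIV (H1_an M)"
    unfolding H1_an_eq[OF M poly] by (rule inj_on_imp_bij_betw[OF star_class_inj[OF M poly]])
  ultimately have "bij_betw (star_class M \<circ> comb) ({..<DIM('h)} \<rightarrow>\<^sub>E UNIV) (H1_an M)"
    by (rule bij_betw_trans)
  then show "has_coh_dim M (H1_an M) DIM('h)"
    unfolding has_coh_dim_def using b by (intro exI[of _ b]) (simp add: o_def cls)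
qed

end

theorem theorem1p3:
  fixes \<Gamma> :: "((real ^ 'n) \<times> (real ^ 'd)) set"
    and W :: "(real ^ 'n) set"
    and M :: "(real ^ 'd) set"
  assumes "model_set \<Gamma> W M"
    and "polyhedral_window W"
  shows "has_coh_dim M (H1_an M) CARD('n) \<and> H1_an M \<subseteq> H1_max \<Gamma> W M"
proof -
  have "scheme \<Gamma> W" and M: "M \<in> window_hull \<Gamma> W"
    using assms(1) unfolding model_set_def cut_and_project_scheme_def scheme_def by blast+
  then interpret scheme \<Gamma> W by blast
  show ?thesis using analytic_cohomology[OF M assms(2)] by simp
qed

end
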